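(* Let $H$ and $B$ be conjugate harmonic functions of $(x^1,x^2)$ and let $\mathcal{E}_p$, $H_p=\mathrm{Re}\,\mathcal{E}_p$, $B_p=\mathrm{Im}\,\mathcal{E}_p$ and $\mathcal{F}_{2n-1}$ be defined from $\mathcal{E}_1=H+iB$ as in the context. Outside the singularities of these functions the following hold. (i) For every integer $n\ge0$ (level $2+6n$), the metric $$ds^2=\mathcal{F}_{2n-1}\bar{\mathcal{F}}_{2n-1}H_{2n+1}^{2/3}\big[(dx^1)^2+(dx^2)^2\big]+H_{2n+1}^{2/3}\big[(dx^9)^2+(dx^{10})^2+(dx^{11})^2\big]+H_{2n+1}^{-1/3}\big[(-1)^{n+1}(dx^3)^2+(-1)^n(dx^4)^2+\dots+(-1)^n(dx^8)^2\big]$$ with 3-form potential $A_{9\,10\,11}=(-1)^nB_{2n+1}$ solves the bosonic equations of motion of eleven-dimensional supergravity (signature $(1,10,+)$, time in 3) if $n$ is even, and of its exotic counterpart of signature $(5,6,+)$ (times in 4, 5, 6, 7, 8) if $n$ is odd. (ii) For every integer $n>0$ (level $-2+6n$), the metric $$ds^2=\mathcal{F}_{2n-1}\bar{\mathcal{F}}_{2n-1}H_{2n}^{2/3}\big[(dx^1)^2+(dx^2)^2\big]+H_{2n}^{2/3}\big[(dx^9)^2+(dx^{10})^2+(dx^{11})^2\big]+H_{2n}^{-1/3}\big[(-1)^{n}(dx^3)^2+(-1)^{n+1}(dx^4)^2+\dots+(-1)^{n+1}(dx^8)^2\big]$$ with $A_{9\,10\,11}=(-1)^{n+1}B_{2n}$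 solves the bosonic equations of motion of eleven-dimensional supergravity (signature $(1,10,+)$, time in 3) if $n$ is odd, and of its exotic counterpart of signature $(5,6,+)$ (times in 4, 5, 6, 7, 8) if $n$ is even.
   Context: Coordinates are $x^1,\dots,x^{11}$; all fields depend only on $(x^1,x^2)$, and $z=x^1+ix^2$. $H,B$ are real functions with $\partial_1H=\partial_2B$, $\partial_2H=-\partial_1B$, so $\mathcal{E}_1=H+iB$ is analytic in $z$. Define recursively $$\mathcal{E}_{2n}=\frac{1}{\mathcal{E}_{2n-1}},\qquad \mathcal{E}_{2n+1}=2-\mathcal{E}_{2n}\qquad(n>0),$$ $$H_p=\mathrm{Re}\,\mathcal{E}_p,\quad B_p=\mathrm{Im}\,\mathcal{E}_p,\qquad \mathcal{F}_{-1}=1,\qquad \mathcal{F}_{2n-1}=\mathcal{E}_1\mathcal{E}_3\cdots\mathcal{E}_{2n-1}\quad(n>0).$$ Everything is considered on an open set of the $(x^1,x^2)$-plane on which all functions entering are defined, the $\mathcal{E}_p$ involved are nonzero, and the function $H_p$ entering the metric is positive (so that the metric has the stated signature). The bosonic equations of motion are the Euler–Lagrange equations of $\int d^{11}x\sqrt{|g|}\big(R-\frac{1}{2\cdot4!}F_{\mu\nu\rho\sigma}F^{\mu\nu\rho\sigma}\big)$ plus a Chern–Simons term proportional to $\int A\wedge F\wedge F$, where $F_{\mu\nu\rho\sigma}=4\,\partial_{[\mu}A_{\nu\rho\sigma]}$. The only nonvanishing components of $A$ are $A_{9\,10\,11}$ and its antisymmetric permutations. The notation $(t,s,+)$ denotes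 such a theory with $t$ time and $s$ space directions and the usual sign of the kinetic term. *)

theory Defs
  imports "HOL-Analysis.Analysis"
begin

section \<open>Coordinates and derivatives\<close>

text \<open>
  The index type \<open>11\<close> consists of the residues modulo 11, so the coordinates
  \<open>x$1, \<dots>, x$10, x$11\<close> are pairwise distinct and exhaust the components of \<open>x\<close>,
  but \<open>11 = 0\<close> in the index type. Its order (and hence any interval of indices) is not used.
\<close>

type_synonym point = "real^11"
type_synonym metric = "real^11^11"
type_synonym three_form = "real^11^11^11"

definition dir_deriv ::
    "('a::real_normed_vector \<Rightarrow> 'b::real_normed_vector) \<Rightarrow> 'a \<Rightarrow> 'a \<Rightarrow> 'b" where
  "dir_deriv f x v = vector_derivative (\<lambda>t::real. f (x + t *\<^sub>R v)) (at 0)"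

definition pd :: "11 \<Rightarrow> (point \<Rightarrow> 'b::real_normed_vector) \<Rightarrow> point \<Rightarrow> 'b" where
  "pd r f x = dir_deriv f x (axis r 1)"

definition grad :: "(point \<Rightarrow> 'b::real_normed_vector) \<Rightarrow> point \<Rightarrow> 'b^11" where
  "grad f x = (\<chi> r. pd r f x)"

definition C2_on :: "point set \<Rightarrow> (point \<Rightarrow> 'b::real_normed_vector) \<Rightarrow> bool" where
  "C2_on U f \<longleftrightarrow> f differentiable_on U \<and> grad f differentiable_on U
     \<and> continuous_on U (grad (grad f))"

section \<open>Euler--Lagrange expressions of second order Lagrangians\<close>

text \<open>
  A Lagrangian \<open>L u p q\<close> is a function of the fields \<open>u\<close> and of the values
  \<open>p$r\<close> of \<open>\<partial>\<^sub>r u\<close> and \<open>q$r$s\<close> of \<open>\<partial>\<^sub>r \<partial>\<^sub>s u\<close>.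
  The expression below is
  \[ \frac{\partial L}{\partial u} - \partial_r \frac{\partial L}{\partial (\partial_r u)}
     + \partial_r \partial_s \frac{\partial L}{\partial (\partial_r \partial_s u)} \]
  contracted with a constant variation \<open>v\<close> of the fields. All \<open>q$r$s\<close> are varied
  independently, hence the last term is summed over all ordered pairs \<open>(r, s)\<close>.
\<close>

definition euler_lagrange ::
    "('u::real_normed_vector \<Rightarrow> 'u^11 \<Rightarrow> 'u^11^11 \<Rightarrow> real) \<Rightarrow> (point \<Rightarrow> 'u) \<Rightarrow> 'u \<Rightarrow> point \<Rightarrow> real" where
  "euler_lagrange L u v x =
     dir_deriv (\<lambda>w. L w (grad u x) (grad (grad u) x)) (u x) v
     - (\<Sum>r\<in>UNIV. pd r (\<lambda>y. dir_deriv (\<lambda>p. L (u y) p (grad (grad u) y)) (grad u y) (axis r v)) x)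
     + (\<Sum>r\<in>UNIV. \<Sum>s\<in>UNIV. pd r (pd s (\<lambda>y.
          dir_deriv (\<lambda>q. L (u y) (grad u y) q) (grad (grad u) y) (axis r (axis s v)))) x)"

section \<open>Curvature\<close>

text \<open>
  The arguments are the metric \<open>G$m$n\<close>, its first derivatives
  \<open>P$r$m$n = \<partial>\<^sub>r G$m$n\<close> and its second derivatives \<open>Q$r$s$m$n = \<partial>\<^sub>r \<partial>\<^sub>s G$m$n\<close>.
  Derivatives of the Christoffel symbols are expanded with the product rule and
  \<open>\<partial>\<^sub>l G\<^sup>-\<^sup>1 = - G\<^sup>-\<^sup>1 (\<partial>\<^sub>l G) G\<^sup>-\<^sup>1\<close>.
\<close>

definition christoffel :: "metric \<Rightarrow> metric^11 \<Rightarrow> 11 \<Rightarrow> 11 \<Rightarrow> 11 \<Rightarrow> real" where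
  "christoffel G P k m n =
     (\<Sum>s\<in>UNIV. matrix_inv G $ k $ s * (P$m$n$s + P$n$m$s - P$s$m$n)) / 2"

definition d_inverse :: "metric \<Rightarrow> metric^11 \<Rightarrow> 11 \<Rightarrow> metric" where
  "d_inverse G P l = - (matrix_inv G ** P$l ** matrix_inv G)"

definition d_christoffel ::
    "metric \<Rightarrow> metric^11 \<Rightarrow> metric^11^11 \<Rightarrow> 11 \<Rightarrow> 11 \<Rightarrow> 11 \<Rightarrow> 11 \<Rightarrow> real" where
  "d_christoffel G P Q l k m n =
     (\<Sum>s\<in>UNIV. d_inverse G P l $ k $ s * (P$m$n$s + P$n$m$s - P$s$m$n)
              + matrix_inv G $ k $ s * (Q$l$m$n$s + Q$l$n$m$s - Q$l$s$m$n)) / 2"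

text \<open>
  \<open>riemann G P Q k l m n\<close> is
  \<open>R\<^sup>k\<^sub>l\<^sub>m\<^sub>n = \<partial>\<^sub>m \<Gamma>\<^sup>k\<^sub>n\<^sub>l - \<partial>\<^sub>n \<Gamma>\<^sup>k\<^sub>m\<^sub>l + \<Gamma>\<^sup>k\<^sub>m\<^sub>s \<Gamma>\<^sup>s\<^sub>n\<^sub>l - \<Gamma>\<^sup>k\<^sub>n\<^sub>s \<Gamma>\<^sup>s\<^sub>m\<^sub>l\<close>;
  with this sign and the contraction below, round spheres have positive scalar curvature.
\<close>

definition riemann ::
    "metric \<Rightarrow> metric^11 \<Rightarrow> metric^11^11 \<Rightarrow> 11 \<Rightarrow> 11 \<Rightarrow> 11 \<Rightarrow> 11 \<Rightarrow> real" where
  "riemann G P Q k l m n =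
     d_christoffel G P Q m k n l - d_christoffel G P Q n k m l
     + (\<Sum>s\<in>UNIV. christoffel G P k m s * christoffel G P s n l
                - christoffel G P k n s * christoffel G P s m l)"

definition ricci :: "metric \<Rightarrow> metric^11 \<Rightarrow> metric^11^11 \<Rightarrow> 11 \<Rightarrow> 11 \<Rightarrow> real" where
  "ricci G P Q l n = (\<Sum>k\<in>UNIV. riemann G P Q k l k n)"

definition scalar_curvature :: "metric \<Rightarrow> metric^11 \<Rightarrow> metric^11^11 \<Rightarrow> real" where
  "scalar_curvature G P Q = (\<Sum>l\<in>UNIV. \<Sum>n\<in>UNIV. matrix_inv G $ l $ n * ricci G P Q l n)"

section \<open>The bosonic action of eleven-dimensional supergravity\<close>

definition antisymmetric :: "three_form \<Rightarrow> bool" where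
  "antisymmetric A \<longleftrightarrow> (\<forall>i j k. A$i$j$k = - A$j$i$k \<and> A$i$j$k = - A$i$k$j)"

text \<open>
  \<open>F\<^sub>m\<^sub>n\<^sub>r\<^sub>s = 4 \<partial>\<^sub>[\<^sub>m A\<^sub>n\<^sub>r\<^sub>s\<^sub>]\<close> for antisymmetric \<open>A\<close>, where \<open>D$m = \<partial>\<^sub>m A\<close> and
  the bracket antisymmetrises with weight one.
\<close>

definition field_strength :: "three_form^11 \<Rightarrow> 11 \<Rightarrow> 11 \<Rightarrow> 11 \<Rightarrow> 11 \<Rightarrow> real" where
  "field_strength D m n r s = D$m$n$r$s - D$n$m$r$s + D$r$m$n$s - D$s$m$n$r"

definition field_strength_square :: "metric \<Rightarrow> three_form^11 \<Rightarrow> real" where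
  "field_strength_square G D =
     (\<Sum>m\<in>UNIV. \<Sum>n\<in>UNIV. \<Sum>r\<in>UNIV. \<Sum>s\<in>UNIV. \<Sum>m'\<in>UNIV. \<Sum>n'\<in>UNIV. \<Sum>r'\<in>UNIV. \<Sum>s'\<in>UNIV.
        matrix_inv G $ m $ m' * matrix_inv G $ n $ n' * matrix_inv G $ r $ r' * matrix_inv G $ s $ s'
        * field_strength D m n r s * field_strength D m' n' r' s')"

text \<open>The coefficient of \<open>dx\<^sup>1 \<and> \<dots> \<and> dx\<^sup>1\<^sup>1\<close> in \<open>A \<and> F \<and> F\<close>.\<close>

definition chern_simons :: "three_form \<Rightarrow> three_form^11 \<Rightarrow> real" where
  "chern_simons A D =
     (\<Sum>p | p permutes (UNIV :: 11 set). of_int (sign p) * A $ p 1 $ p 2 $ p 3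
        * field_strength D (p 4) (p 5) (p 6) (p 7) * field_strength D (p 8) (p 9) (p 10) (p 11))
     / (fact 3 * fact 4 * fact 4)"

text \<open>
  The Lagrangian density as a function of the fields \<open>(g, A)\<close> and their first and second
  derivatives; \<open>c\<close> is the coefficient of the Chern--Simons term.
\<close>

definition sugra_lagrangian ::
    "real \<Rightarrow> metric \<times> three_form \<Rightarrow> (metric \<times> three_form)^11 \<Rightarrow> (metric \<times> three_form)^11^11 \<Rightarrow> real" where
  "sugra_lagrangian c u p q =
     (let G = fst u; A = snd u; P = (\<chi> r. fst (p$r)); D = (\<chi> r. snd (p$r));
          Q = (\<chi> r s. fst (q$r$s))
      in sqrt \<bar>det G\<bar> * (scalar_curvature G P Q - 1 / (2 * fact 4) * field_strength_square G D)
         + c * chern_simons A D)"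

definition has_signature :: "metric \<Rightarrow> nat \<Rightarrow> nat \<Rightarrow> bool" where
  "has_signature G t s \<longleftrightarrow> transpose G = G \<and>
     (\<exists>P D :: metric. invertible P \<and> transpose P ** G ** P = D
        \<and> (\<forall>i j. i \<noteq> j \<longrightarrow> D$i$j = 0)
        \<and> card {i. D$i$i < 0} = t \<and> card {i. D$i$i > 0} = s)"

text \<open>
  Solutions on \<open>U\<close> of the bosonic equations of motion of the theory with \<open>t\<close> time and
  \<open>s\<close> space directions and the usual sign of the kinetic term. The fields are varied within
  symmetric metrics and antisymmetric potentials.
\<close>

definition sugra_solution ::
    "nat \<Rightarrow> nat \<Rightarrow> real \<Rightarrow> point set \<Rightarrow> (point \<Rightarrow> metric) \<Rightarrow> (point \<Rightarrow> three_form) \<Rightarrow> bool" where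
  "sugra_solution t s c U g A \<longleftrightarrow>
     C2_on U g \<and> C2_on U A \<and>
     (\<forall>x\<in>U. has_signature (g x) t s \<and> antisymmetric (A x)) \<and>
     (\<forall>x\<in>U. \<forall>h a. transpose h = h \<and> antisymmetric a \<longrightarrow>
        euler_lagrange (sugra_lagrangian c) (\<lambda>y. (g y, A y)) (h, a) x = 0)"

definition time_directions :: "metric \<Rightarrow> 11 set" where
  "time_directions G = {i. G$i$i < 0}"

section \<open>The functions \<open>\<E>\<^sub>p\<close> and \<open>\<F>\<^sub>2\<^sub>n\<^sub>-\<^sub>1\<close>\<close>

definition conjugate_harmonic ::
    "(real \<times> real) set \<Rightarrow> (real \<times> real \<Rightarrow> real) \<Rightarrow> (real \<times> real \<Rightarrow> real) \<Rightarrow> bool" where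
  "conjugate_harmonic \<Omega> H B \<longleftrightarrow>
     (\<forall>z\<in>\<Omega>. H differentiable (at z) \<and> B differentiable (at z) \<and>
        dir_deriv H z (1, 0) = dir_deriv B z (0, 1) \<and>
        dir_deriv H z (0, 1) = - dir_deriv B z (1, 0))"

text \<open>
  \<open>\<E> e p\<close> is the value of \<open>\<E>\<^sub>p\<close> at a point where \<open>\<E>\<^sub>1\<close> has the value \<open>e\<close>.
  The index 0 does not occur in the mathematics; its value is arbitrary.
\<close>

fun \<E> :: "complex \<Rightarrow> nat \<Rightarrow> complex" where
  "\<E> e 0 = 0"
| "\<E> e (Suc 0) = e"
| "\<E> e (Suc (Suc k)) = (if even k then 1 / \<E> e (Suc k) else 2 - \<E> e (Suc k))"

lemma \<E>_even: "n > 0 \<Longrightarrow> \<E> e (2 * n) = 1 / \<E> e (2 * n - 1)"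
  by (cases n) auto

lemma \<E>_odd: "n > 0 \<Longrightarrow> \<E> e (2 * n + 1) = 2 - \<E> e (2 * n)"
  by (cases n) auto

text \<open>\<open>\<F> e n\<close> is \<open>\<F>\<^sub>2\<^sub>n\<^sub>-\<^sub>1\<close>, so that \<open>\<F> e 0\<close> is \<open>\<F>\<^sub>-\<^sub>1 = 1\<close>.\<close>

definition \<F> :: "complex \<Rightarrow> nat \<Rightarrow> complex" where
  "\<F> e n = (\<Prod>k=1..n. \<E> e (2 * k - 1))"

section \<open>The metrics and the potential\<close>

text \<open>
  The diagonal metric
  \<open>w h\<^sup>2\<^sup>/\<^sup>3 [(dx\<^sup>1)\<^sup>2 + (dx\<^sup>2)\<^sup>2] + h\<^sup>2\<^sup>/\<^sup>3 [(dx\<^sup>9)\<^sup>2 + (dx\<^sup>1\<^sup>0)\<^sup>2 + (dx\<^sup>1\<^sup>1)\<^sup>2]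
     + h\<^sup>-\<^sup>1\<^sup>/\<^sup>3 [\<sigma> (dx\<^sup>3)\<^sup>2 + \<tau> (dx\<^sup>4)\<^sup>2 + \<dots> + \<tau> (dx\<^sup>8)\<^sup>2]\<close>.
\<close>

definition brane_metric :: "real \<Rightarrow> real \<Rightarrow> real \<Rightarrow> real \<Rightarrow> metric" where
  "brane_metric w h \<sigma> \<tau> = (\<chi> i j. if i \<noteq> j then 0
     else if i \<in> {1, 2} then w * h powr (2/3)
     else if i \<in> {9, 10, 11} then h powr (2/3)
     else if i = 3 then \<sigma> * h powr (-1/3)
     else \<tau> * h powr (-1/3))"

definition brane_potential :: "real \<Rightarrow> three_form" where
  "brane_potential a = (\<chi> i j k.
     if (i, j, k) \<in> {(9, 10, 11), (10, 11, 9), (11, 9, 10)} then a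
     else if (i, j, k) \<in> {(10, 9, 11), (9, 11, 10), (11, 10, 9)} then - a
     else 0)"

end

theory Submission
  imports Defs "HOL-Complex_Analysis.Cauchy_Integral_Formula"
begin

text \<open>
  With \<open>f\<^sub>k = ln \<bar>g\<^sub>k\<^sub>k\<bar> / 2\<close> the brane metrics satisfy \<open>f\<^sub>1 = f\<^sub>2\<close> and \<open>f\<^sub>3 + \<dots> + f\<^sub>1\<^sub>1 = 0\<close>, so that
  \<open>sqrt \<bar>det g\<bar> * g\<^sup>1\<^sup>1 = 1\<close>: the coordinates are harmonic and every second order operator that occurs
  is the flat Laplacian in \<open>x\<^sup>1, x\<^sup>2\<close>. All \<open>f\<^sub>k\<close> are combinations of \<open>ln w\<close> and \<open>ln h\<close>, where
  \<open>w = \<bar>\<F>\<bar>\<^sup>2\<close> and \<open>h = Re \<E>\<close>. Here \<open>ln w\<close> is harmonic because \<open>\<F>\<close> is holomorphic without zeros,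
  \<open>\<Delta> ln h = - \<bar>\<nabla> ln h\<bar>\<^sup>2\<close> because \<open>h\<close> is harmonic, and the Cauchy--Riemann equations give
  \<open>\<bar>\<nabla>b\<bar> = h * \<bar>\<nabla> ln h\<bar>\<close> and \<open>\<nabla>b \<bullet> \<nabla>h = 0\<close> for the potential \<open>b = \<plusminus> Im \<E>\<close>. Nothing else about the
  recursion for \<open>\<E>\<close> enters: for any such pair of holomorphic functions the field equations reduce to
  algebra. The signs of the directions 3 to 8 drop out, since only \<open>g\<^sub>k\<^sub>k * g\<^sup>k\<^sup>k = 1\<close> is used for them. The
  Chern--Simons term does not contribute because \<open>A\<close> and every nonzero component of \<open>F\<close> carry the index 9.
\<close>

section \<open>Determinant and inverse near a diagonal matrix\<close>

text \<open>The field equations are not presupposed: \<open>euler_lagrange\<close> differentiates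
  the Lagrangian itself, in the fields and independently in every entry of the first and second
  derivative arrays, and Einstein's equations must emerge from the three groups of terms. The
  inverse metric is therefore made a variable of explicit polynomials, and derivatives are taken
  only at a diagonal point, where the index sums collapse; the variation \<open>h\<close> is an
  arbitrary symmetric matrix. The group without derivatives contains the Ricci tensor twice, plus
  \<open>connection_square\<close>. Einstein's equations use up one Ricci tensor, and what remains
  equals H = -1/2 times the flat Laplacian of the sum of h_kk / g_kk. The first derivative group
  enters with -3 H and the second derivative group with +2 H, so that 1 - 3 + 2 = 0; the terms with
  h_rs for r, s in {1, 2} cancel between these two groups, and the part with \<open>a\<close> is the
  flux equation. The outer derivatives in directions 3 to 11 vanish because all fields depend on x1
  and x2 only, so the jet variations are evaluated for the first two directions alone.\<close>

lemma UNIV_11: "(UNIV :: 11 set) = {1,2,3,4,5,6,7,8,9,10,11}"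
  by (rule sym, rule card_subset_eq) auto

text \<open>Jacobi's formula at a diagonal matrix. Differentiation replaces one factor of a Leibniz
  term; a permutation other than the identity moves at least two indices, so an off-diagonal factor
  0 is left over.\<close>

lemma det_derivative_at_diagonal:
  fixes A M :: "real^'n^'n"
  assumes diag: "\<And>i j. i \<noteq> j \<Longrightarrow> A$i$j = 0"
  shows "((\<lambda>t. det (A + t *\<^sub>R M)) has_real_derivative (\<Sum>k\<in>UNIV. M$k$k * (\<Prod>i\<in>UNIV-{k}. A$i$i))) (at 0)"
proof -
  define D where "D p = of_int (sign p) * (\<Sum>k\<in>UNIV. M$k$p k * (\<Prod>i\<in>UNIV-{k}. A$i$p i))" for p :: "'n \<Rightarrow> 'n"
  have "((\<lambda>t. det (A + t *\<^sub>R M)) has_real_derivative (\<Sum>p | p permutes UNIV. D p)) (at 0)"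
    unfolding det_def D_def
    by (intro DERIV_sum DERIV_cmult, rule DERIV_cong, rule has_field_derivative_prod)
       (auto intro!: derivative_eq_intros)
  moreover have "D p = 0" if p: "p permutes UNIV" "p \<noteq> id" for p
  proof -
    have "(\<Prod>i\<in>UNIV-{k}. A$i$p i) = 0" for k
    proof -
      have "\<exists>i. i \<noteq> k \<and> p i \<noteq> i"
      proof (rule ccontr)
        assume "\<not> ?thesis"
        then have 1: "p i = i" if "i \<noteq> k" for i using that by blast
        have "inj p" using p(1) by (simp add: permutes_inj)
        then have "p k = k" using 1 by (metis injD)
        with 1 have "p = id" by (metis eq_id_iff)
        with p(2) show False by simp
      qed
      then obtain i where "i \<noteq> k" "p i \<noteq> i" by blast
      then show ?thesis
        using diag[of i "p i"] by (intro prod_zero) auto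
    qed
    then show ?thesis unfolding D_def by (simp only: mult_zero_right sum.neutral_const)
  qed
  then have "(\<Sum>p | p permutes UNIV. D p) = D id"
    by (subst sum.remove[of _ id]) (auto simp: permutes_id intro!: sum.neutral)
  ultimately show ?thesis by (simp add: D_def sign_id)
qed

lemma matrix_inv_mult:
  fixes A :: "real^'n^'n"
  assumes "det A \<noteq> 0"
  shows "A ** matrix_inv A = mat 1" "matrix_inv A ** A = mat 1"
proof -
  have "\<exists>B. A ** B = mat 1 \<and> B ** A = mat 1"
    using assms unfolding invertible_det_nz[symmetric] invertible_def by simp
  from someI_ex[OF this] show "A ** matrix_inv A = mat 1" "matrix_inv A ** A = mat 1"
    unfolding matrix_inv_def by auto
qed

text \<open>Quotients of determinants are continuous, and this is how continuity of the inverse is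
  obtained below.\<close>

lemma matrix_inv_cramer:
  fixes A :: "real^'n^'n"
  assumes "det A \<noteq> 0"
  shows "matrix_inv A $ k $ l = det (\<chi> i j. if j = k then axis l 1 $ i else A$i$j) / det A"
proof -
  have "A *v column l (matrix_inv A) = axis l 1"
    by (metis matrix_inv_mult(1)[OF assms] matrix_vector_mul_assoc matrix_vector_mul_lid matrix_vector_mult_basis)
  then have "column l (matrix_inv A) = (\<chi> k. det (\<chi> i j. if j = k then axis l 1 $ i else A$i$j) / det A)"
    unfolding cramer[OF assms] .
  then show ?thesis by (simp add: vec_eq_iff column_def)
qed

lemma continuous_det:
  fixes A :: "'a::t2_space \<Rightarrow> real^'n^'n"
  assumes "\<And>i j. continuous F (\<lambda>t. A t $ i $ j)"
  shows "continuous F (\<lambda>t. det (A t))"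
  unfolding det_def by (intro continuous_intros assms)

lemma matrix_add_mult:
  fixes A B C :: "real^'n^'n"
  shows "(A + B) ** C = A ** C + B ** C"
  by (simp add: matrix_matrix_mult_def vec_eq_iff sum.distrib algebra_simps)

text \<open>The resolvent identity \<open>eq\<close> expresses the difference quotient exactly
  through the inverse at \<open>t\<close>, so continuity of the inverse at 0 already gives the
  derivative.\<close>

lemma matrix_inv_derivative:
  fixes A M :: "real^'n^'n"
  assumes "det A \<noteq> 0"
  shows "((\<lambda>t. matrix_inv (A + t *\<^sub>R M) $ k $ l) has_real_derivative
            - (matrix_inv A ** M ** matrix_inv A) $ k $ l) (at 0)"
proof -
  let ?A = "\<lambda>t. A + t *\<^sub>R M"
  have cont: "isCont (\<lambda>t. det (?A t)) 0"
    by (intro continuous_det) (auto intro!: continuous_intros)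
  have ev: "eventually (\<lambda>t. det (?A t) \<noteq> 0) (nhds 0)"
    by (rule tendsto_imp_eventually_ne[of _ "det A"])
       (use cont assms tendsto_at_iff_tendsto_nhds[of "\<lambda>t. det (?A t)" 0] in \<open>auto simp: isCont_def\<close>)
  have inv: "isCont (\<lambda>t. matrix_inv (?A t) $ i $ j) 0" for i j
  proof -
    let ?B = "\<lambda>t. \<chi> i' j'. if j' = i then axis j 1 $ i' else ?A t$i'$j'"
    have "isCont (\<lambda>t. ?B t $ k $ l) 0" for k l
      by (cases "l = i") (auto intro!: continuous_intros)
    then have "isCont (\<lambda>t. det (?B t)) 0"
      by (rule continuous_det)
    with cont have "isCont (\<lambda>t. det (?B t) / det (?A t)) 0"
      using assms by (intro continuous_divide) auto
    moreover have "eventually (\<lambda>t. matrix_inv (?A t) $ i $ j = det (?B t) / det (?A t)) (nhds 0)"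
      using ev by eventually_elim (rule matrix_inv_cramer)
    ultimately show ?thesis
      by (subst isCont_cong)
  qed
  have eq: "matrix_inv (?A t) - matrix_inv A = - t *\<^sub>R (matrix_inv (?A t) ** M ** matrix_inv A)"
    if "det (?A t) \<noteq> 0" for t
  proof -
    have "matrix_inv (?A t) ** (?A t) ** matrix_inv A = matrix_inv A"
      using matrix_inv_mult(2)[OF that] by simp
    moreover have "matrix_inv (?A t) ** A ** matrix_inv A = matrix_inv (?A t)"
      using matrix_inv_mult(1)[OF assms] by (simp flip: matrix_mul_assoc)
    ultimately show ?thesis
      by (simp add: matrix_add_ldistrib matrix_add_mult matrix_scalar_ac flip: scalar_matrix_assoc)
         (simp add: algebra_simps)
  qed
  have "((\<lambda>t. - (matrix_inv (?A t) ** M ** matrix_inv A) $ k $ l) \<longlongrightarrow> - (matrix_inv (?A 0) ** M ** matrix_inv A) $ k $ l) (at 0)"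
  proof -
    have "((\<lambda>t. matrix_inv (?A t)) \<longlongrightarrow> matrix_inv (?A 0)) (at 0)"
      using inv by (intro vec_tendstoI) (simp add: isCont_def)
    then show ?thesis
      unfolding matrix_matrix_mult_def by (auto intro!: tendsto_intros)
  qed
  moreover have "eventually (\<lambda>t. (matrix_inv (?A t) $ k $ l - matrix_inv (?A 0) $ k $ l) / (t - 0) =
     - (matrix_inv (?A t) ** M ** matrix_inv A) $ k $ l) (at 0)"
    using ev unfolding eventually_at_filter
  proof eventually_elim
    case (elim t)
    from eq[OF elim] have "matrix_inv (?A t) $ k $ l - matrix_inv A $ k $ l
        = - t * (matrix_inv (?A t) ** M ** matrix_inv A) $ k $ l"
      by (simp add: vec_eq_iff)
    then show ?case by simp
  qed
  ultimately show ?thesis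
    unfolding has_field_derivative_iff
    by (subst tendsto_cong) (assumption, simp)
qed

lemma det_diagonal_nonzero:
  fixes A :: "real^'n^'n"
  assumes diag: "\<And>i j. i \<noteq> j \<Longrightarrow> A$i$j = 0" and "\<And>i. A$i$i \<noteq> 0"
  shows "det A \<noteq> 0"
  using assms by (simp add: det_diagonal)

lemma matrix_inv_diagonal:
  fixes A :: "real^'n^'n"
  assumes diag: "\<And>i j. i \<noteq> j \<Longrightarrow> A$i$j = 0" and "\<And>i. A$i$i \<noteq> 0"
  shows "matrix_inv A $ i $ j = (if i = j then 1 / A$i$i else 0)"
proof -
  have "det A \<noteq> 0" using assms by (rule det_diagonal_nonzero)
  then have "(A ** matrix_inv A) $ i $ j = mat 1 $ i $ j" by (simp add: matrix_inv_mult)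
  moreover have "(A ** matrix_inv A) $ i $ j = A$i$i * matrix_inv A $ i $ j"
    unfolding matrix_matrix_mult_def using diag by (simp, subst sum.remove[of _ i]) (auto intro!: sum.neutral)
  ultimately show ?thesis using assms(2)[of i] by (auto simp: mat_def field_simps)
qed

lemma matrix_inv_derivative_at_diagonal:
  fixes A M :: "real^'n^'n"
  assumes diag: "\<And>i j. i \<noteq> j \<Longrightarrow> A$i$j = 0" and "\<And>i. A$i$i \<noteq> 0"
  shows "((\<lambda>t. matrix_inv (A + t *\<^sub>R M) $ i $ j) has_real_derivative - (M$i$j / (A$i$i * A$j$j))) (at 0)"
proof -
  have "(matrix_inv A ** M ** matrix_inv A) $ i $ j = M$i$j / (A$i$i * A$j$j)"
    by (simp add: matrix_matrix_mult_def matrix_inv_diagonal[OF assms] if_distrib[of "\<lambda>x. x * _"] if_distrib[of "\<lambda>x. _ * x"] cong: if_cong)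
  with matrix_inv_derivative[OF det_diagonal_nonzero[OF assms], of M i j] show ?thesis by simp
qed

lemma sqrt_abs_det_derivative_at_diagonal:
  fixes A M :: "real^'n^'n"
  assumes diag: "\<And>i j. i \<noteq> j \<Longrightarrow> A$i$j = 0" and nz: "\<And>i. A$i$i \<noteq> 0"
  shows "((\<lambda>t. sqrt \<bar>det (A + t *\<^sub>R M)\<bar>) has_real_derivative
           sqrt \<bar>det A\<bar> * (\<Sum>k\<in>UNIV. M$k$k / A$k$k) / 2) (at 0)"
proof -
  have d: "det A \<noteq> 0" using assms by (rule det_diagonal_nonzero)
  have "(\<Sum>k\<in>UNIV. M$k$k * (\<Prod>i\<in>UNIV-{k}. A$i$i)) = det A * (\<Sum>k\<in>UNIV. M$k$k / A$k$k)"
    using nz by (simp add: det_diagonal[OF diag] sum_distrib_left prod_diff1 mult.commute)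
  with det_derivative_at_diagonal[of A M, OF diag]
  have *: "((\<lambda>t. det (A + t *\<^sub>R M)) has_real_derivative det A * (\<Sum>k\<in>UNIV. M$k$k / A$k$k)) (at 0)"
    by simp
  \<comment> \<open>The determinant keeps its sign near \<open>t = 0\<close>; multiplying by this
    sign replaces the absolute value by a differentiable function.\<close>
  define s where "s = sgn (det A)"
  have s: "s * det A = \<bar>det A\<bar>" by (simp add: s_def abs_sgn mult.commute)
  have "((\<lambda>t. sqrt (s * det (A + t *\<^sub>R M))) has_real_derivative
           inverse (sqrt \<bar>det A\<bar>) / 2 * (s * (det A * (\<Sum>k\<in>UNIV. M$k$k / A$k$k)))) (at 0)"
    using d s by (auto intro!: derivative_eq_intros * simp: mult.commute)
  also have "inverse (sqrt \<bar>det A\<bar>) / 2 * (s * (det A * (\<Sum>k\<in>UNIV. M$k$k / A$k$k)))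
     = inverse (sqrt \<bar>det A\<bar>) * \<bar>det A\<bar> * (\<Sum>k\<in>UNIV. M$k$k / A$k$k) / 2"
    unfolding s[symmetric] by simp
  also have "inverse (sqrt \<bar>det A\<bar>) * \<bar>det A\<bar> = sqrt \<bar>det A\<bar>"
    using real_div_sqrt[of "\<bar>det A\<bar>"] by (simp add: field_simps)
  finally have D: "((\<lambda>t. sqrt (s * det (A + t *\<^sub>R M))) has_real_derivative
      sqrt \<bar>det A\<bar> * (\<Sum>k\<in>UNIV. M$k$k / A$k$k) / 2) (at 0)" .
  have "isCont (\<lambda>t. det (A + t *\<^sub>R M)) 0" using * by (rule DERIV_isCont)
  then have "((\<lambda>t. s * det (A + t *\<^sub>R M)) \<longlongrightarrow> \<bar>det A\<bar>) (nhds 0)"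
    using s tendsto_at_iff_tendsto_nhds[of "\<lambda>t. s * det (A + t *\<^sub>R M)" 0]
    by (auto simp: isCont_def intro!: tendsto_eq_intros)
  then have "eventually (\<lambda>t. 0 < s * det (A + t *\<^sub>R M)) (nhds 0)"
    using d by (intro order_tendstoD) auto
  then have "eventually (\<lambda>t. sqrt (s * det (A + t *\<^sub>R M)) = sqrt \<bar>det (A + t *\<^sub>R M)\<bar>) (nhds 0)"
    by eventually_elim (auto simp: s_def sgn_real_def abs_if split: if_splits)
  from DERIV_cong_ev[OF refl this refl] D show ?thesis by blast
qed

section \<open>The scalar curvature as a polynomial in the inverse metric\<close>

text \<open>Christoffel symbols of the first kind; the lowered index comes last.\<close>

definition christoffel_lower :: "metric^11 \<Rightarrow> 11 \<Rightarrow> 11 \<Rightarrow> 11 \<Rightarrow> real" where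
  "christoffel_lower P m n s = (P$m$n$s + P$n$m$s - P$s$m$n) / 2"

text \<open>The part of the lowered Riemann tensor with second derivatives. The terms
  \<open>Q$m$n$l$k\<close> and \<open>Q$n$m$l$k\<close> cancel only for commuting derivatives; both
  are kept because the Lagrangian is varied in each \<open>q$r$s\<close> separately.\<close>

definition riemann_linear :: "metric^11^11 \<Rightarrow> 11 \<Rightarrow> 11 \<Rightarrow> 11 \<Rightarrow> 11 \<Rightarrow> real" where
  "riemann_linear Q k l m n =
     (Q$m$n$l$k + Q$m$l$n$k - Q$m$k$n$l - Q$n$m$l$k - Q$n$l$m$k + Q$n$k$m$l) / 2"

text \<open>
  With \<open>\<partial>g\<close> written as a sum of two Christoffel symbols of the first kind, the derivative of the
  inverse metric cancels the quadratic terms of the Riemann tensor and leaves similar ones with the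
  opposite sign.
\<close>

definition riemann_lower :: "metric \<Rightarrow> metric^11 \<Rightarrow> metric^11^11 \<Rightarrow> 11 \<Rightarrow> 11 \<Rightarrow> 11 \<Rightarrow> 11 \<Rightarrow> real" where
  "riemann_lower I P Q k l m n = riemann_linear Q k l m n
     + (\<Sum>b\<in>UNIV. \<Sum>c\<in>UNIV. I$b$c * (christoffel_lower P n k b * christoffel_lower P m l c
                               - christoffel_lower P m k b * christoffel_lower P n l c))"

lemma christoffel_raise:
  "christoffel G P k m n = (\<Sum>s\<in>UNIV. matrix_inv G $ k $ s * christoffel_lower P m n s)"
  by (simp add: christoffel_def christoffel_lower_def sum_divide_distrib)

lemma d_christoffel_lower:
  assumes "\<And>r m n. P$r$m$n = P$r$n$m"
  shows "d_christoffel G P Q l k m n =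
    (\<Sum>a\<in>UNIV. matrix_inv G $ k $ a * ((Q$l$m$n$a + Q$l$n$m$a - Q$l$a$m$n) / 2))
   - (\<Sum>a\<in>UNIV. matrix_inv G $ k $ a * (\<Sum>b\<in>UNIV. (christoffel_lower P l a b + christoffel_lower P l b a) * christoffel G P b m n))"
proof -
  have 1: "P$l$a$b = christoffel_lower P l a b + christoffel_lower P l b a" for a b
    by (simp add: christoffel_lower_def assms[of l b a] field_simps)
  have "(\<Sum>s\<in>UNIV. d_inverse G P l $ k $ s * christoffel_lower P m n s)
     = - (\<Sum>s\<in>UNIV. \<Sum>b\<in>UNIV. \<Sum>a\<in>UNIV. matrix_inv G $ k $ a * P$l$a$b * matrix_inv G $ b $ s * christoffel_lower P m n s)"
    by (simp add: d_inverse_def matrix_matrix_mult_def sum_distrib_right sum_negf)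
  also have "(\<Sum>s\<in>UNIV. \<Sum>b\<in>UNIV. \<Sum>a\<in>UNIV. matrix_inv G $ k $ a * P$l$a$b * matrix_inv G $ b $ s * christoffel_lower P m n s)
     = (\<Sum>b\<in>UNIV. \<Sum>s\<in>UNIV. \<Sum>a\<in>UNIV. matrix_inv G $ k $ a * P$l$a$b * matrix_inv G $ b $ s * christoffel_lower P m n s)"
    by (rule sum.swap)
  also have "\<dots> = (\<Sum>b\<in>UNIV. \<Sum>a\<in>UNIV. \<Sum>s\<in>UNIV. matrix_inv G $ k $ a * P$l$a$b * matrix_inv G $ b $ s * christoffel_lower P m n s)"
    by (rule sum.cong[OF refl], rule sum.swap)
  also have "\<dots> = (\<Sum>a\<in>UNIV. \<Sum>b\<in>UNIV. \<Sum>s\<in>UNIV. matrix_inv G $ k $ a * P$l$a$b * matrix_inv G $ b $ s * christoffel_lower P m n s)"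
    by (rule sum.swap)
  also have "\<dots> = (\<Sum>a\<in>UNIV. matrix_inv G $ k $ a * (\<Sum>b\<in>UNIV. P$l$a$b * christoffel G P b m n))"
    by (simp add: christoffel_raise sum_distrib_left mult.assoc)
  finally have "(\<Sum>s\<in>UNIV. d_inverse G P l $ k $ s * christoffel_lower P m n s)
     = - (\<Sum>a\<in>UNIV. matrix_inv G $ k $ a * (\<Sum>b\<in>UNIV. P$l$a$b * christoffel G P b m n))" .
  moreover have "d_christoffel G P Q l k m n = (\<Sum>s\<in>UNIV. d_inverse G P l $ k $ s * christoffel_lower P m n s) +
     (\<Sum>a\<in>UNIV. matrix_inv G $ k $ a * ((Q$l$m$n$a + Q$l$n$m$a - Q$l$a$m$n) / 2))"
    by (simp add: d_christoffel_def christoffel_lower_def sum_divide_distrib add_divide_distrib flip: sum.distrib)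
  ultimately show ?thesis
    by (simp add: 1)
qed

lemma riemann_eq:
  assumes sym: "\<And>r m n. P$r$m$n = P$r$n$m"
  shows "riemann G P Q k l m n = (\<Sum>a\<in>UNIV. matrix_inv G $ k $ a * riemann_lower (matrix_inv G) P Q a l m n)"
proof -
  let ?I = "\<lambda>i j. matrix_inv G $ i $ j" and ?C = "christoffel_lower P" and ?G = "christoffel G P"
  have 1: "(\<Sum>s\<in>UNIV. ?G k m s * ?G s n l) = (\<Sum>a\<in>UNIV. ?I k a * (\<Sum>b\<in>UNIV. ?C m b a * ?G b n l))" for m n
    by (simp add: christoffel_raise[of G P k] sum_distrib_right sum_distrib_left mult.assoc) (rule sum.swap)
  have 2: "riemann_lower (matrix_inv G) P Q a l m n = riemann_linear Q a l m n
      + (\<Sum>b\<in>UNIV. ?C n a b * ?G b m l) - (\<Sum>b\<in>UNIV. ?C m a b * ?G b n l)" for a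
    by (simp add: riemann_lower_def christoffel_raise sum_distrib_left algebra_simps flip: sum.distrib sum_subtractf)
  show ?thesis
    unfolding riemann_def d_christoffel_lower[OF sym] sum_subtractf 1 2 riemann_linear_def
    by (simp add: algebra_simps sum.distrib sum_subtractf add_divide_distrib diff_divide_distrib)
qed

text \<open>With \<open>I\<close> as an independent argument, the metric enters the scalar curvature
  only through \<open>I\<close>, and its variation follows from the product rule and the derivative
  of the inverse.\<close>

definition curvature_polynomial :: "metric \<Rightarrow> metric^11 \<Rightarrow> metric^11^11 \<Rightarrow> real" where
  "curvature_polynomial I P Q =
     (\<Sum>l\<in>UNIV. \<Sum>n\<in>UNIV. I$l$n * (\<Sum>k\<in>UNIV. \<Sum>a\<in>UNIV. I$k$a * riemann_lower I P Q a l k n))"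

lemma scalar_curvature_eq:
  assumes "\<And>r m n. P$r$m$n = P$r$n$m"
  shows "scalar_curvature G P Q = curvature_polynomial (matrix_inv G) P Q"
  unfolding scalar_curvature_def ricci_def curvature_polynomial_def riemann_eq[OF assms] ..

section \<open>Variations of the curvature at a diagonal metric\<close>

text \<open>
  A point of a diagonal metric \<open>g\<^sub>k\<^sub>k = \<gamma> k = \<plusminus> exp (2 * f\<^sub>k)\<close> in harmonic coordinates, with \<open>v\<close> the
  diagonal of the inverse metric \<open>I\<close>, \<open>\<phi> k r = \<partial>\<^sub>r f\<^sub>k\<close> and \<open>\<psi> k r s = \<partial>\<^sub>r \<partial>\<^sub>s f\<^sub>k\<close>.
\<close>

locale diagonal_background =
  fixes v \<gamma> :: "11 \<Rightarrow> real" and \<phi> :: "11 \<Rightarrow> 11 \<Rightarrow> real" and \<psi> :: "11 \<Rightarrow> 11 \<Rightarrow> 11 \<Rightarrow> real"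
    and P :: "metric^11" and Q :: "metric^11^11" and I :: metric
  assumes v: "v k * \<gamma> k = 1"
    and P: "P$r$m$n = (if m = n then 2 * \<gamma> m * \<phi> m r else 0)"
    and Q: "Q$r$s$m$n = (if m = n then \<gamma> m * (2 * \<psi> m r s + 4 * \<phi> m r * \<phi> m s) else 0)"
    and I: "I$i$j = (if i = j then v i else 0)"
    and \<psi>_sym: "\<psi> m r s = \<psi> m s r"
    and harmonic: "2 * \<phi> b b = (\<Sum>k\<in>UNIV. \<phi> k b)"
begin

abbreviation "C \<equiv> christoffel_lower P"

lemma v_\<gamma>_cancel: "\<gamma> k * v k = 1" "v k * (\<gamma> k * x) = x" "\<gamma> k * (v k * x) = x"
  using v[of k] by algebra+

lemma C_eq: "C n k b = (if k = b then \<gamma> k * \<phi> k n else 0) + (if n = b then \<gamma> n * \<phi> n k else 0)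
    - (if n = k then \<gamma> n * \<phi> n b else 0)"
  by (simp add: christoffel_lower_def P)

lemma C_sym: "C n k b = C k n b"
  by (auto simp: C_eq)

lemma C_special: "C n k k = \<gamma> k * \<phi> k n" "C k n k = \<gamma> k * \<phi> k n"
  "C k k b = (if k = b then 2 * \<gamma> k * \<phi> k k else 0) - \<gamma> k * \<phi> k b"
  by (auto simp: C_eq)

text \<open>This is \<open>harmonic\<close> in the form that the metric trace of the connection
  vanishes. It removes the trace products from every quadratic expression below.\<close>

lemma sum_C_trace: "(\<Sum>k\<in>UNIV. v k * C k k b) = 0"
  using harmonic[of b] by (simp add: C_special algebra_simps sum_subtractf v_\<gamma>_cancel if_distrib[of "\<lambda>x. _ * x"] cong: if_cong)

text \<open>Each summand of \<open>C_eq\<close> carries a Kronecker delta, so a sum of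
  \<open>C\<close> against an arbitrary weight \<open>W\<close> collapses. The next lemmas do the
  same for other choices of summed slots.\<close>

lemma sum_C3: "(\<Sum>b\<in>UNIV. W b * C n k b) = W k * \<gamma> k * \<phi> k n + W n * \<gamma> n * \<phi> n k
    - (if n = k then \<gamma> n * (\<Sum>b\<in>UNIV. W b * \<phi> n b) else 0)"
  by (simp add: C_eq algebra_simps sum.distrib sum_subtractf sum_distrib_left if_distrib[of "\<lambda>x. _ * x"] cong: if_cong)

lemma sum_C2: "(\<Sum>k\<in>UNIV. W k * C k l n) = (if l = n then \<gamma> n * (\<Sum>k\<in>UNIV. W k * \<phi> n k) else 0)
    + W n * \<gamma> n * \<phi> n l - W l * \<gamma> l * \<phi> l n"
  by (simp add: C_eq algebra_simps sum.distrib sum_subtractf sum_distrib_left if_distrib[of "\<lambda>x. _ * x"] cong: if_cong)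

lemma sum_C23: "(\<Sum>k\<in>UNIV. \<Sum>b\<in>UNIV. W k b * C n k b) = (\<Sum>k\<in>UNIV. W k k * \<gamma> k * \<phi> k n)
    + (\<Sum>k\<in>UNIV. W k n * \<gamma> n * \<phi> n k) - \<gamma> n * (\<Sum>b\<in>UNIV. W n b * \<phi> n b)"
  by (simp add: sum_C3 sum.distrib sum_subtractf)

lemma sum_C12: "(\<Sum>l\<in>UNIV. \<Sum>k\<in>UNIV. W l k * C l k b) = (\<Sum>l\<in>UNIV. W l b * \<gamma> b * \<phi> b l)
    + (\<Sum>k\<in>UNIV. W b k * \<gamma> b * \<phi> b k) - (\<Sum>l\<in>UNIV. W l l * \<gamma> l * \<phi> l b)"
proof -
  have "(\<Sum>k\<in>UNIV. W l k * C l k b) = W l b * \<gamma> b * \<phi> b l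
      + (if l = b then (\<Sum>k\<in>UNIV. W l k * \<gamma> l * \<phi> l k) else 0) - W l l * \<gamma> l * \<phi> l b" for l
    by (simp add: C_eq algebra_simps sum.distrib sum_subtractf sum_distrib_left if_distrib[of "\<lambda>x. _ * x"] cong: if_cong)
  then show ?thesis by (simp add: sum.distrib sum_subtractf)
qed

text \<open>Closed form of the Ricci tensor. The terms \<open>\<psi> n n l + \<psi> l n l\<close>
  and the sum of the \<open>\<psi> k n l\<close> would cancel if \<open>harmonic\<close> could be
  differentiated; the locale describes a single point, so they remain.\<close>

definition Ric :: "11 \<Rightarrow> 11 \<Rightarrow> real" where
  "Ric l n = \<psi> n n l + \<psi> l n l + 2 * \<phi> n n * \<phi> n l + 2 * \<phi> l n * \<phi> l l - 2 * \<phi> n l * \<phi> l n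
     - (if n = l then \<gamma> n * (\<Sum>k\<in>UNIV. v k * \<psi> n k k) else 0)
     - (\<Sum>k\<in>UNIV. \<psi> k n l) - (\<Sum>k\<in>UNIV. \<phi> k n * \<phi> k l)"

text \<open>
  \<open>connection_square\<close> comes from varying the inverse metric inside the terms quadratic in the
  Christoffel symbols. Together with one of the two Ricci terms in \<open>curvature_derivative_inverse\<close> it is
  cancelled by the divergence terms of the Euler--Lagrange expression.
\<close>

definition connection_square :: "11 \<Rightarrow> 11 \<Rightarrow> real" where
  "connection_square b c = (if b = c then 2 * \<gamma> b * (\<Sum>n\<in>UNIV. v n * (\<phi> b n)\<^sup>2) else 0) + 2 * \<phi> b c * \<phi> c b
     - 2 * \<phi> b b * \<phi> b c - 2 * \<phi> c c * \<phi> c b + (\<Sum>n\<in>UNIV. \<phi> n b * \<phi> n c)"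

lemma quadratic_part:
  "(\<Sum>k\<in>UNIV. v k * (\<Sum>b\<in>UNIV. v b * (C n k b * C k l b - C k k b * C n l b)))
   = (\<Sum>k\<in>UNIV. \<phi> k n * \<phi> k l) + (if n = l then 2 * \<gamma> n * (\<Sum>k\<in>UNIV. v k * (\<phi> n k)\<^sup>2) else 0) - 2 * \<phi> n l * \<phi> l n"
proof -
  have "(\<Sum>k\<in>UNIV. v k * (\<Sum>b\<in>UNIV. v b * (C n k b * C k l b - C k k b * C n l b)))
    = (\<Sum>k\<in>UNIV. \<Sum>b\<in>UNIV. (v k * v b * C k l b) * C n k b) - (\<Sum>k\<in>UNIV. \<Sum>b\<in>UNIV. (v b * C n l b) * (v k * C k k b))"
    by (simp add: sum_distrib_left algebra_simps sum_subtractf)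
  also have "(\<Sum>k\<in>UNIV. \<Sum>b\<in>UNIV. (v b * C n l b) * (v k * C k k b)) = 0"
    by (subst sum.swap) (simp add: sum_C_trace flip: sum_distrib_left)
  also have "(\<Sum>k\<in>UNIV. \<Sum>b\<in>UNIV. (v k * v b * C k l b) * C n k b)
     = (\<Sum>k\<in>UNIV. \<phi> k n * \<phi> k l) + (\<Sum>k\<in>UNIV. (v k * \<phi> n k) * C k l n) - (\<Sum>b\<in>UNIV. (v b * \<phi> n b) * C n l b)"
  proof -
    have "v k * v k * (\<gamma> k * x) * \<gamma> k * y = y * x" "v k * v n * x * \<gamma> n * y = v k * y * x"
      "\<gamma> n * (v n * v k * x * y) = v k * y * x" for k x y
      using v[of k] v[of n] by algebra+
    then show ?thesis unfolding sum_C23 C_special sum_distrib_left by (simp only:)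
  qed
  also have "(\<Sum>k\<in>UNIV. (v k * \<phi> n k) * C k l n) = (if n = l then \<gamma> n * (\<Sum>k\<in>UNIV. v k * (\<phi> n k)\<^sup>2) else 0) + \<phi> n n * \<phi> n l - \<phi> n l * \<phi> l n"
  proof -
    have "v k * x * \<gamma> k * y = x * y" for k x y
      using v[of k] by algebra
    moreover have "v k * x * x = v k * x\<^sup>2" for k x
      by (simp add: power2_eq_square)
    ultimately show ?thesis unfolding sum_C2 by (simp only:) auto
  qed
  also have "(\<Sum>b\<in>UNIV. (v b * \<phi> n b) * C n l b) = - (if n = l then \<gamma> n * (\<Sum>k\<in>UNIV. v k * (\<phi> n k)\<^sup>2) else 0) + \<phi> n n * \<phi> n l + \<phi> n l * \<phi> l n"
  proof -
    have "v k * x * \<gamma> k * y = x * y" for k x y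
      using v[of k] by algebra
    moreover have "v k * x * x = v k * x\<^sup>2" for k x
      by (simp add: power2_eq_square)
    ultimately show ?thesis unfolding sum_C3 by (simp only:)
  qed
  finally show ?thesis by simp
qed

lemma riemann_lower_eq:
  "riemann_lower I P Q a l m n = riemann_linear Q a l m n
     + (\<Sum>b\<in>UNIV. v b * (C n a b * C m l b - C m a b * C n l b))"
  by (simp add: riemann_lower_def I if_distrib[of "\<lambda>x. x * _"] cong: if_cong)

lemma linear_part:
  "(\<Sum>k\<in>UNIV. v k * riemann_linear Q k l k n) = \<psi> n n l + \<psi> l n l + 2 * \<phi> n n * \<phi> n l + 2 * \<phi> l n * \<phi> l l
    - (if n = l then \<gamma> n * (\<Sum>k\<in>UNIV. v k * \<psi> n k k) + 2 * \<gamma> n * (\<Sum>k\<in>UNIV. v k * (\<phi> n k)\<^sup>2) else 0)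
     - (\<Sum>k\<in>UNIV. \<psi> k n l) - 2 * (\<Sum>k\<in>UNIV. \<phi> k n * \<phi> k l)"
proof -
  have "v k * riemann_linear Q k l k n =
     (if k = n then \<psi> n n l + 2 * \<phi> n n * \<phi> n l else 0) + (if k = l then \<psi> l n l + 2 * \<phi> l n * \<phi> l l else 0)
     - (if n = l then \<gamma> n * (v k * \<psi> n k k) + 2 * \<gamma> n * (v k * (\<phi> n k)\<^sup>2) else 0) - \<psi> k n l - 2 * (\<phi> k n * \<phi> k l)" for k
    by (auto simp: riemann_linear_def Q \<psi>_sym algebra_simps add_divide_distrib diff_divide_distrib v_\<gamma>_cancel power2_eq_square)
  then show ?thesis
    by (simp add: sum.distrib sum_subtractf sum_distrib_left)
qed

text \<open>The sums of \<open>v k * (\<phi> n k)\<^sup>2\<close> cancel between the linear and the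
  quadratic part. Of the sum of \<open>\<phi> k n * \<phi> k l\<close>, the former contributes -2
  and the latter +1.\<close>

lemma Ric_eq: "(\<Sum>k\<in>UNIV. v k * riemann_lower I P Q k l k n) = Ric l n"
proof -
  have "(\<Sum>k\<in>UNIV. v k * riemann_lower I P Q k l k n) = (\<Sum>k\<in>UNIV. v k * riemann_linear Q k l k n)
     + (\<Sum>k\<in>UNIV. v k * (\<Sum>b\<in>UNIV. v b * (C n k b * C k l b - C k k b * C n l b)))"
    by (simp add: riemann_lower_eq distrib_left sum.distrib)
  then show ?thesis unfolding quadratic_part linear_part Ric_def by simp
qed

text \<open>Skew symmetry in both index pairs at once. It turns the contraction of the second and
  fourth slot, which arises when the inner inverse metric is varied, back into the Ricci
  contraction.\<close>

lemma riemann_lower_pair: "riemann_lower I P Q a l k l = riemann_lower I P Q l a l k"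
proof -
  have "riemann_linear Q a l k l = riemann_linear Q l a l k"
    by (auto simp: riemann_linear_def Q \<psi>_sym)
  then show ?thesis
    unfolding riemann_lower_eq by (simp only: mult.commute)
qed

lemma Ric_eq': "(\<Sum>l\<in>UNIV. v l * riemann_lower I P Q a l k l) = Ric a k"
  unfolding riemann_lower_pair[of a] Ric_eq ..

lemma connection_square_eq: "(\<Sum>l\<in>UNIV. v l * (\<Sum>k\<in>UNIV. v k * (C l k b * C k l c - C k k b * C l l c))) = connection_square b c"
proof -
  have "(\<Sum>l\<in>UNIV. v l * (\<Sum>k\<in>UNIV. v k * (C l k b * C k l c - C k k b * C l l c)))
     = (\<Sum>l\<in>UNIV. \<Sum>k\<in>UNIV. (v l * v k * C k l c) * C l k b) - (\<Sum>l\<in>UNIV. (v l * C l l c) * (\<Sum>k\<in>UNIV. v k * C k k b))"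
    by (simp add: sum_distrib_left algebra_simps sum_subtractf)
  also have "(\<Sum>l\<in>UNIV. (v l * C l l c) * (\<Sum>k\<in>UNIV. v k * C k k b)) = 0" by (simp add: sum_C_trace)
  also have "(\<Sum>l\<in>UNIV. \<Sum>k\<in>UNIV. (v l * v k * C k l c) * C l k b)
     = 2 * (\<Sum>l\<in>UNIV. (v l * \<phi> b l) * C l b c) - (\<Sum>l\<in>UNIV. (v l * \<phi> l b) * C l l c)"
  proof -
    have "v k * v b * x * \<gamma> b * y = v k * y * x" "v b * v k * x * \<gamma> b * y = v k * y * x" for k b x y
      using v[of b] by algebra+
    then show ?thesis unfolding sum_C12 C_sym[of b] by (simp only:)
  qed
  also have "(\<Sum>l\<in>UNIV. (v l * \<phi> b l) * C l b c) = (if b = c then \<gamma> b * (\<Sum>n\<in>UNIV. v n * (\<phi> b n)\<^sup>2) else 0) + \<phi> b c * \<phi> c b - \<phi> b b * \<phi> b c"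
  proof -
    have "v k * x * \<gamma> k * y = x * y" for k x y
      using v[of k] by algebra
    moreover have "v k * x * x = v k * x\<^sup>2" for k x
      by (simp add: power2_eq_square)
    ultimately show ?thesis unfolding sum_C2 by (cases "b = c") (simp_all only: if_True if_False)
  qed
  also have "(\<Sum>l\<in>UNIV. (v l * \<phi> l b) * C l l c) = 2 * \<phi> c c * \<phi> c b - (\<Sum>n\<in>UNIV. \<phi> n b * \<phi> n c)"
    by (simp add: C_special algebra_simps sum_subtractf v_\<gamma>_cancel if_distrib[of "\<lambda>x. _ * x"] cong: if_cong)
  finally show ?thesis by (simp add: connection_square_def)
qed

lemma sum_I: "(\<Sum>k\<in>UNIV. \<Sum>a\<in>UNIV. I$k$a * F k a) = (\<Sum>k\<in>UNIV. v k * F k k)"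
  by (simp add: I if_distrib[of "\<lambda>x. x * _"] cong: if_cong)

lemma curvature_diagonal:
  "curvature_polynomial I P' Q' =
     (\<Sum>l\<in>UNIV. \<Sum>k\<in>UNIV. v l * v k * (riemann_linear Q' k l k l
       + (\<Sum>b\<in>UNIV. v b * (christoffel_lower P' l k b * christoffel_lower P' k l b - christoffel_lower P' k k b * christoffel_lower P' l l b))))"
  unfolding curvature_polynomial_def riemann_lower_def sum_I
  by (simp add: sum_distrib_left mult.assoc)

lemma curvature_value: "curvature_polynomial I P Q = (\<Sum>l\<in>UNIV. v l * Ric l l)"
  unfolding curvature_polynomial_def sum_I Ric_eq ..

text \<open>The inverse metric occurs three times in the polynomial: in each of the two outer
  contractions, whose variations give one Ricci tensor each, and inside the terms quadratic in the
  connection, which give \<open>connection_square\<close>.\<close>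

lemma curvature_derivative_inverse:
  assumes J: "J 0 = I" "\<And>i j. ((\<lambda>t. J t $ i $ j) has_real_derivative - (h$i$j * v i * v j)) (at 0)"
  shows "((\<lambda>t. curvature_polynomial (J t) P Q) has_real_derivative
    - (\<Sum>l\<in>UNIV. \<Sum>n\<in>UNIV. h$l$n * v l * v n * (Ric l n + Ric n l + connection_square l n))) (at 0)"
proof -
  let ?h = "\<lambda>i j. - (h$i$j * v i * v j)"
  have "((\<lambda>t. curvature_polynomial (J t) P Q) has_real_derivative
    (\<Sum>l\<in>UNIV. \<Sum>n\<in>UNIV. ?h l n * (\<Sum>k\<in>UNIV. \<Sum>a\<in>UNIV. I$k$a * riemann_lower I P Q a l k n)
      + I$l$n * (\<Sum>k\<in>UNIV. \<Sum>a\<in>UNIV. ?h k a * riemann_lower I P Q a l k n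
          + I$k$a * (\<Sum>b\<in>UNIV. \<Sum>c\<in>UNIV. ?h b c * (C n a b * C k l c - C k a b * C n l c))))) (at 0)"
    unfolding curvature_polynomial_def riemann_lower_def
    by (rule derivative_eq_intros J(2) refl | simp add: J(1) algebra_simps)+
  moreover have "(\<Sum>l\<in>UNIV. \<Sum>n\<in>UNIV. ?h l n * (\<Sum>k\<in>UNIV. \<Sum>a\<in>UNIV. I$k$a * riemann_lower I P Q a l k n)
      + I$l$n * (\<Sum>k\<in>UNIV. \<Sum>a\<in>UNIV. ?h k a * riemann_lower I P Q a l k n
          + I$k$a * (\<Sum>b\<in>UNIV. \<Sum>c\<in>UNIV. ?h b c * (C n a b * C k l c - C k a b * C n l c))))
    = - (\<Sum>l\<in>UNIV. \<Sum>n\<in>UNIV. h$l$n * v l * v n * (Ric l n + Ric n l + connection_square l n))"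
  proof -
    have "(\<Sum>l\<in>UNIV. v l * (\<Sum>k\<in>UNIV. \<Sum>a\<in>UNIV. ?h k a * riemann_lower I P Q a l k l))
       = (\<Sum>l\<in>UNIV. \<Sum>k\<in>UNIV. \<Sum>a\<in>UNIV. ?h k a * (v l * riemann_lower I P Q a l k l))"
      by (simp add: sum_distrib_left algebra_simps)
    also have "\<dots> = (\<Sum>k\<in>UNIV. \<Sum>a\<in>UNIV. \<Sum>l\<in>UNIV. ?h k a * (v l * riemann_lower I P Q a l k l))"
      by (subst sum.swap, rule sum.cong[OF refl], rule sum.swap)
    also have "\<dots> = (\<Sum>k\<in>UNIV. \<Sum>a\<in>UNIV. ?h k a * Ric a k)"
      unfolding sum_distrib_left[symmetric] Ric_eq' ..
    finally have 2: "(\<Sum>l\<in>UNIV. v l * (\<Sum>k\<in>UNIV. \<Sum>a\<in>UNIV. ?h k a * riemann_lower I P Q a l k l))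
       = (\<Sum>k\<in>UNIV. \<Sum>a\<in>UNIV. ?h k a * Ric a k)" .
    let ?T = "\<lambda>l k b c. v l * v k * (C l k b * C k l c - C k k b * C l l c)"
    have "(\<Sum>l\<in>UNIV. v l * (\<Sum>k\<in>UNIV. v k * (\<Sum>b\<in>UNIV. \<Sum>c\<in>UNIV. ?h b c * (C l k b * C k l c - C k k b * C l l c))))
       = (\<Sum>l\<in>UNIV. \<Sum>k\<in>UNIV. \<Sum>b\<in>UNIV. \<Sum>c\<in>UNIV. ?h b c * ?T l k b c)"
      by (simp add: sum_distrib_left algebra_simps)
    also have "\<dots> = (\<Sum>l\<in>UNIV. \<Sum>b\<in>UNIV. \<Sum>c\<in>UNIV. \<Sum>k\<in>UNIV. ?h b c * ?T l k b c)"
      by (rule sum.cong[OF refl], subst sum.swap, rule sum.cong[OF refl], rule sum.swap)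
    also have "\<dots> = (\<Sum>b\<in>UNIV. \<Sum>c\<in>UNIV. \<Sum>l\<in>UNIV. \<Sum>k\<in>UNIV. ?h b c * ?T l k b c)"
      by (subst sum.swap, rule sum.cong[OF refl], rule sum.swap)
    also have "\<dots> = (\<Sum>b\<in>UNIV. \<Sum>c\<in>UNIV. ?h b c * connection_square b c)"
      unfolding connection_square_eq[symmetric] by (simp add: sum_distrib_left mult.assoc)
    finally have 3: "(\<Sum>l\<in>UNIV. v l * (\<Sum>k\<in>UNIV. v k * (\<Sum>b\<in>UNIV. \<Sum>c\<in>UNIV. ?h b c * (C l k b * C k l c - C k k b * C l l c))))
       = (\<Sum>b\<in>UNIV. \<Sum>c\<in>UNIV. ?h b c * connection_square b c)" .
    have "(\<Sum>l\<in>UNIV. \<Sum>n\<in>UNIV. ?h l n * (\<Sum>k\<in>UNIV. \<Sum>a\<in>UNIV. I$k$a * riemann_lower I P Q a l k n)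
      + I$l$n * (\<Sum>k\<in>UNIV. \<Sum>a\<in>UNIV. ?h k a * riemann_lower I P Q a l k n
          + I$k$a * (\<Sum>b\<in>UNIV. \<Sum>c\<in>UNIV. ?h b c * (C n a b * C k l c - C k a b * C n l c))))
     = (\<Sum>l\<in>UNIV. \<Sum>n\<in>UNIV. ?h l n * Ric l n) + (\<Sum>k\<in>UNIV. \<Sum>a\<in>UNIV. ?h k a * Ric a k) + (\<Sum>b\<in>UNIV. \<Sum>c\<in>UNIV. ?h b c * connection_square b c)"
      unfolding sum.distrib sum_I Ric_eq distrib_left 2 3 by (simp only: add.assoc)
    then show ?thesis
      by (simp add: algebra_simps sum.distrib sum_negf)
  qed
  ultimately show ?thesis by simp
qed

text \<open>Products with a trace of \<open>C\<close> drop out by \<open>sum_C_trace\<close>. With X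
  and Y denoting \<open>v r\<close> times the two sums of the statement, the remaining part is 2
  (X/2 + X/2 - (Y - X/2)) = 3 X - 2 Y.\<close>

lemma curvature_derivative_first:
  assumes h: "transpose h = h"
    and P': "\<And>c a b. P'$c$a$b = (if c = r then h$a$b else 0)"
  shows "((\<lambda>t. curvature_polynomial I (P + t *\<^sub>R P') Q) has_real_derivative
    3 * v r * (\<Sum>k\<in>UNIV. v k * h$k$k * \<phi> k r) - 2 * v r * (\<Sum>b\<in>UNIV. v b * \<phi> r b * h$r$b)) (at 0)"
proof -
  let ?D = "christoffel_lower P'"
  have hs: "h$a$b = h$b$a" for a b using arg_cong[OF h, of "\<lambda>M. M$b$a"] by (simp add: transpose_def)
  have lin: "christoffel_lower (P + t *\<^sub>R P') a b c = C a b c + t * ?D a b c" for t a b c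
    by (simp add: christoffel_lower_def algebra_simps add_divide_distrib diff_divide_distrib)
  have D_sym: "?D n k b = ?D k n b" for n k b
    by (simp add: christoffel_lower_def P' hs)
  have D1: "?D l k k = (if l = r then h$k$k / 2 else 0)" for l k
    by (simp add: christoffel_lower_def P' hs)
  have D2: "?D l l b = (if l = r then h$r$b else 0) - (if b = r then h$l$l / 2 else 0)" for l b
    by (simp add: christoffel_lower_def P' hs)
  have "((\<lambda>t. curvature_polynomial I (P + t *\<^sub>R P') Q) has_real_derivative
    (\<Sum>l\<in>UNIV. \<Sum>k\<in>UNIV. v l * v k * (\<Sum>b\<in>UNIV. v b * (?D l k b * C k l b + C l k b * ?D k l b - (?D k k b * C l l b + C k k b * ?D l l b))))) (at 0)"
    unfolding curvature_diagonal lin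
    by (rule derivative_eq_intros refl | simp add: algebra_simps)+
  moreover have "(\<Sum>l\<in>UNIV. \<Sum>k\<in>UNIV. v l * v k * (\<Sum>b\<in>UNIV. v b * (?D l k b * C k l b + C l k b * ?D k l b - (?D k k b * C l l b + C k k b * ?D l l b))))
    = 3 * v r * (\<Sum>k\<in>UNIV. v k * h$k$k * \<phi> k r) - 2 * v r * (\<Sum>b\<in>UNIV. v b * \<phi> r b * h$r$b)"
  proof -
    have "(\<Sum>l\<in>UNIV. \<Sum>k\<in>UNIV. v l * v k * (\<Sum>b\<in>UNIV. v b * (?D l k b * C k l b + C l k b * ?D k l b - (?D k k b * C l l b + C k k b * ?D l l b))))
     = 2 * (\<Sum>l\<in>UNIV. \<Sum>k\<in>UNIV. \<Sum>b\<in>UNIV. (v l * v k * v b * ?D l k b) * C l k b)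
       - (\<Sum>l\<in>UNIV. \<Sum>k\<in>UNIV. \<Sum>b\<in>UNIV. (v k * v b * ?D k k b) * (v l * C l l b))
       - (\<Sum>l\<in>UNIV. \<Sum>k\<in>UNIV. \<Sum>b\<in>UNIV. (v l * v b * ?D l l b) * (v k * C k k b))"
      by (simp add: C_sym D_sym sum_distrib_left algebra_simps sum.distrib sum_subtractf)
    also have "(\<Sum>l\<in>UNIV. \<Sum>k\<in>UNIV. \<Sum>b\<in>UNIV. (v k * v b * ?D k k b) * (v l * C l l b)) = 0"
    proof -
      have "(\<Sum>l\<in>UNIV. \<Sum>k\<in>UNIV. \<Sum>b\<in>UNIV. (v k * v b * ?D k k b) * (v l * C l l b))
        = (\<Sum>k\<in>UNIV. \<Sum>b\<in>UNIV. \<Sum>l\<in>UNIV. (v k * v b * ?D k k b) * (v l * C l l b))"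
        by (subst sum.swap, rule sum.cong[OF refl], rule sum.swap)
      then show ?thesis by (simp add: sum_C_trace flip: sum_distrib_left)
    qed
    also have "(\<Sum>l\<in>UNIV. \<Sum>k\<in>UNIV. \<Sum>b\<in>UNIV. (v l * v b * ?D l l b) * (v k * C k k b)) = 0"
      by (subst sum.swap[of "\<lambda>k b. _ k b" UNIV UNIV]) (simp add: sum_C_trace flip: sum_distrib_left)
    also have "(\<Sum>l\<in>UNIV. \<Sum>k\<in>UNIV. \<Sum>b\<in>UNIV. (v l * v k * v b * ?D l k b) * C l k b)
      = (\<Sum>l\<in>UNIV. \<Sum>k\<in>UNIV. v l * v k * ?D l k k * \<phi> k l) + (\<Sum>l\<in>UNIV. \<Sum>k\<in>UNIV. v l * v k * ?D l k l * \<phi> l k)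
         - (\<Sum>l\<in>UNIV. \<Sum>b\<in>UNIV. v l * v b * ?D l l b * \<phi> l b)"
    proof -
      have "v l * v k * v k * x * \<gamma> k * y = v l * v k * x * y" "v l * v k * v l * x * \<gamma> l * y = v l * v k * x * y"
        "\<gamma> l * (v l * v l * v k * x * y) = v l * v k * x * y" for k l x y
        using v[of k] v[of l] by algebra+
      then show ?thesis
        unfolding sum_C23 sum_distrib_left by (simp only: sum.distrib sum_subtractf)
    qed
    also have "(\<Sum>l\<in>UNIV. \<Sum>k\<in>UNIV. v l * v k * ?D l k l * \<phi> l k) = (\<Sum>l\<in>UNIV. \<Sum>k\<in>UNIV. v l * v k * ?D l k k * \<phi> k l)"
      by (subst sum.swap) (simp add: D_sym mult.commute[of "v _" "v _"])
    also have "(\<Sum>l\<in>UNIV. \<Sum>k\<in>UNIV. v l * v k * ?D l k k * \<phi> k l) = v r * (\<Sum>k\<in>UNIV. v k * h$k$k * \<phi> k r) / 2"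
      unfolding D1 by (subst sum.swap) (simp add: sum_distrib_left sum_divide_distrib if_distrib[of "\<lambda>x. _ * x"] if_distrib[of "\<lambda>x. x * _"] mult_ac cong: if_cong)
    also have "(\<Sum>l\<in>UNIV. \<Sum>b\<in>UNIV. v l * v b * ?D l l b * \<phi> l b)
      = v r * (\<Sum>b\<in>UNIV. v b * \<phi> r b * h$r$b) - v r * (\<Sum>k\<in>UNIV. v k * h$k$k * \<phi> k r) / 2"
    proof -
      have "(\<Sum>b\<in>UNIV. v l * v b * ?D l l b * \<phi> l b) = (if l = r then v r * (\<Sum>b\<in>UNIV. v b * \<phi> r b * h$r$b) else 0)
          - v r * (v l * h$l$l * \<phi> l r) / 2" for l
        unfolding D2 by (simp add: algebra_simps sum_subtractf sum_distrib_left if_distrib[of "\<lambda>x. _ * x"] cong: if_cong)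
      then show ?thesis by (simp add: sum_subtractf sum_distrib_left sum_divide_distrib)
    qed
    finally show ?thesis by simp
  qed
  ultimately show ?thesis by simp
qed

text \<open>The familiar tensor g^ra g^sb - g^rs g^ab contracted with \<open>h\<close>. Only the
  entry \<open>(r, s)\<close> is varied, without symmetrisation in \<open>r\<close> and
  \<open>s\<close>, as the Euler-Lagrange expression requires.\<close>

lemma curvature_derivative_second:
  assumes h: "transpose h = h"
    and Q': "\<And>c d a b. Q'$c$d$a$b = (if c = r \<and> d = s then h$a$b else 0)"
  shows "((\<lambda>t. curvature_polynomial I P (Q + t *\<^sub>R Q')) has_real_derivative
    v r * v s * h$r$s - (if r = s then v r * (\<Sum>a\<in>UNIV. v a * h$a$a) else 0)) (at 0)"
proof -
  have hs: "h$a$b = h$b$a" for a b using arg_cong[OF h, of "\<lambda>M. M$b$a"] by (simp add: transpose_def)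
  have lin: "riemann_linear (Q + t *\<^sub>R Q') a b c d = riemann_linear Q a b c d + t * riemann_linear Q' a b c d" for t a b c d
    by (simp add: riemann_linear_def algebra_simps add_divide_distrib diff_divide_distrib)
  have "((\<lambda>t. curvature_polynomial I P (Q + t *\<^sub>R Q')) has_real_derivative
     (\<Sum>l\<in>UNIV. \<Sum>k\<in>UNIV. v l * v k * riemann_linear Q' k l k l)) (at 0)"
    unfolding curvature_diagonal lin
    by (rule derivative_eq_intros refl | simp add: algebra_simps)+
  moreover have 1: "v l * v k * riemann_linear Q' k l k l = (if k = r then if l = s then v l * v k * h$l$k else 0 else 0)
     - (if k = r then if r = s then v l * v r * h$l$l / 2 else 0 else 0)
     - (if l = r then if r = s then v k * v r * h$k$k / 2 else 0 else 0)" for l k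
    by (auto simp: riemann_linear_def Q' hs)
  have "(\<Sum>l\<in>UNIV. \<Sum>k\<in>UNIV. v l * v k * riemann_linear Q' k l k l)
     = v r * v s * h$r$s - (if r = s then v r * (\<Sum>a\<in>UNIV. v a * h$a$a) else 0)"
    unfolding 1 sum_subtractf sum.swap[of "\<lambda>l k. if l = r then _ k else 0"]
    by (cases "r = s") (simp_all add: sum_distrib_left hs mult_ac sum_negf flip: sum_divide_distrib)
  ultimately show ?thesis by simp
qed

end

section \<open>Variations of the square of the field strength\<close>

lemma sum_swap_12: "(\<Sum>m\<in>UNIV. \<Sum>n\<in>UNIV. f m n) = (\<Sum>m\<in>UNIV. \<Sum>n\<in>UNIV. f n m)"
  by (rule sum.swap)
lemma sum_swap_23: "(\<Sum>m\<in>UNIV. \<Sum>n\<in>UNIV. \<Sum>r\<in>UNIV. f m n r) = (\<Sum>m\<in>UNIV. \<Sum>n\<in>UNIV. \<Sum>r\<in>UNIV. f m r n)"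
  by (rule sum.cong[OF refl], rule sum.swap)
lemma sum_swap_34: "(\<Sum>m\<in>UNIV. \<Sum>n\<in>UNIV. \<Sum>r\<in>UNIV. \<Sum>s\<in>UNIV. f m n r s) = (\<Sum>m\<in>UNIV. \<Sum>n\<in>UNIV. \<Sum>r\<in>UNIV. \<Sum>s\<in>UNIV. f m n s r)"
  by (rule sum.cong[OF refl], rule sum_swap_23)

lemma field_strength_antisymmetric:
  assumes "\<And>m. antisymmetric (D$m)"
  shows "field_strength D n m r s = - field_strength D m n r s"
    "field_strength D m r n s = - field_strength D m n r s"
    "field_strength D m n s r = - field_strength D m n r s"
proof -
  have "D$m$n$r$s = - D$m$r$n$s" "D$m$n$r$s = - D$m$n$s$r" for m n r s
    using assms unfolding antisymmetric_def by blast+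
  note a = this
  show "field_strength D n m r s = - field_strength D m n r s"
    unfolding field_strength_def using a(1)[of r n m s] a(1)[of s n m r] by simp
  show "field_strength D m r n s = - field_strength D m n r s"
    unfolding field_strength_def using a(1)[of m r n s] a(2)[of s m r n] by simp
  show "field_strength D m n s r = - field_strength D m n r s"
    unfolding field_strength_def using a(2)[of m n s r] a(2)[of n m s r] by simp
qed

text \<open>The nesting gives each inverse metric its own inner sum, so that a diagonal
  \<open>I\<close> collapses the sums one at a time by \<open>sum_diagonal\<close>.\<close>

definition field_strength_polynomial :: "metric \<Rightarrow> three_form^11 \<Rightarrow> real" where
  "field_strength_polynomial I D =
     (\<Sum>m\<in>UNIV. \<Sum>n\<in>UNIV. \<Sum>r\<in>UNIV. \<Sum>s\<in>UNIV. \<Sum>m'\<in>UNIV. I$m$m' * (\<Sum>n'\<in>UNIV. I$n$n' * (\<Sum>r'\<in>UNIV. I$r$r' * (\<Sum>s'\<in>UNIV. I$s$s' *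
       (field_strength D m n r s * field_strength D m' n' r' s')))))"

lemma field_strength_square_eq:
  "field_strength_square G D = field_strength_polynomial (matrix_inv G) D"
  by (simp add: field_strength_square_def field_strength_polynomial_def sum_distrib_left mult.assoc)

text \<open>The tensor F_mnrs F_m'^nrs, the flux side of Einstein's equations.\<close>

definition contracted_square :: "(11 \<Rightarrow> real) \<Rightarrow> three_form^11 \<Rightarrow> 11 \<Rightarrow> 11 \<Rightarrow> real" where
  "contracted_square v D m m' = (\<Sum>n\<in>UNIV. \<Sum>r\<in>UNIV. \<Sum>s\<in>UNIV. v n * v r * v s * (field_strength D m n r s * field_strength D m' n r s))"

lemma sum_diagonal:
  fixes I :: metric
  assumes "\<And>i j. I$i$j = (if i = j then v i else 0)"
  shows "(\<Sum>j\<in>UNIV. I$i$j * F j) = v i * F i"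
  by (simp add: assms if_distrib[of "\<lambda>x. x * _"] cong: if_cong)

text \<open>Each of the four inverse metrics can be the varied one; antisymmetry moves its slot to
  the front in both factors, whose signs cancel. Hence the factor 4.\<close>

lemma field_strength_derivative_inverse:
  assumes I: "\<And>i j. I$i$j = (if i = j then v i else 0)"
    and J: "J 0 = I" "\<And>i j. ((\<lambda>t. J t $ i $ j) has_real_derivative J' i j) (at 0)"
    and D: "\<And>m. antisymmetric (D$m)"
  shows "((\<lambda>t. field_strength_polynomial (J t) D) has_real_derivative
    4 * (\<Sum>m\<in>UNIV. \<Sum>m'\<in>UNIV. J' m m' * contracted_square v D m m')) (at 0)"
proof -
  let ?F = "field_strength D"
  note A = field_strength_antisymmetric[OF D]
  have e: "?F n m r s * ?F n m' r s = ?F m n r s * ?F m' n r s"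
    "?F m r n s * ?F m r m' s = ?F m n r s * ?F m m' r s"
    "?F m n s r * ?F m n s m' = ?F m n r s * ?F m n m' s" for m m' n r s
    using A(1)[of n m r s] A(1)[of n m' r s] A(2)[of m r n s] A(2)[of m r m' s] A(3)[of m n s r] A(3)[of m n s m']
    by simp_all
  have "((\<lambda>t. field_strength_polynomial (J t) D) has_real_derivative
     (\<Sum>m\<in>UNIV. \<Sum>n\<in>UNIV. \<Sum>r\<in>UNIV. \<Sum>s\<in>UNIV. \<Sum>m'\<in>UNIV.
        J' m m' * (\<Sum>n'\<in>UNIV. I$n$n' * (\<Sum>r'\<in>UNIV. I$r$r' * (\<Sum>s'\<in>UNIV. I$s$s' * (?F m n r s * ?F m' n' r' s'))))
      + I$m$m' * (\<Sum>n'\<in>UNIV. J' n n' * (\<Sum>r'\<in>UNIV. I$r$r' * (\<Sum>s'\<in>UNIV. I$s$s' * (?F m n r s * ?F m' n' r' s')))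
      + I$n$n' * (\<Sum>r'\<in>UNIV. J' r r' * (\<Sum>s'\<in>UNIV. I$s$s' * (?F m n r s * ?F m' n' r' s'))
      + I$r$r' * (\<Sum>s'\<in>UNIV. J' s s' * (?F m n r s * ?F m' n' r' s')))))) (at 0)"
    unfolding field_strength_polynomial_def
    by (rule derivative_eq_intros J(2) refl | simp add: J(1) algebra_simps)+
  also have "(\<Sum>m\<in>UNIV. \<Sum>n\<in>UNIV. \<Sum>r\<in>UNIV. \<Sum>s\<in>UNIV. \<Sum>m'\<in>UNIV.
        J' m m' * (\<Sum>n'\<in>UNIV. I$n$n' * (\<Sum>r'\<in>UNIV. I$r$r' * (\<Sum>s'\<in>UNIV. I$s$s' * (?F m n r s * ?F m' n' r' s'))))
      + I$m$m' * (\<Sum>n'\<in>UNIV. J' n n' * (\<Sum>r'\<in>UNIV. I$r$r' * (\<Sum>s'\<in>UNIV. I$s$s' * (?F m n r s * ?F m' n' r' s')))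
      + I$n$n' * (\<Sum>r'\<in>UNIV. J' r r' * (\<Sum>s'\<in>UNIV. I$s$s' * (?F m n r s * ?F m' n' r' s'))
      + I$r$r' * (\<Sum>s'\<in>UNIV. J' s s' * (?F m n r s * ?F m' n' r' s')))))
    = (\<Sum>m\<in>UNIV. \<Sum>n\<in>UNIV. \<Sum>r\<in>UNIV. \<Sum>s\<in>UNIV. \<Sum>m'\<in>UNIV. J' m m' * (v n * v r * v s * (?F m n r s * ?F m' n r s)))
    + (\<Sum>m\<in>UNIV. \<Sum>n\<in>UNIV. \<Sum>r\<in>UNIV. \<Sum>s\<in>UNIV. \<Sum>m'\<in>UNIV. J' n m' * (v m * v r * v s * (?F m n r s * ?F m m' r s)))
    + (\<Sum>m\<in>UNIV. \<Sum>n\<in>UNIV. \<Sum>r\<in>UNIV. \<Sum>s\<in>UNIV. \<Sum>m'\<in>UNIV. J' r m' * (v m * v n * v s * (?F m n r s * ?F m n m' s)))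
    + (\<Sum>m\<in>UNIV. \<Sum>n\<in>UNIV. \<Sum>r\<in>UNIV. \<Sum>s\<in>UNIV. \<Sum>m'\<in>UNIV. J' s m' * (v m * v n * v r * (?F m n r s * ?F m n r m')))"
    unfolding sum.distrib distrib_left sum_diagonal[OF I]
    by (simp add: sum_distrib_left mult_ac)
  also have "(\<Sum>m\<in>UNIV. \<Sum>n\<in>UNIV. \<Sum>r\<in>UNIV. \<Sum>s\<in>UNIV. \<Sum>m'\<in>UNIV. J' s m' * (v m * v n * v r * (?F m n r s * ?F m n r m')))
    = (\<Sum>m\<in>UNIV. \<Sum>n\<in>UNIV. \<Sum>r\<in>UNIV. \<Sum>s\<in>UNIV. \<Sum>m'\<in>UNIV. J' r m' * (v m * v n * v s * (?F m n r s * ?F m n m' s)))"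
    by (subst sum_swap_34) (simp only: e(3))
  also have "(\<Sum>m\<in>UNIV. \<Sum>n\<in>UNIV. \<Sum>r\<in>UNIV. \<Sum>s\<in>UNIV. \<Sum>m'\<in>UNIV. J' r m' * (v m * v n * v s * (?F m n r s * ?F m n m' s)))
    = (\<Sum>m\<in>UNIV. \<Sum>n\<in>UNIV. \<Sum>r\<in>UNIV. \<Sum>s\<in>UNIV. \<Sum>m'\<in>UNIV. J' n m' * (v m * v r * v s * (?F m n r s * ?F m m' r s)))"
    by (subst sum_swap_23) (simp only: e(2))
  also have "(\<Sum>m\<in>UNIV. \<Sum>n\<in>UNIV. \<Sum>r\<in>UNIV. \<Sum>s\<in>UNIV. \<Sum>m'\<in>UNIV. J' n m' * (v m * v r * v s * (?F m n r s * ?F m m' r s)))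
    = (\<Sum>m\<in>UNIV. \<Sum>n\<in>UNIV. \<Sum>r\<in>UNIV. \<Sum>s\<in>UNIV. \<Sum>m'\<in>UNIV. J' m m' * (v n * v r * v s * (?F m n r s * ?F m' n r s)))"
    by (subst sum_swap_12) (simp only: e(1))
  also have "(\<Sum>m\<in>UNIV. \<Sum>n\<in>UNIV. \<Sum>r\<in>UNIV. \<Sum>s\<in>UNIV. \<Sum>m'\<in>UNIV. J' m m' * (v n * v r * v s * (?F m n r s * ?F m' n r s)))
    = (\<Sum>m\<in>UNIV. \<Sum>n\<in>UNIV. \<Sum>r\<in>UNIV. \<Sum>m'\<in>UNIV. \<Sum>s\<in>UNIV. J' m m' * (v n * v r * v s * (?F m n r s * ?F m' n r s)))"
    by (rule sum.cong[OF refl], rule sum.cong[OF refl], rule sum.cong[OF refl], rule sum.swap)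
  also have "\<dots> = (\<Sum>m\<in>UNIV. \<Sum>n\<in>UNIV. \<Sum>m'\<in>UNIV. \<Sum>r\<in>UNIV. \<Sum>s\<in>UNIV. J' m m' * (v n * v r * v s * (?F m n r s * ?F m' n r s)))"
    by (rule sum.cong[OF refl], rule sum.cong[OF refl], rule sum.swap)
  also have "\<dots> = (\<Sum>m\<in>UNIV. \<Sum>m'\<in>UNIV. \<Sum>n\<in>UNIV. \<Sum>r\<in>UNIV. \<Sum>s\<in>UNIV. J' m m' * (v n * v r * v s * (?F m n r s * ?F m' n r s)))"
    by (rule sum.cong[OF refl], rule sum.swap)
  also have "\<dots> = (\<Sum>m\<in>UNIV. \<Sum>m'\<in>UNIV. J' m m' * contracted_square v D m m')"
    by (simp add: contracted_square_def sum_distrib_left)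
  finally show ?thesis by simp
qed

lemma field_strength_diagonal:
  assumes I: "\<And>i j. I$i$j = (if i = j then v i else 0)"
  shows "field_strength_polynomial I D = (\<Sum>m\<in>UNIV. \<Sum>n\<in>UNIV. \<Sum>r\<in>UNIV. \<Sum>s\<in>UNIV. v m * v n * v r * v s * (field_strength D m n r s)\<^sup>2)"
  unfolding field_strength_polynomial_def sum_diagonal[OF I] by (simp add: power2_eq_square mult_ac)

lemma field_strength_value:
  assumes I: "\<And>i j. I$i$j = (if i = j then v i else 0)"
  shows "field_strength_polynomial I D = (\<Sum>m\<in>UNIV. v m * contracted_square v D m m)"
  unfolding field_strength_diagonal[OF I] contracted_square_def
  by (simp add: sum_distrib_left power2_eq_square mult.assoc)

text \<open>The square gives a factor 2, and the four terms of \<open>field_strength D'\<close>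
  contribute equally after renaming indices by antisymmetry of \<open>field_strength D\<close>.
  Hence the factor 8.\<close>

lemma field_strength_derivative_potential:
  assumes I: "\<And>i j. I$i$j = (if i = j then v i else 0)"
    and D: "\<And>m. antisymmetric (D$m)"
    and D': "\<And>m n p q. D'$m$n$p$q = (if m = r then a$n$p$q else 0)"
  shows "((\<lambda>t. field_strength_polynomial I (D + t *\<^sub>R D')) has_real_derivative
    8 * v r * (\<Sum>n\<in>UNIV. \<Sum>p\<in>UNIV. \<Sum>q\<in>UNIV. v n * v p * v q * field_strength D r n p q * a$n$p$q)) (at 0)"
proof -
  let ?F = "field_strength D" and ?v = "\<lambda>m n p q. v m * v n * v p * v q"
  have lin: "field_strength (D + t *\<^sub>R D') m n p q = ?F m n p q + t * field_strength D' m n p q" for t m n p q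
    by (simp add: field_strength_def algebra_simps)
  note A = field_strength_antisymmetric[OF D]
  have "((\<lambda>t. field_strength_polynomial I (D + t *\<^sub>R D')) has_real_derivative
     (\<Sum>m\<in>UNIV. \<Sum>n\<in>UNIV. \<Sum>p\<in>UNIV. \<Sum>q\<in>UNIV. ?v m n p q * (2 * (?F m n p q * field_strength D' m n p q)))) (at 0)"
    unfolding field_strength_diagonal[OF I] lin
    by (rule derivative_eq_intros refl | simp add: algebra_simps)+
  also have "(\<Sum>m\<in>UNIV. \<Sum>n\<in>UNIV. \<Sum>p\<in>UNIV. \<Sum>q\<in>UNIV. ?v m n p q * (2 * (?F m n p q * field_strength D' m n p q)))
    = 2 * ((\<Sum>m\<in>UNIV. \<Sum>n\<in>UNIV. \<Sum>p\<in>UNIV. \<Sum>q\<in>UNIV. ?v m n p q * ?F m n p q * D'$m$n$p$q)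
      - (\<Sum>m\<in>UNIV. \<Sum>n\<in>UNIV. \<Sum>p\<in>UNIV. \<Sum>q\<in>UNIV. ?v m n p q * ?F m n p q * D'$n$m$p$q)
      + (\<Sum>m\<in>UNIV. \<Sum>n\<in>UNIV. \<Sum>p\<in>UNIV. \<Sum>q\<in>UNIV. ?v m n p q * ?F m n p q * D'$p$m$n$q)
      - (\<Sum>m\<in>UNIV. \<Sum>n\<in>UNIV. \<Sum>p\<in>UNIV. \<Sum>q\<in>UNIV. ?v m n p q * ?F m n p q * D'$q$m$n$p))"
    unfolding field_strength_def[of D']
    by (simp add: algebra_simps sum.distrib sum_subtractf sum_distrib_left)
  also have "(\<Sum>m\<in>UNIV. \<Sum>n\<in>UNIV. \<Sum>p\<in>UNIV. \<Sum>q\<in>UNIV. ?v m n p q * ?F m n p q * D'$q$m$n$p)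
    = - (\<Sum>m\<in>UNIV. \<Sum>n\<in>UNIV. \<Sum>p\<in>UNIV. \<Sum>q\<in>UNIV. ?v m n p q * ?F m n p q * D'$p$m$n$q)"
    unfolding sum_negf[symmetric] by (subst sum_swap_34, intro sum.cong refl, subst A(3)) (simp add: mult_ac)
  also have "(\<Sum>m\<in>UNIV. \<Sum>n\<in>UNIV. \<Sum>p\<in>UNIV. \<Sum>q\<in>UNIV. ?v m n p q * ?F m n p q * D'$p$m$n$q)
    = - (\<Sum>m\<in>UNIV. \<Sum>n\<in>UNIV. \<Sum>p\<in>UNIV. \<Sum>q\<in>UNIV. ?v m n p q * ?F m n p q * D'$n$m$p$q)"
    unfolding sum_negf[symmetric] by (subst sum_swap_23, intro sum.cong refl, subst A(2)) (simp add: mult_ac)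
  also have "(\<Sum>m\<in>UNIV. \<Sum>n\<in>UNIV. \<Sum>p\<in>UNIV. \<Sum>q\<in>UNIV. ?v m n p q * ?F m n p q * D'$n$m$p$q)
    = - (\<Sum>m\<in>UNIV. \<Sum>n\<in>UNIV. \<Sum>p\<in>UNIV. \<Sum>q\<in>UNIV. ?v m n p q * ?F m n p q * D'$m$n$p$q)"
    unfolding sum_negf[symmetric] by (subst sum_swap_12, intro sum.cong refl, subst A(1)) (simp add: mult_ac)
  also have "(\<Sum>m\<in>UNIV. \<Sum>n\<in>UNIV. \<Sum>p\<in>UNIV. \<Sum>q\<in>UNIV. ?v m n p q * ?F m n p q * D'$m$n$p$q)
    = (\<Sum>m\<in>UNIV. if m = r then (\<Sum>n\<in>UNIV. \<Sum>p\<in>UNIV. \<Sum>q\<in>UNIV. ?v m n p q * ?F m n p q * a$n$p$q) else 0)"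
    by (rule sum.cong) (auto simp: D')
  finally show ?thesis
    by (simp add: sum_distrib_left mult_ac)
qed

section \<open>Brane fluxes and the variations of the Lagrangian\<close>

abbreviation eps :: "11 \<Rightarrow> 11 \<Rightarrow> 11 \<Rightarrow> real" where
  "eps i j k \<equiv> brane_potential 1 $ i $ j $ k"

lemma brane_potential_scale: "brane_potential a = a *\<^sub>R brane_potential 1"
  by (simp add: brane_potential_def vec_eq_iff)

lemma antisymmetric_brane_potential: "antisymmetric (brane_potential a)"
  unfolding antisymmetric_def
proof (intro allI)
  fix i j k :: 11
  have c: "i = 9 \<or> i = 10 \<or> i = 11 \<or> i \<notin> {9,10,11}" for i :: 11 by blast
  show "brane_potential a $ i $ j $ k = - brane_potential a $ j $ i $ k \<and>
      brane_potential a $ i $ j $ k = - brane_potential a $ i $ k $ j"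
    using c[of i] c[of j] c[of k] by (elim disjE) (simp_all add: brane_potential_def)
qed

lemma eps_support: "i \<notin> {9,10,11} \<Longrightarrow> eps i j k = 0" "j \<notin> {9,10,11} \<Longrightarrow> eps i j k = 0"
  "k \<notin> {9,10,11} \<Longrightarrow> eps i j k = 0"
  by (auto simp: brane_potential_def)

lemma sum_eps: "(\<Sum>j\<in>UNIV. \<Sum>k\<in>UNIV. F j k * eps i j k) =
    (if i = 9 then F 10 11 - F 11 10 else 0) + (if i = 10 then F 11 9 - F 9 11 else 0) + (if i = 11 then F 9 10 - F 10 9 else 0)"
proof -
  have e: "eps i j k = (if k = 11 then if j = 10 then if i = 9 then 1 else 0 else 0 else 0)
    + (if k = 9 then if j = 11 then if i = 10 then 1 else 0 else 0 else 0)
    + (if k = 10 then if j = 9 then if i = 11 then 1 else 0 else 0 else 0)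
    - (if k = 11 then if j = 9 then if i = 10 then 1 else 0 else 0 else 0)
    - (if k = 10 then if j = 11 then if i = 9 then 1 else 0 else 0 else 0)
    - (if k = 9 then if j = 10 then if i = 11 then 1 else 0 else 0 else 0)" for j k
  proof -
    have c: "i = 9 \<or> i = 10 \<or> i = 11 \<or> i \<notin> {9,10,11}" for i :: 11 by blast
    show ?thesis
      using c[of i] c[of j] c[of k] by (elim disjE) (simp_all add: brane_potential_def)
  qed
  show ?thesis
    unfolding e by (simp add: algebra_simps sum.distrib sum_subtractf if_distrib[of "\<lambda>x. _ * x"] cong: if_cong)
qed

lemma sum_eps_all: "(\<Sum>i\<in>UNIV. \<Sum>j\<in>UNIV. \<Sum>k\<in>UNIV. F i j k * eps i j k) =
    F 9 10 11 - F 9 11 10 + F 10 11 9 - F 10 9 11 + F 11 9 10 - F 11 10 9"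
  unfolding sum_eps by (simp add: sum.distrib)

text \<open>\<open>\<beta>\<close> is the gradient of the potential and \<open>\<kappa>\<close> the
  common inverse metric component along the three directions of the potential.\<close>

locale brane_background = diagonal_background v \<gamma> \<phi> \<psi> P Q I
  for v \<gamma> \<phi> \<psi> P Q I +
  fixes D :: "three_form^11" and \<beta> :: "11 \<Rightarrow> real" and \<kappa> :: real
  assumes D: "D$m = \<beta> m *\<^sub>R brane_potential 1"
    and \<beta>: "m \<in> {9,10,11} \<Longrightarrow> \<beta> m = 0"
    and \<kappa>: "v 9 = \<kappa>" "v 10 = \<kappa>" "v 11 = \<kappa>"
begin

abbreviation "F \<equiv> field_strength D"

lemma F_eq: "F m n r s = \<beta> m * eps n r s - \<beta> n * eps m r s + \<beta> r * eps m n s - \<beta> s * eps m n r"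
  by (simp add: field_strength_def D)

lemma antisymmetric_D: "antisymmetric (D$m)"
  using antisymmetric_brane_potential[of "\<beta> m"] by (simp add: D brane_potential_scale[of "\<beta> m"])

lemma \<beta>_eps: "\<beta> m * eps m j k = 0" "\<beta> m * eps i m k = 0" "\<beta> m * eps i j m = 0"
  using \<beta>[of m] eps_support(1)[of m j k] eps_support(2)[of m i k] eps_support(3)[of m i j]
  by (cases "m \<in> {9,10,11}"; simp)+

lemma F_zero: "9 \<notin> {m, n, r, s} \<Longrightarrow> F m n r s = 0"
  by (auto simp: F_eq brane_potential_def)

lemma contracted_square_eq:
  "contracted_square v D m m' = 6 * \<kappa>^3 * \<beta> m * \<beta> m'
     + (if m = m' \<and> m \<in> {9,10,11} then 6 * \<kappa>\<^sup>2 * (\<Sum>n\<in>UNIV. v n * (\<beta> n)\<^sup>2) else 0)"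
proof -
  let ?B = "\<Sum>n\<in>UNIV. v n * (\<beta> n)\<^sup>2" and ?w = "\<lambda>r s. v r * v s * eps m r s"
  have "F m n r s * F m' n r s = \<beta> m * \<beta> m' * (eps n r s * eps n r s) + \<beta> n * \<beta> n * (eps m r s * eps m' r s)
     + \<beta> r * \<beta> r * (eps m n s * eps m' n s) + \<beta> s * \<beta> s * (eps m n r * eps m' n r)" for n r s
  proof -
    \<comment> \<open>Every cross term of the product pairs some \<open>\<beta> i\<close> with an
      \<open>eps\<close> that also has the index \<open>i\<close>; these are the products that
      vanish by \<open>\<beta>_eps\<close>.\<close>
    note z = \<beta>_eps(1)[of n r s] \<beta>_eps(2)[of r n s] \<beta>_eps(3)[of s n r]
      \<beta>_eps(2)[of n m s] \<beta>_eps(2)[of n m' s] \<beta>_eps(2)[of n m r] \<beta>_eps(2)[of n m' r]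
      \<beta>_eps(2)[of r m s] \<beta>_eps(2)[of r m' s] \<beta>_eps(3)[of r m n] \<beta>_eps(3)[of r m' n]
      \<beta>_eps(3)[of s m n] \<beta>_eps(3)[of s m' n] \<beta>_eps(3)[of s m r] \<beta>_eps(3)[of s m' r]
    show ?thesis unfolding F_eq using z by algebra
  qed
  then have "contracted_square v D m m' =
      \<beta> m * \<beta> m' * (\<Sum>n\<in>UNIV. \<Sum>r\<in>UNIV. \<Sum>s\<in>UNIV. (v n * v r * v s * eps n r s) * eps n r s)
    + (\<Sum>n\<in>UNIV. \<Sum>r\<in>UNIV. \<Sum>s\<in>UNIV. (v n * (\<beta> n)\<^sup>2) * (?w r s * eps m' r s))
    + (\<Sum>n\<in>UNIV. \<Sum>r\<in>UNIV. \<Sum>s\<in>UNIV. (v r * (\<beta> r)\<^sup>2) * (?w n s * eps m' n s))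
    + (\<Sum>n\<in>UNIV. \<Sum>r\<in>UNIV. \<Sum>s\<in>UNIV. (v s * (\<beta> s)\<^sup>2) * (?w n r * eps m' n r))"
    unfolding contracted_square_def by (simp add: sum_distrib_left algebra_simps sum.distrib power2_eq_square)
  also have "(\<Sum>n\<in>UNIV. \<Sum>r\<in>UNIV. \<Sum>s\<in>UNIV. (v s * (\<beta> s)\<^sup>2) * (?w n r * eps m' n r))
    = (\<Sum>n\<in>UNIV. \<Sum>r\<in>UNIV. \<Sum>s\<in>UNIV. (v r * (\<beta> r)\<^sup>2) * (?w n s * eps m' n s))"
    by (subst sum_swap_23) (rule refl)
  also have "(\<Sum>n\<in>UNIV. \<Sum>r\<in>UNIV. \<Sum>s\<in>UNIV. (v r * (\<beta> r)\<^sup>2) * (?w n s * eps m' n s))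
    = (\<Sum>n\<in>UNIV. \<Sum>r\<in>UNIV. \<Sum>s\<in>UNIV. (v n * (\<beta> n)\<^sup>2) * (?w r s * eps m' r s))"
    by (subst sum_swap_12) (rule refl)
  also have "(\<Sum>n\<in>UNIV. \<Sum>r\<in>UNIV. \<Sum>s\<in>UNIV. (v n * (\<beta> n)\<^sup>2) * (?w r s * eps m' r s)) = ?B * (\<Sum>r\<in>UNIV. \<Sum>s\<in>UNIV. ?w r s * eps m' r s)"
    unfolding sum_distrib_left[symmetric] sum_distrib_right[symmetric] ..
  also have "(\<Sum>r\<in>UNIV. \<Sum>s\<in>UNIV. ?w r s * eps m' r s) = (if m = m' \<and> m \<in> {9,10,11} then 2 * \<kappa>\<^sup>2 else 0)"
    unfolding sum_eps by (auto simp: \<kappa> brane_potential_def power2_eq_square)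
  also have "(\<Sum>n\<in>UNIV. \<Sum>r\<in>UNIV. \<Sum>s\<in>UNIV. (v n * v r * v s * eps n r s) * eps n r s) = 6 * \<kappa>^3"
    unfolding sum_eps_all by (simp add: \<kappa> brane_potential_def power3_eq_cube)
  finally show ?thesis by auto
qed

text \<open>The factor 6 counts the orderings of 9, 10, 11, each contributing the same by
  antisymmetry of both \<open>eps\<close> and \<open>a\<close>.\<close>

lemma F_contracted_variation:
  assumes a: "antisymmetric a" and r: "r \<notin> {9,10,11}"
  shows "(\<Sum>n\<in>UNIV. \<Sum>p\<in>UNIV. \<Sum>q\<in>UNIV. v n * v p * v q * F r n p q * a$n$p$q) = 6 * \<kappa>^3 * \<beta> r * a$9$10$11"
proof -
  have "a$i$j$k = - a$j$i$k" "a$i$j$k = - a$i$k$j" for i j k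
    using a unfolding antisymmetric_def by blast+
  note s = this
  have "(\<Sum>n\<in>UNIV. \<Sum>p\<in>UNIV. \<Sum>q\<in>UNIV. v n * v p * v q * F r n p q * a$n$p$q)
      = (\<Sum>n\<in>UNIV. \<Sum>p\<in>UNIV. \<Sum>q\<in>UNIV. (\<beta> r * v n * v p * v q * a$n$p$q) * eps n p q)"
    using eps_support(1)[OF r] by (simp add: F_eq mult_ac)
  also have "\<dots> = 6 * \<kappa>^3 * \<beta> r * a$9$10$11"
    unfolding sum_eps_all \<kappa>
    using s(2)[of 9 11 10] s(1)[of 10 9 11] s(2)[of 10 11 9] s(1)[of 11 9 10] s(2)[of 11 10 9]
    by (simp add: power3_eq_cube algebra_simps)
  finally show ?thesis .
qed

text \<open>A permutation uses the index 9 once. The first claim leaves a vanishing field strength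
  when the potential is varied; the second one makes both product rule terms vanish when the field
  strengths are varied.\<close>

lemma chern_simons_term_zero:
  assumes "p permutes (UNIV :: 11 set)"
  shows "F (p 4) (p 5) (p 6) (p 7) = 0 \<or> F (p 8) (p 9) (p 10) (p 11) = 0"
    and "brane_potential b $ p 1 $ p 2 $ p 3 = 0 \<or> F (p 4) (p 5) (p 6) (p 7) = 0 \<and> F (p 8) (p 9) (p 10) (p 11) = 0"
proof -
  have p: "p i = p j \<longleftrightarrow> i = j" for i j using permutes_inj[OF assms] by (simp add: inj_eq)
  obtain k where "9 = p k" using permutes_surj[OF assms] by (metis surjD)
  then have k: "9 = p i \<longleftrightarrow> i = k" for i using p by metis
  have 1: "9 \<notin> {p 4, p 5, p 6, p 7} \<or> 9 \<notin> {p 8, p 9, p 10, p 11}"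
    by (auto simp: k)
  have 2: "9 \<in> {p 1, p 2, p 3} \<Longrightarrow> 9 \<notin> {p 4, p 5, p 6, p 7} \<and> 9 \<notin> {p 8, p 9, p 10, p 11}"
    by (auto simp: k)
  have 3: "brane_potential b $ p 1 $ p 2 $ p 3 = 0" if "9 \<notin> {p 1, p 2, p 3}"
    using that by (auto simp: brane_potential_def)
  show "F (p 4) (p 5) (p 6) (p 7) = 0 \<or> F (p 8) (p 9) (p 10) (p 11) = 0"
    using 1 F_zero by blast
  show "brane_potential b $ p 1 $ p 2 $ p 3 = 0 \<or> F (p 4) (p 5) (p 6) (p 7) = 0 \<and> F (p 8) (p 9) (p 10) (p 11) = 0"
    using 2 3 F_zero by blast
qed

lemma chern_simons_zero: "chern_simons A D = 0"
  unfolding chern_simons_def using chern_simons_term_zero(1)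
  by (auto intro!: sum.neutral)

lemma chern_simons_derivative:
  "((\<lambda>t. chern_simons (brane_potential b) (D + t *\<^sub>R D')) has_real_derivative 0) (at 0)"
proof -
  have lin: "field_strength (D + t *\<^sub>R D') m n p q = F m n p q + t * field_strength D' m n p q" for t m n p q
    by (simp add: field_strength_def algebra_simps)
  have "((\<lambda>t. chern_simons (brane_potential b) (D + t *\<^sub>R D')) has_real_derivative
     (\<Sum>p | p permutes (UNIV :: 11 set). 0) / (fact 3 * fact 4 * fact 4)) (at 0)"
    unfolding chern_simons_def lin
  proof (intro DERIV_cdivide DERIV_sum)
    fix p assume "p \<in> {p. p permutes (UNIV :: 11 set)}"
    then have p: "p permutes UNIV" by simp
    let ?b = "brane_potential b $ p 1 $ p 2 $ p 3" and ?x = "F (p 4) (p 5) (p 6) (p 7)" and ?y = "F (p 8) (p 9) (p 10) (p 11)"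
      and ?x' = "field_strength D' (p 4) (p 5) (p 6) (p 7)" and ?y' = "field_strength D' (p 8) (p 9) (p 10) (p 11)"
    have "((\<lambda>t. of_int (sign p) * ?b * (?x + t * ?x') * (?y + t * ?y')) has_real_derivative
        of_int (sign p) * ?b * (?x' * ?y + ?x * ?y')) (at 0)"
      by (auto intro!: derivative_eq_intros simp: algebra_simps)
    also have "of_int (sign p) * ?b * (?x' * ?y + ?x * ?y') = 0"
      using chern_simons_term_zero(2)[OF p, of b] by auto
    finally show "((\<lambda>t. of_int (sign p) * ?b * (?x + t * ?x') * (?y + t * ?y')) has_real_derivative 0) (at 0)" .
  qed
  then show ?thesis by simp
qed

end

section \<open>Derivatives of the Lagrangian in the fields and in their first and second
  derivatives\<close>

lemma dir_deriv_real:
  assumes "((\<lambda>t. f (x + t *\<^sub>R v)) has_real_derivative d) (at 0)"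
  shows "dir_deriv f x v = d"
  unfolding dir_deriv_def using assms
  by (intro vector_derivative_at) (simp add: has_real_derivative_iff_has_vector_derivative)

lemma lagrangian_eq:
  assumes "\<And>r m n. fst (p$r)$m$n = fst (p$r)$n$m"
  shows "sugra_lagrangian c (G, A) p q =
    sqrt \<bar>det G\<bar> * (curvature_polynomial (matrix_inv G) (\<chi> r. fst (p$r)) (\<chi> r s. fst (q$r$s))
      - field_strength_polynomial (matrix_inv G) (\<chi> r. snd (p$r)) / 48)
    + c * chern_simons A (\<chi> r. snd (p$r))"
  using assms by (simp add: sugra_lagrangian_def Let_def scalar_curvature_eq field_strength_square_eq fact_numeral)

text \<open>The Lagrangian contains no second derivatives of the potential, hence \<open>q\<close>
  is fixed in its metric component only.\<close>

locale brane_fields = brane_background v \<gamma> \<phi> \<psi> P Q I D \<beta> \<kappa>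
  for v \<gamma> \<phi> \<psi> P Q I D \<beta> \<kappa> +
  fixes G :: metric and b :: real and p :: "(metric \<times> three_form)^11" and q :: "(metric \<times> three_form)^11^11"
  assumes G: "G$i$j = (if i = j then \<gamma> i else 0)"
    and p: "p$m = (P$m, D$m)"
    and q: "fst (q$r$s) = Q$r$s"
begin

lemma \<gamma>_nonzero: "\<gamma> k \<noteq> 0" using v[of k] by auto
lemma v_eq: "v k = 1 / \<gamma> k" using v[of k] \<gamma>_nonzero[of k] by (simp add: field_simps)

lemma matrix_inv_G: "matrix_inv G = I"
  using matrix_inv_diagonal[of G] by (simp add: vec_eq_iff G \<gamma>_nonzero I v_eq)

lemma P_sym: "P$r$m$n = P$r$n$m" by (simp add: P)

lemma p_components: "(\<chi> r. fst (p$r)) = P" "(\<chi> r. snd (p$r)) = D" "(\<chi> r s. fst (q$r$s)) = Q"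
  by (simp_all add: vec_eq_iff p q)

lemma dir_deriv_fields:
  "dir_deriv (\<lambda>w. sugra_lagrangian c w p q) (G, brane_potential b) (h, a) =
     sqrt \<bar>det G\<bar> * ((\<Sum>k\<in>UNIV. v k * h$k$k) / 2 * ((\<Sum>l\<in>UNIV. v l * Ric l l) - (\<Sum>l\<in>UNIV. v l * contracted_square v D l l) / 48)
       - (\<Sum>l\<in>UNIV. \<Sum>n\<in>UNIV. h$l$n * v l * v n * (Ric l n + Ric n l + connection_square l n))
       + (\<Sum>l\<in>UNIV. \<Sum>n\<in>UNIV. h$l$n * v l * v n * contracted_square v D l n) / 12)"
proof (rule dir_deriv_real)
  have o: "G$i$j = 0" if "i \<noteq> j" for i j using that by (simp add: G)
  have nz: "G$i$i \<noteq> 0" for i by (simp add: G \<gamma>_nonzero)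
  have inv: "((\<lambda>t. matrix_inv (G + t *\<^sub>R h) $ i $ j) has_real_derivative - (h$i$j * v i * v j)) (at 0)" for i j
    using matrix_inv_derivative_at_diagonal[OF o nz, of h i j] by (simp add: G v_eq)
  have det: "((\<lambda>t. sqrt \<bar>det (G + t *\<^sub>R h)\<bar>) has_real_derivative sqrt \<bar>det G\<bar> * (\<Sum>k\<in>UNIV. v k * h$k$k) / 2) (at 0)"
    using sqrt_abs_det_derivative_at_diagonal[OF o nz, of h] by (simp add: G v_eq)
  have R: "((\<lambda>t. curvature_polynomial (matrix_inv (G + t *\<^sub>R h)) P Q) has_real_derivative
    - (\<Sum>l\<in>UNIV. \<Sum>n\<in>UNIV. h$l$n * v l * v n * (Ric l n + Ric n l + connection_square l n))) (at 0)"
    by (rule curvature_derivative_inverse) (simp_all add: matrix_inv_G inv)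
  have S: "((\<lambda>t. field_strength_polynomial (matrix_inv (G + t *\<^sub>R h)) D) has_real_derivative
    4 * (\<Sum>m\<in>UNIV. \<Sum>m'\<in>UNIV. - (h$m$m' * v m * v m') * contracted_square v D m m')) (at 0)"
    by (rule field_strength_derivative_inverse[OF I]) (simp_all add: matrix_inv_G inv antisymmetric_D)
  \<comment> \<open>The potential itself enters through the Chern-Simons term only, and there the
    product of the two field strengths vanishes, whatever \<open>A + t a\<close> is.\<close>
  have L: "sugra_lagrangian c ((G, brane_potential b) + t *\<^sub>R (h, a)) p q = sqrt \<bar>det (G + t *\<^sub>R h)\<bar> *
     (curvature_polynomial (matrix_inv (G + t *\<^sub>R h)) P Q - field_strength_polynomial (matrix_inv (G + t *\<^sub>R h)) D / 48)" for t
  proof -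
    have "fst (p$r)$m$n = fst (p$r)$n$m" for r m n by (simp add: p P_sym)
    then show ?thesis by (simp add: lagrangian_eq p_components chern_simons_zero)
  qed
  show "((\<lambda>t. sugra_lagrangian c ((G, brane_potential b) + t *\<^sub>R (h, a)) p q) has_real_derivative
     sqrt \<bar>det G\<bar> * ((\<Sum>k\<in>UNIV. v k * h$k$k) / 2 * ((\<Sum>l\<in>UNIV. v l * Ric l l) - (\<Sum>l\<in>UNIV. v l * contracted_square v D l l) / 48)
       - (\<Sum>l\<in>UNIV. \<Sum>n\<in>UNIV. h$l$n * v l * v n * (Ric l n + Ric n l + connection_square l n))
       + (\<Sum>l\<in>UNIV. \<Sum>n\<in>UNIV. h$l$n * v l * v n * contracted_square v D l n) / 12)) (at 0)"
    unfolding L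
    by (rule DERIV_cong[OF DERIV_mult[OF det DERIV_diff[OF R DERIV_cdivide[OF S]]]])
       (simp add: matrix_inv_G curvature_value field_strength_value[OF I] sum_negf algebra_simps)
qed

text \<open>The flux term has coefficient 1 because 8 (derivative of the square) times 6 (orderings
  of 9, 10, 11) cancels the 48 in the Lagrangian.\<close>

lemma dir_deriv_first:
  assumes h: "transpose h = h" and a: "antisymmetric a" and r: "r \<notin> {9,10,11}"
  shows "dir_deriv (\<lambda>p. sugra_lagrangian c (G, brane_potential b) p q) p (axis r (h, a)) =
     sqrt \<bar>det G\<bar> * (3 * v r * (\<Sum>k\<in>UNIV. v k * h$k$k * \<phi> k r) - 2 * v r * (\<Sum>k\<in>UNIV. v k * \<phi> r k * h$r$k)
       - v r * \<kappa>^3 * \<beta> r * a$9$10$11)"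
proof (rule dir_deriv_real)
  define P' where "P' = (\<chi> m. fst (axis r (h, a) $ m))"
  define D' where "D' = (\<chi> m. snd (axis r (h, a) $ m))"
  have P': "P'$c$i$j = (if c = r then h$i$j else 0)" for c i j by (simp add: P'_def axis_def)
  have D': "D'$c$i$j$k = (if c = r then a$i$j$k else 0)" for c i j k by (simp add: D'_def axis_def)
  have hs: "h$i$j = h$j$i" for i j using arg_cong[OF h, of "\<lambda>M. M$j$i"] by (simp add: transpose_def)
  have L: "sugra_lagrangian c (G, brane_potential b) (p + t *\<^sub>R axis r (h, a)) q = sqrt \<bar>det G\<bar> *
     (curvature_polynomial I (P + t *\<^sub>R P') Q - field_strength_polynomial I (D + t *\<^sub>R D') / 48)
      + c * chern_simons (brane_potential b) (D + t *\<^sub>R D')" for t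
  proof -
    have 1: "(\<chi> m. fst ((p + t *\<^sub>R axis r (h, a)) $ m)) = P + t *\<^sub>R P'" "(\<chi> m. snd ((p + t *\<^sub>R axis r (h, a)) $ m)) = D + t *\<^sub>R D'"
      by (simp_all add: vec_eq_iff P'_def D'_def p)
    \<comment> \<open>The polynomial form of the curvature holds for symmetric metric derivatives;
      symmetry of \<open>h\<close> keeps the whole line in \<open>t\<close> inside this
      class.\<close>
    have "fst ((p + t *\<^sub>R axis r (h, a))$r')$m$n = fst ((p + t *\<^sub>R axis r (h, a))$r')$n$m" for r' m n
      using P'[of r' m n] P'[of r' n m] hs[of m n] by (simp add: p P'_def P_sym[of r' m n])
    then show ?thesis
      by (simp only: lagrangian_eq 1 p_components matrix_inv_G)
  qed
  note R = curvature_derivative_first[OF h P']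
  have S: "((\<lambda>t. field_strength_polynomial I (D + t *\<^sub>R D')) has_real_derivative 8 * v r * (6 * \<kappa>^3 * \<beta> r * a$9$10$11)) (at 0)"
    using field_strength_derivative_potential[OF I antisymmetric_D D'] unfolding F_contracted_variation[OF a r] .
  show "((\<lambda>t. sugra_lagrangian c (G, brane_potential b) (p + t *\<^sub>R axis r (h, a)) q) has_real_derivative
     sqrt \<bar>det G\<bar> * (3 * v r * (\<Sum>k\<in>UNIV. v k * h$k$k * \<phi> k r) - 2 * v r * (\<Sum>k\<in>UNIV. v k * \<phi> r k * h$r$k)
       - v r * \<kappa>^3 * \<beta> r * a$9$10$11)) (at 0)"
    unfolding L
    by (rule DERIV_cong[OF DERIV_add[OF DERIV_cmult[OF DERIV_diff[OF R DERIV_cdivide[OF S]]] DERIV_cmult[OF chern_simons_derivative]]])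
       (simp add: algebra_simps)
qed

lemma dir_deriv_second:
  assumes h: "transpose h = h"
  shows "dir_deriv (\<lambda>q. sugra_lagrangian c (G, brane_potential b) p q) q (axis r (axis s (h, a))) =
     sqrt \<bar>det G\<bar> * (v r * v s * h$r$s - (if r = s then v r * (\<Sum>k\<in>UNIV. v k * h$k$k) else 0))"
proof (rule dir_deriv_real)
  define Q' where "Q' = (\<chi> m n. fst (axis r (axis s (h, a)) $ m $ n))"
  have Q': "Q'$m$n$i$j = (if m = r \<and> n = s then h$i$j else 0)" for m n i j by (auto simp: Q'_def axis_def)
  have L: "sugra_lagrangian c (G, brane_potential b) p (q + t *\<^sub>R axis r (axis s (h, a))) = sqrt \<bar>det G\<bar> *
     (curvature_polynomial I P (Q + t *\<^sub>R Q') - field_strength_polynomial I D / 48)" for t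
  proof -
    have 1: "(\<chi> m n. fst ((q + t *\<^sub>R axis r (axis s (h, a))) $ m $ n)) = Q + t *\<^sub>R Q'"
      by (simp add: vec_eq_iff Q'_def q)
    have "fst (p$r)$m$n = fst (p$r)$n$m" for r m n by (simp add: p P_sym)
    then show ?thesis
      by (simp only: lagrangian_eq 1 p_components chern_simons_zero matrix_inv_G mult_zero_right add_0_right)
  qed
  note R = curvature_derivative_second[OF h Q']
  show "((\<lambda>t. sugra_lagrangian c (G, brane_potential b) p (q + t *\<^sub>R axis r (axis s (h, a)))) has_real_derivative
     sqrt \<bar>det G\<bar> * (v r * v s * h$r$s - (if r = s then v r * (\<Sum>k\<in>UNIV. v k * h$k$k) else 0))) (at 0)"
    unfolding L by (rule DERIV_cong[OF DERIV_cmult[OF DERIV_diff[OF R DERIV_const]]]) simp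
qed

end

section \<open>Gradients of functions on coordinate space\<close>

lemma dir_deriv_has_derivative:
  assumes "(f has_derivative f') (at x)"
  shows "dir_deriv f x v = f' v"
proof -
  interpret bounded_linear f' using assms by (rule has_derivative_bounded_linear)
  have "((\<lambda>t::real. x + t *\<^sub>R v) has_derivative (\<lambda>t. t *\<^sub>R v)) (at 0)"
    by (auto intro!: derivative_eq_intros)
  moreover have "(f has_derivative f') (at (x + 0 *\<^sub>R v))" using assms by simp
  ultimately have "((\<lambda>t::real. f (x + t *\<^sub>R v)) has_derivative (\<lambda>t. f' (t *\<^sub>R v))) (at 0)"
    by (rule has_derivative_compose[where g = f])
  then have "((\<lambda>t::real. f (x + t *\<^sub>R v)) has_vector_derivative f' v) (at 0)"
    by (simp add: has_vector_derivative_def scaleR)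
  then show ?thesis
    unfolding dir_deriv_def by (rule vector_derivative_at)
qed

text \<open>\<open>pd\<close> has a value even where no derivative exists. Bundling the total
  derivative with named partial derivatives provides existence and value together and supports a
  calculus of rules.\<close>

definition has_grad :: "point set \<Rightarrow> (point \<Rightarrow> 'b::real_normed_vector) \<Rightarrow> (11 \<Rightarrow> point \<Rightarrow> 'b) \<Rightarrow> bool" where
  "has_grad U f f' \<longleftrightarrow> (\<forall>y\<in>U. (f has_derivative (\<lambda>w. \<Sum>r\<in>UNIV. w$r *\<^sub>R f' r y)) (at y))"

lemma has_gradD: "has_grad U f f' \<Longrightarrow> y \<in> U \<Longrightarrow> (f has_derivative (\<lambda>w. \<Sum>r\<in>UNIV. w$r *\<^sub>R f' r y)) (at y)"
  by (simp add: has_grad_def)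

lemma pd_has_grad:
  assumes "has_grad U f f'" "y \<in> U"
  shows "pd r f y = f' r y"
proof -
  have "(\<Sum>s\<in>UNIV. axis r (1::real) $ s *\<^sub>R f' s y) = f' r y"
    by (subst sum.remove[of _ r]) (auto simp: axis_def intro!: sum.neutral)
  then show ?thesis
    unfolding pd_def dir_deriv_has_derivative[OF has_gradD[OF assms]] .
qed

lemma has_grad_cong:
  assumes "open U" "has_grad U f f'" "\<And>y. y \<in> U \<Longrightarrow> f y = g y" "\<And>r y. y \<in> U \<Longrightarrow> f' r y = g' r y"
  shows "has_grad U g g'"
  unfolding has_grad_def
proof
  fix y assume y: "y \<in> U"
  have "(f has_derivative (\<lambda>w. \<Sum>r\<in>UNIV. w$r *\<^sub>R f' r y)) (at y)" using assms(2) y by (rule has_gradD)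
  then have "(g has_derivative (\<lambda>w. \<Sum>r\<in>UNIV. w$r *\<^sub>R f' r y)) (at y)"
    using assms(1) y assms(3) by (rule has_derivative_transform_within_open)
  then show "(g has_derivative (\<lambda>w. \<Sum>r\<in>UNIV. w$r *\<^sub>R g' r y)) (at y)" using assms(4)[OF y] by simp
qed

lemma has_grad_const: "has_grad U (\<lambda>_. c) (\<lambda>_ _. 0)"
  by (simp add: has_grad_def)

lemma has_grad_linear:
  assumes "bounded_linear T" "has_grad U f f'"
  shows "has_grad U (\<lambda>y. T (f y)) (\<lambda>r y. T (f' r y))"
proof -
  interpret bounded_linear T by fact
  show ?thesis unfolding has_grad_def
  proof
    fix y assume "y \<in> U"
    from has_derivative[OF has_gradD[OF assms(2) this]]
    show "((\<lambda>y. T (f y)) has_derivative (\<lambda>w. \<Sum>r\<in>UNIV. w $ r *\<^sub>R T (f' r y))) (at y)"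
      by (simp add: sum scaleR)
  qed
qed

lemma has_grad_sum:
  assumes "\<And>i. i \<in> K \<Longrightarrow> has_grad U (f i) (f' i)"
  shows "has_grad U (\<lambda>y. \<Sum>i\<in>K. f i y) (\<lambda>r y. \<Sum>i\<in>K. f' i r y)"
  unfolding has_grad_def
proof
  fix y assume y: "y \<in> U"
  have "((\<lambda>y. \<Sum>i\<in>K. f i y) has_derivative (\<lambda>w. \<Sum>i\<in>K. \<Sum>r\<in>UNIV. w$r *\<^sub>R f' i r y)) (at y)"
    by (rule has_derivative_sum) (rule has_gradD[OF assms y])
  then show "((\<lambda>y. \<Sum>i\<in>K. f i y) has_derivative (\<lambda>w. \<Sum>r\<in>UNIV. w$r *\<^sub>R (\<Sum>i\<in>K. f' i r y))) (at y)"
    by (subst (asm) sum.swap) (simp add: scaleR_sum_right)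
qed

lemma has_grad_add:
  "has_grad U f f' \<Longrightarrow> has_grad U g g' \<Longrightarrow> has_grad U (\<lambda>y. f y + g y) (\<lambda>r y. f' r y + g' r y)"
  unfolding has_grad_def by (auto intro!: derivative_eq_intros simp: sum.distrib scaleR_add_right)

lemma has_grad_diff:
  "has_grad U f f' \<Longrightarrow> has_grad U g g' \<Longrightarrow> has_grad U (\<lambda>y. f y - g y) (\<lambda>r y. f' r y - g' r y)"
  unfolding has_grad_def by (auto intro!: derivative_eq_intros simp: sum_subtractf scaleR_diff_right)

lemma has_grad_mult:
  fixes f g :: "point \<Rightarrow> real"
  shows "has_grad U f f' \<Longrightarrow> has_grad U g g' \<Longrightarrow> has_grad U (\<lambda>y. f y * g y) (\<lambda>r y. f' r y * g y + f y * g' r y)"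
  unfolding has_grad_def
  by (auto intro!: derivative_eq_intros simp: sum_distrib_left sum_distrib_right sum.distrib algebra_simps)

lemma has_grad_chain:
  fixes f :: "point \<Rightarrow> real"
  assumes "has_grad U f f'" "\<And>y. y \<in> U \<Longrightarrow> (\<Phi> has_real_derivative d y) (at (f y))"
  shows "has_grad U (\<lambda>y. \<Phi> (f y)) (\<lambda>r y. d y * f' r y)"
  unfolding has_grad_def
proof
  fix y assume y: "y \<in> U"
  from has_derivative_compose[OF has_gradD[OF assms(1) y] assms(2)[OF y, unfolded has_field_derivative_def]]
  show "((\<lambda>y. \<Phi> (f y)) has_derivative (\<lambda>w. \<Sum>r\<in>UNIV. w $ r *\<^sub>R (d y * f' r y))) (at y)"
    by (simp add: sum_distrib_left mult_ac)
qed

lemma bounded_linear_axis: "bounded_linear (axis k :: 'b::real_normed_vector \<Rightarrow> 'b^'n)"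
proof (rule bounded_linear_intro[where K = 1])
  fix x :: 'b
  have "norm (axis k x) \<le> (\<Sum>i\<in>UNIV. norm (axis k x $ i))"
    unfolding norm_vec_def by (rule L2_set_le_sum) simp
  also have "\<dots> = norm x" by (simp add: axis_def if_distrib[of norm] cong: if_cong)
  finally show "norm (axis k x) \<le> norm x * 1" by simp
qed (auto simp: axis_def vec_eq_iff)

lemma vec_sum_axis: "(\<chi> r. f r) = (\<Sum>r\<in>UNIV. axis r (f r))"
  by (simp add: vec_eq_iff axis_def sum_component)

lemma grad_has_grad: "has_grad U f f' \<Longrightarrow> y \<in> U \<Longrightarrow> grad f y = (\<chi> r. f' r y)"
  by (simp add: grad_def pd_has_grad)

text \<open>\<open>f'' r s\<close> is the derivative of \<open>f' r\<close> in direction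
  \<open>s\<close>, so it is the entry \<open>$ s $ r\<close> of \<open>grad (grad f)\<close>: the
  index order is reversed.\<close>

lemma has_grad_grad:
  assumes "open U" "has_grad U f f'" "\<And>r. has_grad U (f' r) (f'' r)"
  shows "has_grad U (grad f) (\<lambda>s y. \<chi> r. f'' r s y)"
proof -
  have "has_grad U (\<lambda>y. \<Sum>r\<in>UNIV. axis r (f' r y)) (\<lambda>s y. \<Sum>r\<in>UNIV. axis r (f'' r s y))"
    by (rule has_grad_sum, rule has_grad_linear[OF bounded_linear_axis assms(3)])
  then show ?thesis
    by (rule has_grad_cong[OF assms(1)]) (simp_all add: grad_has_grad[OF assms(2)] vec_sum_axis)
qed

lemma has_grad_imp_differentiable_on: "has_grad U f f' \<Longrightarrow> f differentiable_on U"
  unfolding has_grad_def differentiable_on_def by (meson differentiable_def has_derivative_at_withinI)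

lemma C2_on_has_grad:
  assumes "open U" "has_grad U f f'" "\<And>r. has_grad U (f' r) (f'' r)" "\<And>r s. continuous_on U (f'' r s)"
  shows "C2_on U f"
proof -
  have "continuous_on U (\<lambda>y. \<chi> s r. f'' r s y)"
    by (intro continuous_on_vec_lambda assms)
  then have "continuous_on U (grad (grad f))"
    by (rule continuous_on_eq) (simp add: grad_has_grad[OF has_grad_grad[OF assms(1-3)]])
  then show ?thesis
    unfolding C2_on_def using has_grad_imp_differentiable_on[OF assms(2)] has_grad_imp_differentiable_on[OF has_grad_grad[OF assms(1-3)]] by blast
qed

section \<open>Functions of the first two coordinates\<close>

definition planar :: "(point \<Rightarrow> 'b) \<Rightarrow> bool" where
  "planar f \<longleftrightarrow> (\<forall>y y'. y$1 = y'$1 \<longrightarrow> y$2 = y'$2 \<longrightarrow> f y = f y')"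

lemma planarD: "planar f \<Longrightarrow> y$1 = y'$1 \<Longrightarrow> y$2 = y'$2 \<Longrightarrow> f y = f y'"
  unfolding planar_def by blast

text \<open>At both points the same function of one real variable is differentiated, so the argument
  covers the derivative expressions of \<open>euler_lagrange\<close> before they are
  evaluated.\<close>

lemma planar_pd: "planar f \<Longrightarrow> planar (pd r f)"
  unfolding planar_def[of "pd r f"] pd_def dir_deriv_def
proof (intro allI impI arg_cong[where f = "\<lambda>F. vector_derivative F (at 0)"] ext)
  fix y y' :: point and t
  assume "planar f" "y$1 = y'$1" "y$2 = y'$2"
  then show "f (y + t *\<^sub>R axis r 1) = f (y' + t *\<^sub>R axis r 1)" by (auto intro!: planarD[of f])
qed

lemma planar_grad:
  assumes "planar f"
  shows "planar (grad f)"
  unfolding planar_def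
proof (intro allI impI)
  fix y y' :: point
  assume "y$1 = y'$1" "y$2 = y'$2"
  then have "pd r f y = pd r f y'" for r by (rule planarD[OF planar_pd[OF assms]])
  then show "grad f y = grad f y'" unfolding grad_def by simp
qed

lemma pd_planar_zero:
  assumes "planar f" "r \<notin> {1,2}"
  shows "pd r f y = 0"
proof -
  have "f (y + t *\<^sub>R axis r 1) = f y" for t
    using assms(2) by (auto intro!: planarD[OF assms(1)] simp: axis_def)
  then show ?thesis by (simp add: pd_def dir_deriv_def)
qed


lemma has_grad_Pair:
  assumes "has_grad U f f'" "has_grad U g g'"
  shows "has_grad U (\<lambda>y. (f y, g y)) (\<lambda>r y. (f' r y, g' r y))"
  unfolding has_grad_def
proof
  fix y assume y: "y \<in> U"
  have "(\<Sum>r\<in>UNIV. w$r *\<^sub>R (f' r y, g' r y)) = (\<Sum>r\<in>UNIV. w$r *\<^sub>R f' r y, \<Sum>r\<in>UNIV. w$r *\<^sub>R g' r y)" for w :: point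
    by (simp add: prod_eq_iff fst_sum snd_sum)
  with has_derivative_Pair[OF has_gradD[OF assms(1) y] has_gradD[OF assms(2) y]]
  show "((\<lambda>y. (f y, g y)) has_derivative (\<lambda>w. \<Sum>r\<in>UNIV. w $ r *\<^sub>R (f' r y, g' r y))) (at y)" by simp
qed

lemma has_grad_scaleR: "has_grad U f f' \<Longrightarrow> has_grad U (\<lambda>y. f y *\<^sub>R e) (\<lambda>r y. f' r y *\<^sub>R e)"
  by (rule has_grad_linear[OF bounded_linear_scaleR_left])

lemma has_grad_cmult: "has_grad U f f' \<Longrightarrow> has_grad U (\<lambda>y. (c::real) * f y) (\<lambda>r y. c * f' r y)"
  by (rule has_grad_linear[OF bounded_linear_mult_right])

section \<open>Diagonal metric fields\<close>

definition diagonal :: "(11 \<Rightarrow> real) \<Rightarrow> metric" where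
  "diagonal x = (\<chi> i j. if i = j then x i else 0)"

lemma diagonal_nth: "diagonal x $ i $ j = (if i = j then x i else 0)"
  by (simp add: diagonal_def)

lemma diagonal_sum: "diagonal x = (\<Sum>k\<in>UNIV. x k *\<^sub>R axis k (axis k 1))"
  by (simp add: vec_eq_iff diagonal_def sum_component axis_def if_distrib[of "\<lambda>z. z $ _"] if_distrib[of "\<lambda>z. _ * z"] cong: if_cong)

lemma has_grad_diagonal:
  assumes "\<And>k. has_grad U (f k) (f' k)"
  shows "has_grad U (\<lambda>y. diagonal (\<lambda>k. f k y)) (\<lambda>r y. diagonal (\<lambda>k. f' k r y))"
  unfolding diagonal_sum by (rule has_grad_sum, rule has_grad_scaleR, rule assms)

lemma continuous_on_diagonal:
  assumes "\<And>k. continuous_on U (f k)"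
  shows "continuous_on U (\<lambda>y. diagonal (\<lambda>k. f k y))"
  unfolding diagonal_sum by (intro continuous_intros assms)

lemma has_grad_continuous_on: "has_grad U f f' \<Longrightarrow> continuous_on U f"
  by (rule differentiable_imp_continuous_on[OF has_grad_imp_differentiable_on])

section \<open>The Einstein equations at a point\<close>

text \<open>Half of the exponent of \<open>w\<close> in the metric component;
  \<open>weight_h\<close> is the same for \<open>h\<close>.\<close>

definition weight_w :: "11 \<Rightarrow> real" where
  "weight_w k = (if k \<in> {1,2} then 1/2 else 0)"

definition weight_h :: "11 \<Rightarrow> real" where
  "weight_h k = (if k \<in> {1,2,9,10,11} then 1/3 else -1/6)"

lemma sum_11: "sum f (UNIV :: 11 set) = f 1 + f 2 + f 3 + f 4 + f 5 + f 6 + f 7 + f 8 + f 9 + f 10 + f 11"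
  unfolding UNIV_11 by (simp add: add.assoc)

lemma sum_zero_outside:
  fixes f :: "11 \<Rightarrow> real"
  assumes "\<And>k. k \<notin> {1,2} \<Longrightarrow> f k = 0"
  shows "sum f UNIV = f 1 + f 2"
  using assms by (simp add: sum_11)

text \<open>
  Here \<open>f\<^sub>k = weight_w k * ln w + weight_h k * ln h\<close>; \<open>L\<close> and \<open>l\<close> carry the derivatives of \<open>ln w\<close> and
  \<open>ln h\<close>, and \<open>\<kappa>\<^sup>3 = h\<^sup>-\<^sup>2\<close>.
\<close>

locale brane_solution_at_point = brane_background v \<gamma> \<phi> \<psi> P Q I D \<beta> \<kappa>
  for v \<gamma> \<phi> \<psi> P Q I D \<beta> \<kappa> +
  fixes L' l' :: "11 \<Rightarrow> real" and L'' l'' :: "11 \<Rightarrow> 11 \<Rightarrow> real"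
  assumes \<phi>: "\<phi> k r = weight_w k * L' r + weight_h k * l' r"
    and \<psi>: "\<psi> k r s = weight_w k * L'' r s + weight_h k * l'' r s"
    and L'_zero: "r \<notin> {1,2} \<Longrightarrow> L' r = 0" and l'_zero: "r \<notin> {1,2} \<Longrightarrow> l' r = 0"
    and L''_zero: "r \<notin> {1,2} \<or> s \<notin> {1,2} \<Longrightarrow> L'' r s = 0" and l''_zero: "r \<notin> {1,2} \<or> s \<notin> {1,2} \<Longrightarrow> l'' r s = 0"
    and \<beta>_zero: "r \<notin> {1,2} \<Longrightarrow> \<beta> r = 0"
    and v12: "v 2 = v 1"
    and laplace_L: "L'' 1 1 + L'' 2 2 = 0"
    and laplace_l: "l'' 1 1 + l'' 2 2 = - ((l' 1)\<^sup>2 + (l' 2)\<^sup>2)"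
    and \<beta>_l: "\<kappa>^3 * \<beta> 1 * \<beta> 1 = (l' 2)\<^sup>2" "\<kappa>^3 * \<beta> 2 * \<beta> 2 = (l' 1)\<^sup>2" "\<kappa>^3 * \<beta> 1 * \<beta> 2 = - l' 1 * l' 2"
begin

lemma \<phi>_zero: "r \<notin> {1,2} \<Longrightarrow> \<phi> k r = 0"
  by (simp add: \<phi> L'_zero l'_zero)

lemma \<psi>_zero: "r \<notin> {1,2} \<or> s \<notin> {1,2} \<Longrightarrow> \<psi> k r s = 0"
  using L''_zero[of r s] l''_zero[of r s] by (simp add: \<psi>)

lemma sum_v_\<psi>: "(\<Sum>k\<in>UNIV. v k * \<psi> n k k) = - v 1 * weight_h n * ((l' 1)\<^sup>2 + (l' 2)\<^sup>2)"
proof -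
  have "(\<Sum>k\<in>UNIV. v k * \<psi> n k k) = v 1 * (weight_w n * (L'' 1 1 + L'' 2 2) + weight_h n * (l'' 1 1 + l'' 2 2))"
    by (subst sum_zero_outside) (simp_all add: L''_zero l''_zero v12 \<psi> algebra_simps)
  then show ?thesis by (simp add: laplace_L laplace_l algebra_simps)
qed

lemma sum_v_\<phi>: "(\<Sum>k\<in>UNIV. v k * (\<phi> n k)\<^sup>2) = v 1 * ((\<phi> n 1)\<^sup>2 + (\<phi> n 2)\<^sup>2)"
  by (subst sum_zero_outside) (simp_all add: \<phi>_zero v12 algebra_simps)

lemma sum_\<psi>: "(\<Sum>k\<in>UNIV. \<psi> k r s) = L'' r s + 2/3 * l'' r s"
  by (simp add: sum_11 \<psi> weight_w_def weight_h_def)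

text \<open>Directions 1 and 2 give the first term. Over the other nine the squared weights add up
  to 3/9 + 6/36 = 1/2.\<close>

lemma sum_\<phi>\<phi>: "(\<Sum>k\<in>UNIV. \<phi> k r * \<phi> k s) = 2 * \<phi> 1 r * \<phi> 1 s + l' r * l' s / 2"
  by (simp add: sum_11 \<phi> weight_w_def weight_h_def algebra_simps)

lemma \<phi>_12: "\<phi> 2 r = \<phi> 1 r" "\<psi> 2 r s = \<psi> 1 r s"
  by (simp_all add: \<phi> \<psi> weight_w_def weight_h_def)

lemma \<gamma>_v1_cancel: "\<gamma> 1 * (v 1 * x) = x" "\<gamma> 2 * (v 1 * x) = x" "v 1 * (\<gamma> 2 * x) = x" "v 1 * (2 * (\<gamma> 2 * x)) = 2 * x"
  using v_\<gamma>_cancel(3)[of 1] v_\<gamma>_cancel(3)[of 2] v_\<gamma>_cancel(2)[of 2] by (simp_all add: v12)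

text \<open>\<open>ln w\<close> disappears: it is harmonic, and in the plane the gradient terms 2
  \<open>(\<phi> 1 k)\<^sup>2\<close> cancel those of \<open>sum_\<phi>\<phi>\<close>, leaving only
  \<open>(l' k)\<^sup>2 / 2\<close>.\<close>

lemma Ric_diagonal: "Ric k k = \<gamma> k * v 1 * weight_h k * ((l' 1)\<^sup>2 + (l' 2)\<^sup>2) - (l' k)\<^sup>2 / 2"
proof (cases "k \<in> {1,2}")
  case True
  then show ?thesis
    unfolding Ric_def sum_v_\<psi> sum_\<psi> sum_\<phi>\<phi>
    by (auto simp: \<gamma>_v1_cancel \<phi>_12 v12 \<psi> weight_w_def weight_h_def power2_eq_square algebra_simps)
next
  case False
  then show ?thesis
    unfolding Ric_def sum_v_\<psi> sum_\<psi> sum_\<phi>\<phi>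
    by (simp add: \<phi>_zero \<psi>_zero L''_zero l''_zero l'_zero)
qed

lemma connection_square_diagonal: "connection_square k k = \<gamma> k * v 1 * 2 * ((\<phi> k 1)\<^sup>2 + (\<phi> k 2)\<^sup>2) + (l' k)\<^sup>2 / 2"
proof (cases "k \<in> {1,2}")
  case True
  then show ?thesis
    unfolding connection_square_def sum_v_\<phi> sum_\<phi>\<phi>
    by (auto simp: \<gamma>_v1_cancel \<phi>_12 v12 power2_eq_square algebra_simps)
next
  case False
  then show ?thesis
    unfolding connection_square_def sum_v_\<phi> sum_\<phi>\<phi>
    by (simp add: \<phi>_zero l'_zero)
qed

lemma Ric_off_diagonal: "k \<noteq> n \<Longrightarrow> Ric k n = - l' k * l' n / 2"
proof (cases "k \<in> {1,2} \<and> n \<in> {1,2}")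
  case True
  moreover assume "k \<noteq> n"
  ultimately show ?thesis
    unfolding Ric_def sum_v_\<psi> sum_\<psi> sum_\<phi>\<phi>
    by (auto simp: \<phi>_12 \<psi> weight_w_def weight_h_def \<psi>_sym[of 1 2 1] \<psi>_sym[of 2 2 1] algebra_simps)
next
  case False
  moreover assume "k \<noteq> n"
  ultimately show ?thesis
    unfolding Ric_def sum_v_\<psi> sum_\<psi> sum_\<phi>\<phi>
    by (auto simp: \<phi>_zero \<psi>_zero L''_zero l''_zero l'_zero)
qed

lemma connection_square_off_diagonal: "k \<noteq> n \<Longrightarrow> connection_square k n = l' k * l' n / 2"
proof (cases "k \<in> {1,2} \<and> n \<in> {1,2}")
  case True
  moreover assume "k \<noteq> n"
  ultimately show ?thesis
    unfolding connection_square_def sum_v_\<phi> sum_\<phi>\<phi>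
    by (auto simp: \<phi>_12 algebra_simps)
next
  case False
  moreover assume "k \<noteq> n"
  ultimately show ?thesis
    unfolding connection_square_def sum_v_\<phi> sum_\<phi>\<phi>
    by (auto simp: \<phi>_zero l'_zero)
qed

text \<open>The coefficient is 2/3 - 1/2: the total of \<open>weight_h\<close> minus the gradient
  term in the plane.\<close>

lemma curvature_scalar_value: "(\<Sum>l\<in>UNIV. v l * Ric l l) = v 1 * ((l' 1)\<^sup>2 + (l' 2)\<^sup>2) / 6"
proof -
  have "v l * Ric l l = v 1 * weight_h l * ((l' 1)\<^sup>2 + (l' 2)\<^sup>2) - v l * (l' l)\<^sup>2 / 2" for l
    unfolding Ric_diagonal using v_\<gamma>_cancel(2)[of l "v 1 * weight_h l * ((l' 1)\<^sup>2 + (l' 2)\<^sup>2)"] by (simp add: algebra_simps)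
  then have "(\<Sum>l\<in>UNIV. v l * Ric l l) = v 1 * (\<Sum>l\<in>UNIV. weight_h l) * ((l' 1)\<^sup>2 + (l' 2)\<^sup>2) - (\<Sum>l\<in>UNIV. v l * (l' l)\<^sup>2 / 2)"
    by (simp add: sum_subtractf sum_distrib_left sum_distrib_right)
  moreover have "(\<Sum>l\<in>UNIV. v l * (l' l)\<^sup>2 / 2) = v 1 * ((l' 1)\<^sup>2 + (l' 2)\<^sup>2) / 2"
    by (subst sum_zero_outside) (simp_all add: l'_zero v12 algebra_simps)
  moreover have "(\<Sum>l\<in>UNIV. weight_h l) = 2/3" by (simp add: sum_11 weight_h_def)
  ultimately show ?thesis by simp
qed

lemma flux_norm: "\<kappa>^3 * (\<Sum>n\<in>UNIV. v n * (\<beta> n)\<^sup>2) = v 1 * ((l' 1)\<^sup>2 + (l' 2)\<^sup>2)"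
proof -
  have "(\<Sum>n\<in>UNIV. v n * (\<beta> n)\<^sup>2) = v 1 * (\<beta> 1)\<^sup>2 + v 1 * (\<beta> 2)\<^sup>2"
    by (subst sum_zero_outside) (simp_all add: \<beta>_zero v12)
  then show ?thesis using \<beta>_l by algebra
qed

lemma contracted_square_value:
  "contracted_square v D k n = 6 * (\<kappa>^3 * \<beta> k * \<beta> n)
     + (if k = n \<and> k \<in> {9,10,11} then 6 * \<gamma> k * v 1 * ((l' 1)\<^sup>2 + (l' 2)\<^sup>2) else 0)"
proof -
  have "6 * \<kappa>\<^sup>2 * (\<Sum>n\<in>UNIV. v n * (\<beta> n)\<^sup>2) = 6 * \<gamma> k * v 1 * ((l' 1)\<^sup>2 + (l' 2)\<^sup>2)" if "k \<in> {9,10,11}"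
  proof -
    have "\<kappa> * \<gamma> k = 1" using that v[of k] \<kappa> by auto
    then show ?thesis using flux_norm by algebra
  qed
  then show ?thesis unfolding contracted_square_eq by auto
qed

lemma flux_square_value: "(\<Sum>l\<in>UNIV. v l * contracted_square v D l l) = 24 * v 1 * ((l' 1)\<^sup>2 + (l' 2)\<^sup>2)"
proof -
  let ?q = "(l' 1)\<^sup>2 + (l' 2)\<^sup>2"
  have "v l * contracted_square v D l l = 6 * (\<kappa>^3 * (v l * (\<beta> l)\<^sup>2)) + (if l \<in> {9,10,11} then 6 * v 1 * ?q else 0)" for l
    unfolding contracted_square_value using v_\<gamma>_cancel(2)[of l "6 * v 1 * ?q"] by (simp add: algebra_simps power2_eq_square)
  then have "(\<Sum>l\<in>UNIV. v l * contracted_square v D l l) = 6 * (\<kappa>^3 * (\<Sum>l\<in>UNIV. v l * (\<beta> l)\<^sup>2)) + (\<Sum>l::11\<in>UNIV. if l \<in> {9,10,11} then 6 * v 1 * ?q else 0)"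
    by (simp add: sum.distrib sum_distrib_left)
  then show ?thesis unfolding flux_norm by (simp add: sum_11)
qed

text \<open>The term with \<open>\<phi>\<close> and \<open>\<psi>\<close> anticipates the divergence
  terms and equals one Ricci tensor plus \<open>connection_square\<close>. What is left is the
  Einstein equation with R - F^2/48 = - v_1 q / 3, where q is the squared flat gradient of
  \<open>ln h\<close>. In units of g_kk v_1 q its terms are -1/6 - 1/3 + 1/2 in directions 9 to 11
  and -1/6 + 1/6 in directions 3 to 8.\<close>

lemma einstein_equations:
  "(if k = n then \<gamma> k * ((\<Sum>l\<in>UNIV. v l * Ric l l) - (\<Sum>l\<in>UNIV. v l * contracted_square v D l l) / 48) / 2
       + \<gamma> k * v 1 * (2 * ((\<phi> k 1)\<^sup>2 + (\<phi> k 2)\<^sup>2) - (\<psi> k 1 1 + \<psi> k 2 2)) else 0)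
     - (Ric k n + Ric n k + connection_square k n) + contracted_square v D k n / 12 = 0"
proof (cases "k = n")
  case True
  have "v 1 * (\<psi> k 1 1 + \<psi> k 2 2) = - v 1 * weight_h k * ((l' 1)\<^sup>2 + (l' 2)\<^sup>2)"
    unfolding sum_v_\<psi>[symmetric] by (subst sum_zero_outside) (simp_all add: \<psi>_zero v12 algebra_simps)
  then have \<psi>: "\<gamma> k * v 1 * (2 * ((\<phi> k 1)\<^sup>2 + (\<phi> k 2)\<^sup>2) - (\<psi> k 1 1 + \<psi> k 2 2))
      = \<gamma> k * v 1 * (2 * ((\<phi> k 1)\<^sup>2 + (\<phi> k 2)\<^sup>2) + weight_h k * ((l' 1)\<^sup>2 + (l' 2)\<^sup>2))" by algebra
  consider "k = 1" | "k = 2" | "k \<in> {9,10,11}" | "k \<notin> {1,2,9,10,11}" by blast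
  then show ?thesis
    unfolding if_P[OF True] \<psi> curvature_scalar_value flux_square_value
    unfolding True[symmetric] Ric_diagonal connection_square_diagonal contracted_square_value
    by cases (use \<beta>_l in \<open>auto simp: \<gamma>_v1_cancel v12 weight_h_def l'_zero \<beta>_zero algebra_simps add_divide_distrib diff_divide_distrib\<close>)
next
  case False
  have "\<kappa>^3 * \<beta> k * \<beta> n = - l' k * l' n"
  proof (cases "k \<in> {1,2} \<and> n \<in> {1,2}")
    case True
    with False show ?thesis using \<beta>_l(3) by (auto simp: mult_ac)
  next
    case 2: False
    then show ?thesis by (auto simp: \<beta>_zero l'_zero)
  qed
  with False show ?thesis
    by (simp add: Ric_off_diagonal connection_square_off_diagonal contracted_square_value)
qed

text \<open>\<open>S\<close> is the density sqrt|det g|. The variation of the density cancels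
  against the trace part of \<open>Y\<close>, so only the divergence remainder \<open>W\<close>
  survives.\<close>

lemma metric_variation_value:
  assumes S: "S * v 1 = 1"
  shows "S * ((\<Sum>k\<in>UNIV. v k * h$k$k) / 2 * ((\<Sum>l\<in>UNIV. v l * Ric l l) - (\<Sum>l\<in>UNIV. v l * contracted_square v D l l) / 48)
       - (\<Sum>l\<in>UNIV. \<Sum>n\<in>UNIV. h$l$n * v l * v n * (Ric l n + Ric n l + connection_square l n))
       + (\<Sum>l\<in>UNIV. \<Sum>n\<in>UNIV. h$l$n * v l * v n * contracted_square v D l n) / 12)
    = (\<Sum>k\<in>UNIV. h$k$k * v k * (\<psi> k 1 1 + \<psi> k 2 2 - 2 * ((\<phi> k 1)\<^sup>2 + (\<phi> k 2)\<^sup>2)))"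
proof -
  define R where "R = (\<Sum>l\<in>UNIV. v l * Ric l l) - (\<Sum>l\<in>UNIV. v l * contracted_square v D l l) / 48"
  define W where "W k = 2 * ((\<phi> k 1)\<^sup>2 + (\<phi> k 2)\<^sup>2) - (\<psi> k 1 1 + \<psi> k 2 2)" for k
  define Y where "Y l n = - (Ric l n + Ric n l + connection_square l n) + contracted_square v D l n / 12" for l n
  have Y: "Y l n = - (if l = n then \<gamma> l * R / 2 + \<gamma> l * v 1 * W l else 0)" for l n
    using einstein_equations[of l n] unfolding R_def W_def Y_def by (auto split: if_splits)
  have "S * ((\<Sum>k\<in>UNIV. v k * h$k$k) / 2 * R
       - (\<Sum>l\<in>UNIV. \<Sum>n\<in>UNIV. h$l$n * v l * v n * (Ric l n + Ric n l + connection_square l n))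
       + (\<Sum>l\<in>UNIV. \<Sum>n\<in>UNIV. h$l$n * v l * v n * contracted_square v D l n) / 12)
     = S * ((\<Sum>k\<in>UNIV. v k * h$k$k) / 2 * R + (\<Sum>l\<in>UNIV. \<Sum>n\<in>UNIV. h$l$n * v l * v n * Y l n))"
    by (simp add: Y_def algebra_simps sum.distrib sum_subtractf sum_negf sum_divide_distrib)
  also have "(\<Sum>l\<in>UNIV. \<Sum>n\<in>UNIV. h$l$n * v l * v n * Y l n) = - (\<Sum>l\<in>UNIV. h$l$l * v l * (R / 2 + v 1 * W l))"
  proof -
    have "h$l$n * v l * v n * Y l n = - (if l = n then h$l$l * v l * (R / 2 + v 1 * W l) else 0)" for l n
    proof (cases "l = n")
      case True
      have "h$n$n * v n * v n * - (\<gamma> n * R / 2 + \<gamma> n * v 1 * W n)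
          = - (h$n$n * v n * (v n * (\<gamma> n * (R / 2 + v 1 * W n))))" by (simp add: algebra_simps)
      also have "\<dots> = - (h$n$n * v n * (R / 2 + v 1 * W n))" unfolding v_\<gamma>_cancel(2) ..
      finally show ?thesis unfolding Y True by (simp only: refl if_True)
    qed (simp add: Y)
    then show ?thesis by (simp add: sum_negf)
  qed
  also have "S * ((\<Sum>k\<in>UNIV. v k * h$k$k) / 2 * R + - (\<Sum>l\<in>UNIV. h$l$l * v l * (R / 2 + v 1 * W l)))
      = (\<Sum>l\<in>UNIV. - (S * v 1) * (h$l$l * v l * W l))"
    by (simp add: algebra_simps sum.distrib sum_distrib_left sum_distrib_right sum_negf sum_divide_distrib)
  also have "\<dots> = (\<Sum>k\<in>UNIV. h$k$k * v k * (\<psi> k 1 1 + \<psi> k 2 2 - 2 * ((\<phi> k 1)\<^sup>2 + (\<phi> k 2)\<^sup>2)))"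
    unfolding S W_def by (simp add: algebra_simps)
  finally show ?thesis unfolding R_def .
qed

end

section \<open>The Euler--Lagrange expression of the brane configurations\<close>

lemma pd_cong_open:
  assumes "open U" "y \<in> U" "\<And>z. z \<in> U \<Longrightarrow> f z = g z" "has_grad U g g'"
  shows "pd r f y = g' r y"
  by (rule pd_has_grad[OF has_grad_cong[OF assms(1) assms(4)] assms(2)]) (simp_all add: assms(3))

lemma pd_zero: "pd r (\<lambda>_. 0 :: 'b::real_normed_vector) x = 0"
  by (simp add: pd_def dir_deriv_def)

text \<open>
  \<open>L = ln w\<close>, \<open>l = ln h\<close> and \<open>b\<close> is the potential. The assumption \<open>b_l\<close> states the Cauchy--Riemann
  equations for \<open>h \<plusminus> \<i> b\<close>.
\<close>

locale brane_configuration =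
  fixes U :: "point set" and L l b :: "point \<Rightarrow> real"
    and L' l' b' :: "11 \<Rightarrow> point \<Rightarrow> real" and L'' l'' b'' :: "11 \<Rightarrow> 11 \<Rightarrow> point \<Rightarrow> real"
    and sign_of :: "11 \<Rightarrow> real" and g :: "point \<Rightarrow> metric" and A :: "point \<Rightarrow> three_form"
  assumes open_U: "open U"
    and grad_L: "has_grad U L L'" "\<And>r. has_grad U (L' r) (L'' r)" "\<And>r s. continuous_on U (L'' r s)"
    and grad_l: "has_grad U l l'" "\<And>r. has_grad U (l' r) (l'' r)" "\<And>r s. continuous_on U (l'' r s)"
    and grad_b: "has_grad U b b'" "\<And>r. has_grad U (b' r) (b'' r)" "\<And>r s. continuous_on U (b'' r s)"
    and first_derivatives_zero: "\<And>r y. r \<notin> {1,2} \<Longrightarrow> y \<in> U \<Longrightarrow> L' r y = 0 \<and> l' r y = 0 \<and> b' r y = 0"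
    and second_derivatives_zero: "\<And>r s y. r \<notin> {1,2} \<or> s \<notin> {1,2} \<Longrightarrow> y \<in> U \<Longrightarrow> L'' r s y = 0 \<and> l'' r s y = 0"
    and sym: "\<And>r s y. y \<in> U \<Longrightarrow> L'' r s y = L'' s r y \<and> l'' r s y = l'' s r y"
    and laplace_L: "\<And>y. y \<in> U \<Longrightarrow> L'' 1 1 y + L'' 2 2 y = 0"
    and laplace_l: "\<And>y. y \<in> U \<Longrightarrow> l'' 1 1 y + l'' 2 2 y = - ((l' 1 y)\<^sup>2 + (l' 2 y)\<^sup>2)"
    and laplace_b: "\<And>y. y \<in> U \<Longrightarrow> b'' 1 1 y + b'' 2 2 y = 0"
    and b_l: "\<And>y. y \<in> U \<Longrightarrow> \<exists>\<epsilon>::real. \<epsilon>\<^sup>2 = 1 \<and> b' 1 y = - \<epsilon> * exp (l y) * l' 2 y \<and> b' 2 y = \<epsilon> * exp (l y) * l' 1 y"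
    and sign_of: "\<And>k. (sign_of k)\<^sup>2 = 1" "\<And>k. k \<in> {1,2,9,10,11} \<Longrightarrow> sign_of k = 1"
    and g: "\<And>y. y \<in> U \<Longrightarrow> g y = diagonal (\<lambda>k. sign_of k * exp (2 * (weight_w k * L y + weight_h k * l y)))"
    and A: "\<And>y. y \<in> U \<Longrightarrow> A y = brane_potential (b y)"
    and planar: "planar g" "planar A"
begin

definition \<gamma> where "\<gamma> k y = sign_of k * exp (2 * (weight_w k * L y + weight_h k * l y))"
definition v where "v k y = sign_of k * exp (- 2 * (weight_w k * L y + weight_h k * l y))"
definition \<phi> where "\<phi> k r y = weight_w k * L' r y + weight_h k * l' r y"
definition \<psi> where "\<psi> k r s y = weight_w k * L'' r s y + weight_h k * l'' r s y"
definition \<kappa> where "\<kappa> y = exp (- 2/3 * l y)"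
definition \<gamma>' where "\<gamma>' r k y = 2 * (\<gamma> k y * \<phi> k r y)"
definition \<gamma>'' where "\<gamma>'' r s k y = 2 * (\<gamma>' s k y * \<phi> k r y + \<gamma> k y * \<psi> k r s y)"

lemma v_\<gamma>: "v k y * \<gamma> k y = 1"
proof -
  have "v k y * \<gamma> k y = (sign_of k)\<^sup>2 * (exp (- (2 * (weight_w k * L y + weight_h k * l y))) * exp (2 * (weight_w k * L y + weight_h k * l y)))"
    by (simp add: v_def \<gamma>_def power2_eq_square mult_ac)
  then show ?thesis by (simp add: sign_of flip: exp_add)
qed

lemma grad_\<phi>: "has_grad U (\<phi> k r) (\<psi> k r)"
  unfolding \<phi>_def \<psi>_def by (intro has_grad_add has_grad_cmult grad_L grad_l)

lemma grad_f: "has_grad U (\<lambda>y. weight_w k * L y + weight_h k * l y) (\<phi> k)"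
  unfolding \<phi>_def by (intro has_grad_add has_grad_cmult grad_L grad_l)

lemma grad_\<gamma>: "has_grad U (\<gamma> k) (\<lambda>r. \<gamma>' r k)"
proof -
  have "has_grad U (\<lambda>y. sign_of k * exp (2 * (weight_w k * L y + weight_h k * l y)))
     (\<lambda>r y. sign_of k * (exp (2 * (weight_w k * L y + weight_h k * l y)) * 2 * \<phi> k r y))"
    by (rule has_grad_cmult, rule has_grad_chain[OF grad_f, of "\<lambda>z. exp (2 * z)"]) (auto intro!: derivative_eq_intros)
  then show ?thesis
    by (rule has_grad_cong[OF open_U]) (simp_all add: \<gamma>_def \<gamma>'_def)
qed

lemma grad_v: "has_grad U (v k) (\<lambda>r y. - 2 * (v k y * \<phi> k r y))"
proof -
  have "has_grad U (\<lambda>y. sign_of k * exp (- 2 * (weight_w k * L y + weight_h k * l y)))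
     (\<lambda>r y. sign_of k * (exp (- 2 * (weight_w k * L y + weight_h k * l y)) * - 2 * \<phi> k r y))"
    by (rule has_grad_cmult, rule has_grad_chain[OF grad_f, of "\<lambda>z. exp (- 2 * z)"]) (auto intro!: derivative_eq_intros)
  then show ?thesis
    by (rule has_grad_cong[OF open_U]) (simp_all add: v_def)
qed

lemma grad_\<gamma>': "has_grad U (\<gamma>' r k) (\<lambda>s. \<gamma>'' r s k)"
  unfolding \<gamma>'_def[of r] \<gamma>''_def by (intro has_grad_cmult has_grad_mult grad_\<gamma> grad_\<phi>)

text \<open>\<open>\<kappa> y ^ 3\<close> is the coefficient h^-2 of the flux equation: the product
  of the three inverse metric components along the potential.\<close>

lemma grad_\<kappa>: "has_grad U (\<lambda>y. \<kappa> y ^ 3) (\<lambda>r y. - 2 * (\<kappa> y ^ 3 * l' r y))"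
proof -
  have k: "\<kappa> y ^ 3 = exp (- 2 * l y)" for y
    by (simp add: \<kappa>_def flip: exp_of_nat_mult)
  have "has_grad U (\<lambda>y. exp (- 2 * l y)) (\<lambda>r y. exp (- 2 * l y) * - 2 * l' r y)"
    by (rule has_grad_chain[OF grad_l(1), of "\<lambda>z. exp (- 2 * z)"]) (auto intro!: derivative_eq_intros)
  then show ?thesis unfolding k by (rule has_grad_cong[OF open_U]) simp_all
qed

lemma grad_g: "has_grad U g (\<lambda>r y. diagonal (\<lambda>k. \<gamma>' r k y))"
  by (rule has_grad_cong[OF open_U has_grad_diagonal[OF grad_\<gamma>]]) (simp_all add: g \<gamma>_def)

lemma grad_g': "has_grad U (\<lambda>y. diagonal (\<lambda>k. \<gamma>' r k y)) (\<lambda>s y. diagonal (\<lambda>k. \<gamma>'' r s k y))"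
  by (rule has_grad_diagonal[OF grad_\<gamma>'])

lemma grad_A: "has_grad U A (\<lambda>r y. b' r y *\<^sub>R brane_potential 1)"
  by (rule has_grad_cong[OF open_U has_grad_scaleR[OF grad_b(1), of "brane_potential 1"]])
     (simp_all add: A brane_potential_scale[symmetric])

lemma grad_A': "has_grad U (\<lambda>y. b' r y *\<^sub>R brane_potential 1) (\<lambda>s y. b'' r s y *\<^sub>R brane_potential 1)"
  by (rule has_grad_scaleR[OF grad_b(2)])

lemma C2_g: "C2_on U g"
  by (rule C2_on_has_grad[OF open_U grad_g grad_g'], rule continuous_on_diagonal)
     (auto simp: \<gamma>''_def \<gamma>'_def \<phi>_def \<psi>_def
        intro!: continuous_intros has_grad_continuous_on[OF grad_\<gamma>]
          has_grad_continuous_on[OF grad_L(2)] has_grad_continuous_on[OF grad_l(2)] grad_L grad_l)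

lemma C2_A: "C2_on U A"
  by (rule C2_on_has_grad[OF open_U grad_A grad_A']) (intro continuous_intros grad_b)

definition u where "u y = (g y, A y)"

lemma grad_u: "has_grad U u (\<lambda>r y. (diagonal (\<lambda>k. \<gamma>' r k y), b' r y *\<^sub>R brane_potential 1))"
  unfolding u_def by (rule has_grad_Pair[OF grad_g grad_A])

lemma grad_u': "has_grad U (\<lambda>y. (diagonal (\<lambda>k. \<gamma>' r k y), b' r y *\<^sub>R brane_potential 1))
    (\<lambda>s y. (diagonal (\<lambda>k. \<gamma>'' r s k y), b'' r s y *\<^sub>R brane_potential 1))"
  by (rule has_grad_Pair[OF grad_g' grad_A'])

lemma \<phi>_directions_equal: "v 2 y = v 1 y" "\<phi> 2 r y = \<phi> 1 r y" "\<psi> 2 r s y = \<psi> 1 r s y"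
  by (simp_all add: v_def \<phi>_def \<psi>_def weight_w_def weight_h_def sign_of)

lemma \<phi>_zero: "r \<notin> {1,2} \<Longrightarrow> y \<in> U \<Longrightarrow> \<phi> k r y = 0"
  using first_derivatives_zero[of r y] by (simp add: \<phi>_def)

lemma \<psi>_zero: "r \<notin> {1,2} \<or> s \<notin> {1,2} \<Longrightarrow> y \<in> U \<Longrightarrow> \<psi> k r s y = 0"
  using second_derivatives_zero[of r s y] by (simp add: \<psi>_def)

lemma sqrt_det: "y \<in> U \<Longrightarrow> sqrt \<bar>det (g y)\<bar> * v 1 y = 1"
proof -
  assume y: "y \<in> U"
  have "\<bar>sign_of k\<bar> = 1" for k
    using sign_of(1)[of k] by (simp add: power2_eq_1_iff) auto
  then have "\<bar>det (g y)\<bar> = (\<Prod>k\<in>UNIV. exp (2 * (weight_w k * L y + weight_h k * l y)))"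
    by (subst det_diagonal) (simp_all add: g[OF y] diagonal_nth abs_prod abs_mult)
  also have "\<dots> = exp (\<Sum>k\<in>UNIV. 2 * (weight_w k * L y + weight_h k * l y))"
    by (simp add: exp_sum)
  also have "(\<Sum>k\<in>UNIV. 2 * (weight_w k * L y + weight_h k * l y)) = 2 * (L y + 2/3 * l y)"
    by (simp add: sum_11 weight_w_def weight_h_def algebra_simps)
  finally have "sqrt \<bar>det (g y)\<bar> = sqrt ((exp (L y + 2/3 * l y))\<^sup>2)"
    by (simp add: power2_eq_square flip: exp_add)
  then have "sqrt \<bar>det (g y)\<bar> = exp (L y + 2/3 * l y)" by simp
  moreover have "v 1 y = exp (- (L y + 2/3 * l y))"
    by (simp add: v_def sign_of weight_w_def weight_h_def)
  ultimately show ?thesis by (simp flip: exp_add)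
qed

lemma g_eq: "y \<in> U \<Longrightarrow> g y = diagonal (\<lambda>k. \<gamma> k y)"
  by (simp add: g \<gamma>_def)

lemma brane_fields:
  assumes y: "y \<in> U"
  shows "brane_fields (\<lambda>k. v k y) (\<lambda>k. \<gamma> k y) (\<lambda>k r. \<phi> k r y) (\<lambda>k r s. \<psi> k r s y)
    (\<chi> r. diagonal (\<lambda>k. \<gamma>' r k y)) (\<chi> s r. diagonal (\<lambda>k. \<gamma>'' r s k y)) (diagonal (\<lambda>k. v k y))
    (\<chi> r. b' r y *\<^sub>R brane_potential 1) (\<lambda>r. b' r y) (\<kappa> y) (g y) (grad u y) (grad (grad u) y)"
proof
  show "2 * \<phi> r r y = (\<Sum>k\<in>UNIV. \<phi> k r y)" for r
  proof (cases "r \<in> {1,2}")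
    case True
    then show ?thesis by (auto simp: sum_11 \<phi>_def weight_w_def weight_h_def)
  qed (simp add: \<phi>_zero y)
  show "v 9 y = \<kappa> y" "v 10 y = \<kappa> y" "v 11 y = \<kappa> y"
    by (simp_all add: v_def \<kappa>_def weight_w_def weight_h_def sign_of)
  show "b' r y = 0" if "r \<in> {9,10,11}" for r
    using first_derivatives_zero[of r y] that y by auto
qed (use sym[OF y] in \<open>auto simp: v_\<gamma> v_\<gamma>[THEN trans[OF mult.commute]] diagonal_nth \<gamma>'_def \<gamma>''_def \<psi>_def g_eq[OF y] algebra_simps
      grad_has_grad[OF grad_u y] grad_has_grad[OF has_grad_grad[OF open_U grad_u grad_u'] y]\<close>)

lemma u_eq: "y \<in> U \<Longrightarrow> u y = (g y, brane_potential (b y))"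
  by (simp add: u_def A)

lemma brane_solution:
  assumes y: "y \<in> U"
  shows "brane_solution_at_point (\<lambda>k. v k y) (\<lambda>k. \<gamma> k y) (\<lambda>k r. \<phi> k r y) (\<lambda>k r s. \<psi> k r s y)
    (\<chi> r. diagonal (\<lambda>k. \<gamma>' r k y)) (\<chi> s r. diagonal (\<lambda>k. \<gamma>'' r s k y)) (diagonal (\<lambda>k. v k y))
    (\<chi> r. b' r y *\<^sub>R brane_potential 1) (\<lambda>r. b' r y) (\<kappa> y) (\<lambda>r. L' r y) (\<lambda>r. l' r y) (\<lambda>r s. L'' r s y) (\<lambda>r s. l'' r s y)"
proof -
  interpret brane_fields "\<lambda>k. v k y" "\<lambda>k. \<gamma> k y" "\<lambda>k r. \<phi> k r y" "\<lambda>k r s. \<psi> k r s y"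
    "\<chi> r. diagonal (\<lambda>k. \<gamma>' r k y)" "\<chi> s r. diagonal (\<lambda>k. \<gamma>'' r s k y)" "diagonal (\<lambda>k. v k y)"
    "\<chi> r. b' r y *\<^sub>R brane_potential 1" "\<lambda>r. b' r y" "\<kappa> y" "g y" "b y" "grad u y" "grad (grad u) y"
    by (rule brane_fields[OF y])
  obtain \<epsilon> :: real where \<epsilon>: "\<epsilon>\<^sup>2 = 1" "b' 1 y = - \<epsilon> * exp (l y) * l' 2 y" "b' 2 y = \<epsilon> * exp (l y) * l' 1 y"
    using b_l[OF y] by blast
  have k: "\<kappa> y ^ 3 * (exp (l y))\<^sup>2 = 1"
    by (simp add: \<kappa>_def power2_eq_square flip: exp_of_nat_mult exp_add)
  show ?thesis
  proof
    show "\<kappa> y ^ 3 * b' 1 y * b' 1 y = (l' 2 y)\<^sup>2" "\<kappa> y ^ 3 * b' 2 y * b' 2 y = (l' 1 y)\<^sup>2" "\<kappa> y ^ 3 * b' 1 y * b' 2 y = - l' 1 y * l' 2 y"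
      unfolding \<epsilon>(2,3) using \<epsilon>(1) k by algebra+
  qed (use first_derivatives_zero[OF _ y] second_derivatives_zero[OF _ y] laplace_L[OF y] laplace_l[OF y] in \<open>auto simp: \<phi>_def \<psi>_def \<phi>_directions_equal\<close>)
qed


section \<open>Jet variations, their divergences and the final cancellation\<close>

lemma planar_fields: "planar (\<lambda>y. F (u y) (grad u y) (grad (grad u) y))"
proof -
  have "planar u"
    using planar unfolding planar_def u_def by blast
  then have "planar u" "planar (grad u)" "planar (grad (grad u))"
    by (simp_all add: planar_grad)
  then show ?thesis
    unfolding planar_def by metis
qed

lemma first_jet_variation:
  assumes y: "y \<in> U" and h: "transpose h = h" and a: "antisymmetric a" and r: "r \<in> {1,2}"
  shows "dir_deriv (\<lambda>p. sugra_lagrangian c (u y) p (grad (grad u) y)) (grad u y) (axis r (h, a)) =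
    3 * (\<Sum>k\<in>UNIV. h$k$k * (v k y * \<phi> k r y)) - 2 * (\<Sum>k\<in>UNIV. h$r$k * (v k y * \<phi> r k y)) - a$9$10$11 * (\<kappa> y ^ 3 * b' r y)"
proof -
  interpret brane_fields "\<lambda>k. v k y" "\<lambda>k. \<gamma> k y" "\<lambda>k r. \<phi> k r y" "\<lambda>k r s. \<psi> k r s y"
    "\<chi> r. diagonal (\<lambda>k. \<gamma>' r k y)" "\<chi> s r. diagonal (\<lambda>k. \<gamma>'' r s k y)" "diagonal (\<lambda>k. v k y)"
    "\<chi> r. b' r y *\<^sub>R brane_potential 1" "\<lambda>r. b' r y" "\<kappa> y" "g y" "b y" "grad u y" "grad (grad u) y"
    by (rule brane_fields[OF y])
  have "r \<notin> {9,10,11}" using r by auto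
  from dir_deriv_first[OF h a this, of c]
  have "dir_deriv (\<lambda>p. sugra_lagrangian c (u y) p (grad (grad u) y)) (grad u y) (axis r (h, a)) =
    (sqrt \<bar>det (g y)\<bar> * v r y) * (3 * (\<Sum>k\<in>UNIV. h$k$k * (v k y * \<phi> k r y)) - 2 * (\<Sum>k\<in>UNIV. h$r$k * (v k y * \<phi> r k y)) - a$9$10$11 * (\<kappa> y ^ 3 * b' r y))"
    by (simp add: u_eq[OF y] algebra_simps)
  also have "sqrt \<bar>det (g y)\<bar> * v r y = 1" using sqrt_det[OF y] r by (auto simp: \<phi>_directions_equal)
  finally show ?thesis by simp
qed

lemma second_jet_variation:
  assumes y: "y \<in> U" and h: "transpose h = h" and r: "r \<in> {1,2}"
  shows "dir_deriv (\<lambda>q. sugra_lagrangian c (u y) (grad u y) q) (grad (grad u) y) (axis r (axis s (h, a))) =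
    h$r$s * v s y - (if r = s then \<Sum>k\<in>UNIV. h$k$k * v k y else 0)"
proof -
  interpret brane_fields "\<lambda>k. v k y" "\<lambda>k. \<gamma> k y" "\<lambda>k r. \<phi> k r y" "\<lambda>k r s. \<psi> k r s y"
    "\<chi> r. diagonal (\<lambda>k. \<gamma>' r k y)" "\<chi> s r. diagonal (\<lambda>k. \<gamma>'' r s k y)" "diagonal (\<lambda>k. v k y)"
    "\<chi> r. b' r y *\<^sub>R brane_potential 1" "\<lambda>r. b' r y" "\<kappa> y" "g y" "b y" "grad u y" "grad (grad u) y"
    by (rule brane_fields[OF y])
  have "sqrt \<bar>det (g y)\<bar> * (v r y * v s y * h$r$s - (if r = s then v r y * (\<Sum>k\<in>UNIV. v k y * h$k$k) else 0)) =
    (sqrt \<bar>det (g y)\<bar> * v r y) * (h$r$s * v s y - (if r = s then \<Sum>k\<in>UNIV. h$k$k * v k y else 0))"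
    by (cases "r = s") (simp_all add: algebra_simps)
  also have "sqrt \<bar>det (g y)\<bar> * v r y = 1" using sqrt_det[OF y] r by (auto simp: \<phi>_directions_equal)
  finally show ?thesis unfolding u_eq[OF y] dir_deriv_second[OF h] by simp
qed

lemma pd_first_jet_variation:
  assumes y: "y \<in> U" and h: "transpose h = h" and a: "antisymmetric a" and r: "r \<in> {1,2}"
  shows "pd r (\<lambda>y. dir_deriv (\<lambda>p. sugra_lagrangian c (u y) p (grad (grad u) y)) (grad u y) (axis r (h, a))) y =
    3 * (\<Sum>k\<in>UNIV. h$k$k * (- 2 * (v k y * \<phi> k r y) * \<phi> k r y + v k y * \<psi> k r r y))
    - 2 * (\<Sum>k\<in>UNIV. h$r$k * (- 2 * (v k y * \<phi> k r y) * \<phi> r k y + v k y * \<psi> r k r y))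
    - a$9$10$11 * (- 2 * (\<kappa> y ^ 3 * l' r y) * b' r y + \<kappa> y ^ 3 * b'' r r y)"
proof -
  have "has_grad U (\<lambda>y. 3 * (\<Sum>k\<in>UNIV. h$k$k * (v k y * \<phi> k r y)) - 2 * (\<Sum>k\<in>UNIV. h$r$k * (v k y * \<phi> r k y)) - a$9$10$11 * (\<kappa> y ^ 3 * b' r y))
    (\<lambda>r' y. 3 * (\<Sum>k\<in>UNIV. h$k$k * (- 2 * (v k y * \<phi> k r' y) * \<phi> k r y + v k y * \<psi> k r r' y))
    - 2 * (\<Sum>k\<in>UNIV. h$r$k * (- 2 * (v k y * \<phi> k r' y) * \<phi> r k y + v k y * \<psi> r k r' y))
    - a$9$10$11 * (- 2 * (\<kappa> y ^ 3 * l' r' y) * b' r y + \<kappa> y ^ 3 * b'' r r' y))"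
    by (rule has_grad_diff has_grad_cmult has_grad_sum has_grad_mult grad_v grad_\<phi> grad_\<kappa> grad_b)+
  from pd_cong_open[OF open_U y first_jet_variation[OF _ h a r] this] show ?thesis .
qed

text \<open>The second jet variation is algebraic in the inverse metric. Two more derivatives
  therefore reach only \<open>\<psi>\<close>, and the regularity of C2 fields suffices.\<close>

lemma pd_pd_second_jet_variation:
  assumes y: "y \<in> U" and h: "transpose h = h" and r: "r \<in> {1,2}"
  shows "pd r (pd s (\<lambda>y. dir_deriv (\<lambda>q. sugra_lagrangian c (u y) (grad u y) q) (grad (grad u) y) (axis r (axis s (h, a))))) y =
    h$r$s * (- 2 * (- 2 * (v s y * \<phi> s r y) * \<phi> s s y + v s y * \<psi> s s r y))
    - (if r = s then \<Sum>k\<in>UNIV. h$k$k * (- 2 * (- 2 * (v k y * \<phi> k r y) * \<phi> k s y + v k y * \<psi> k s r y)) else 0)"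
proof -
  have 1: "pd s (\<lambda>y. dir_deriv (\<lambda>q. sugra_lagrangian c (u y) (grad u y) q) (grad (grad u) y) (axis r (axis s (h, a)))) y
    = h$r$s * (- 2 * (v s y * \<phi> s s y)) - (if r = s then \<Sum>k\<in>UNIV. h$k$k * (- 2 * (v k y * \<phi> k s y)) else 0)"
    if "y \<in> U" for y
  proof -
    have "has_grad U (\<lambda>y. h$r$s * v s y - (if r = s then \<Sum>k\<in>UNIV. h$k$k * v k y else 0))
       (\<lambda>s' y. h$r$s * (- 2 * (v s y * \<phi> s s' y)) - (if r = s then \<Sum>k\<in>UNIV. h$k$k * (- 2 * (v k y * \<phi> k s' y)) else 0))"
      by (cases "r = s"; simp only: if_True if_False refl;
          (rule has_grad_diff has_grad_cmult has_grad_sum has_grad_const grad_v)+)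
    from pd_cong_open[OF open_U that second_jet_variation[OF _ h r] this] show ?thesis .
  qed
  have "has_grad U (\<lambda>y. h$r$s * (- 2 * (v s y * \<phi> s s y)) - (if r = s then \<Sum>k\<in>UNIV. h$k$k * (- 2 * (v k y * \<phi> k s y)) else 0))
      (\<lambda>r' y. h$r$s * (- 2 * (- 2 * (v s y * \<phi> s r' y) * \<phi> s s y + v s y * \<psi> s s r' y))
       - (if r = s then \<Sum>k\<in>UNIV. h$k$k * (- 2 * (- 2 * (v k y * \<phi> k r' y) * \<phi> k s y + v k y * \<psi> k s r' y)) else 0))"
    by (cases "r = s"; simp only: if_True if_False refl;
        (rule has_grad_diff has_grad_cmult has_grad_sum has_grad_const grad_v has_grad_mult grad_\<phi>)+)
  from pd_cong_open[OF open_U y 1 this] show ?thesis .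
qed

lemma euler_lagrange_zero:
  assumes y: "y \<in> U" and h: "transpose h = h" and a: "antisymmetric a"
  shows "euler_lagrange (sugra_lagrangian c) u (h, a) y = 0"
proof -
  let ?N = "\<lambda>r y. dir_deriv (\<lambda>p. sugra_lagrangian c (u y) p (grad (grad u) y)) (grad u y) (axis r (h, a))"
  let ?M = "\<lambda>r s y. dir_deriv (\<lambda>q. sugra_lagrangian c (u y) (grad u y) q) (grad (grad u) y) (axis r (axis s (h, a)))"
  let ?D = "dir_deriv (\<lambda>w. sugra_lagrangian c w (grad u y) (grad (grad u) y)) (u y) (h, a)"
  have hs: "h$i$j = h$j$i" for i j using arg_cong[OF h, of "\<lambda>M. M$j$i"] by (simp add: transpose_def)
  have pN: "planar (?N r)" for r
    by (rule planar_fields[of "\<lambda>u u' u''. dir_deriv (\<lambda>p. sugra_lagrangian c u p u'') u' (axis r (h, a))"])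
  have pM: "planar (?M r s)" for r s
    by (rule planar_fields[of "\<lambda>u u' u''. dir_deriv (\<lambda>q. sugra_lagrangian c u u' q) u'' (axis r (axis s (h, a)))"])
  have N: "pd r (?N r) y = 0" if "r \<notin> {1,2}" for r
    by (rule pd_planar_zero[OF pN that])
  have M1: "pd r (pd s (?M r s)) y = 0" if "r \<notin> {1,2}" for r s
    by (rule pd_planar_zero[OF planar_pd[OF pM] that])
  have "pd s (?M r s) = (\<lambda>_. 0)" if "s \<notin> {1,2}" for r s
    using pd_planar_zero[OF pM that] by blast
  then have M2: "pd r (pd s (?M r s)) y = 0" if "s \<notin> {1,2}" for r s
    using that by (simp add: pd_zero)
  have EL: "euler_lagrange (sugra_lagrangian c) u (h, a) y = ?D - (pd 1 (?N 1) y + pd 2 (?N 2) y)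
    + (pd 1 (pd 1 (?M 1 1)) y + pd 1 (pd 2 (?M 1 2)) y + (pd 2 (pd 1 (?M 2 1)) y + pd 2 (pd 2 (?M 2 2)) y))"
  proof -
    have "(\<Sum>r\<in>UNIV. pd r (?N r) y) = pd 1 (?N 1) y + pd 2 (?N 2) y"
      by (rule sum_zero_outside) (rule N)
    moreover have "(\<Sum>s\<in>UNIV. pd r (pd s (?M r s)) y) = pd r (pd 1 (?M r 1)) y + pd r (pd 2 (?M r 2)) y" for r
      by (rule sum_zero_outside) (rule M2)
    moreover have "(\<Sum>r\<in>UNIV. pd r (pd 1 (?M r 1)) y + pd r (pd 2 (?M r 2)) y)
        = pd 1 (pd 1 (?M 1 1)) y + pd 1 (pd 2 (?M 1 2)) y + (pd 2 (pd 1 (?M 2 1)) y + pd 2 (pd 2 (?M 2 2)) y)"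
      by (rule sum_zero_outside) (simp add: M1)
    ultimately show ?thesis unfolding euler_lagrange_def by simp
  qed
  \<comment> \<open>\<open>W k r\<close> is the derivative of \<open>v k * \<phi> k r\<close> in
    direction \<open>r\<close>, and \<open>V r s\<close> that of \<open>v 1 * \<phi> 1 s\<close>.
    Since \<open>v k\<close> has derivative -2 \<open>v k * \<phi> k r\<close>, \<open>H r\<close>
    is -1/2 times the second derivative in direction \<open>r\<close> of the sum of
    \<open>h$k$k * v k\<close>.\<close>
  define W where "W k r = v k y * \<psi> k r r y - 2 * (v k y * \<phi> k r y * \<phi> k r y)" for k r
  define V where "V r s = - 2 * (v 1 y * \<phi> 1 r y) * \<phi> 1 s y + v 1 y * \<psi> 1 s r y" for r s
  define H where "H r = (\<Sum>k\<in>UNIV. h$k$k * W k r)" for r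
  have D: "?D = H 1 + H 2"
  proof -
    interpret brane_fields "\<lambda>k. v k y" "\<lambda>k. \<gamma> k y" "\<lambda>k r. \<phi> k r y" "\<lambda>k r s. \<psi> k r s y"
      "\<chi> r. diagonal (\<lambda>k. \<gamma>' r k y)" "\<chi> s r. diagonal (\<lambda>k. \<gamma>'' r s k y)" "diagonal (\<lambda>k. v k y)"
      "\<chi> r. b' r y *\<^sub>R brane_potential 1" "\<lambda>r. b' r y" "\<kappa> y" "g y" "b y" "grad u y" "grad (grad u) y"
      by (rule brane_fields[OF y])
    show ?thesis
      unfolding u_eq[OF y] dir_deriv_fields brane_solution_at_point.metric_variation_value[OF brane_solution[OF y] sqrt_det[OF y]]
      by (simp add: H_def W_def sum.distrib[symmetric] algebra_simps power2_eq_square)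
  qed
  have PN: "pd r (?N r) y = 3 * H r - 2 * (h$r$1 * V r 1 + h$r$2 * V r 2)
      - a$9$10$11 * (- 2 * (\<kappa> y ^ 3 * l' r y) * b' r y + \<kappa> y ^ 3 * b'' r r y)" if r: "r \<in> {1,2}" for r
  proof -
    have "(\<Sum>k\<in>UNIV. h$r$k * (- 2 * (v k y * \<phi> k r y) * \<phi> r k y + v k y * \<psi> r k r y)) = h$r$1 * V r 1 + h$r$2 * V r 2"
      using r by (subst sum_zero_outside) (auto simp: \<phi>_zero[OF _ y] \<psi>_zero[OF _ y] V_def \<phi>_directions_equal)
    then show ?thesis unfolding pd_first_jet_variation[OF y h a r] H_def W_def by (simp add: algebra_simps)
  qed
  have PM: "pd r (pd s (?M r s)) y = - 2 * (h$r$s * V r s) + (if r = s then 2 * H r else 0)"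
    if r: "r \<in> {1,2}" and s: "s \<in> {1,2}" for r s
  proof -
    have "- 2 * (v s y * \<phi> s r y) * \<phi> s s y + v s y * \<psi> s s r y = V r s"
      using s by (auto simp: V_def \<phi>_directions_equal)
    then show ?thesis unfolding pd_pd_second_jet_variation[OF y h r] H_def W_def
      by (simp only:) (cases "r = s"; simp add: algebra_simps sum_distrib_left sum_subtractf sum_negf)
  qed
  obtain \<epsilon> :: real where "b' 1 y = - \<epsilon> * exp (l y) * l' 2 y" "b' 2 y = \<epsilon> * exp (l y) * l' 1 y"
    using b_l[OF y] by blast
  \<comment> \<open>The gradients of \<open>b\<close> and \<open>h\<close> are orthogonal; with
    \<open>b\<close> harmonic this gives the flux equation, the vanishing divergence of h^-2 times
    the gradient of \<open>b\<close>.\<close>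
  then have "l' 1 y * b' 1 y + l' 2 y * b' 2 y = 0" by simp
  then have flux: "(- 2 * (\<kappa> y ^ 3 * l' 1 y) * b' 1 y + \<kappa> y ^ 3 * b'' 1 1 y) + (- 2 * (\<kappa> y ^ 3 * l' 2 y) * b' 2 y + \<kappa> y ^ 3 * b'' 2 2 y) = 0"
    using laplace_b[OF y] by algebra
  have P: "pd 1 (?N 1) y + pd 2 (?N 2) y = 3 * (H 1 + H 2) - 2 * (h$1$1 * V 1 1 + h$1$2 * V 1 2 + h$2$1 * V 2 1 + h$2$2 * V 2 2)"
    using flux PN[of 1] PN[of 2] by (simp only: insert_iff simp_thms) algebra
  \<comment> \<open>The coefficients of \<open>H 1 + H 2\<close> are 1, -3 and 2, and those of the
    terms with \<open>V\<close> are +2 and -2.\<close>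
  show ?thesis
    unfolding EL D P using PM[of 1 1] PM[of 1 2] PM[of 2 1] PM[of 2 2] by simp
qed

end

section \<open>Configurations built from holomorphic functions\<close>

definition zeta :: "point \<Rightarrow> complex" where
  "zeta x = Complex (x$1) (x$2)"

text \<open>The partial derivatives of x1 + i x2, so that the chain rule for a holomorphic function
  becomes multiplication by \<open>dzeta r\<close>.\<close>

definition dzeta :: "11 \<Rightarrow> complex" where
  "dzeta r = (if r = 1 then 1 else if r = 2 then \<i> else 0)"

lemma has_derivative_zeta: "(zeta has_derivative (\<lambda>w. \<Sum>r\<in>UNIV. w$r *\<^sub>R dzeta r)) (at x)"
proof -
  have z: "zeta = (\<lambda>x. \<Sum>r\<in>UNIV. x$r *\<^sub>R dzeta r)"
    by (simp add: fun_eq_iff zeta_def dzeta_def sum_11 complex_eq_iff)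
  show ?thesis unfolding z
    by (intro bounded_linear_imp_has_derivative bounded_linear_sum
        bounded_linear_compose[OF bounded_linear_scaleR_left bounded_linear_vec_nth])
qed

lemma open_zeta_vimage: "open D \<Longrightarrow> open {x. zeta x \<in> D}"
  using continuous_open_vimage[of D zeta] has_derivative_continuous[OF has_derivative_zeta]
  by (simp add: vimage_def)

lemma has_grad_holomorphic:
  assumes "open D" "W holomorphic_on D"
  shows "has_grad {x. zeta x \<in> D} (\<lambda>x. W (zeta x)) (\<lambda>r x. dzeta r * deriv W (zeta x))"
  unfolding has_grad_def
proof
  fix x assume "x \<in> {x. zeta x \<in> D}"
  then have "(W has_field_derivative deriv W (zeta x)) (at (zeta x))"
    using assms by (simp add: holomorphic_derivI)
  from has_derivative_compose[OF has_derivative_zeta this[unfolded has_field_derivative_def]]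
  show "((\<lambda>x. W (zeta x)) has_derivative (\<lambda>w. \<Sum>r\<in>UNIV. w $ r *\<^sub>R (dzeta r * deriv W (zeta x)))) (at x)"
    by (simp add: sum_distrib_left mult_ac)
qed

lemma continuous_on_zeta: "continuous_on S zeta"
  by (meson has_derivative_zeta has_derivative_at_withinI has_derivative_continuous_on)

lemma continuous_on_holomorphic_zeta:
  assumes "W holomorphic_on D"
  shows "continuous_on {x. zeta x \<in> D} (\<lambda>x. W (zeta x))"
  by (rule continuous_on_compose2[OF holomorphic_on_imp_continuous_on[OF assms] continuous_on_zeta]) auto

definition brane_sign :: "real \<Rightarrow> real \<Rightarrow> 11 \<Rightarrow> real" where
  "brane_sign \<sigma> \<tau> k = (if k \<in> {1,2,9,10,11} then 1 else if k = 3 then \<sigma> else \<tau>)"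

lemma brane_metric_exp:
  "brane_metric (exp L) (exp l) \<sigma> \<tau> = diagonal (\<lambda>k. brane_sign \<sigma> \<tau> k * exp (2 * (weight_w k * L + weight_h k * l)))"
  by (simp add: vec_eq_iff brane_metric_def diagonal_def brane_sign_def weight_w_def weight_h_def powr_def exp_add field_simps)

context
  fixes D :: "complex set" and E F :: "complex \<Rightarrow> complex" and \<epsilon> \<sigma> \<tau> :: real
  assumes D: "open D" and E: "E holomorphic_on D" and F: "F holomorphic_on D"
    and E_pos: "\<And>z. z \<in> D \<Longrightarrow> Re (E z) > 0" and F_nz: "\<And>z. z \<in> D \<Longrightarrow> F z \<noteq> 0"
    and signs: "\<epsilon>\<^sup>2 = 1" "\<sigma>\<^sup>2 = 1" "\<tau>\<^sup>2 = 1"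
begin

lemma E_nz: "z \<in> D \<Longrightarrow> Re (E z) \<noteq> 0"
  using E_pos by fastforce

abbreviation "U \<equiv> {x. zeta x \<in> D}"
text \<open>The logarithmic derivative yields the gradient of ln |F|^2 on all of \<open>D\<close>,
  without choosing a holomorphic logarithm of \<open>F\<close>.\<close>

abbreviation "\<G> \<equiv> \<lambda>z. deriv F z / F z"

lemma brane_configuration_holomorphic:
  "brane_configuration U (\<lambda>x. ln ((cmod (F (zeta x)))\<^sup>2)) (\<lambda>x. ln (Re (E (zeta x)))) (\<lambda>x. \<epsilon> * Im (E (zeta x)))
    (\<lambda>r x. 2 * Re (dzeta r * \<G> (zeta x))) (\<lambda>r x. Re (dzeta r * deriv E (zeta x)) / Re (E (zeta x))) (\<lambda>r x. \<epsilon> * Im (dzeta r * deriv E (zeta x)))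
    (\<lambda>r s x. 2 * Re (dzeta r * (dzeta s * deriv \<G> (zeta x))))
    (\<lambda>r s x. Re (dzeta r * (dzeta s * deriv (deriv E) (zeta x))) / Re (E (zeta x))
      - Re (dzeta r * deriv E (zeta x)) * Re (dzeta s * deriv E (zeta x)) / (Re (E (zeta x)))\<^sup>2)
    (\<lambda>r s x. \<epsilon> * Im (dzeta r * (dzeta s * deriv (deriv E) (zeta x))))
    (brane_sign \<sigma> \<tau>)
    (\<lambda>x. brane_metric (Re (F (zeta x) * cnj (F (zeta x)))) (Re (E (zeta x))) \<sigma> \<tau>)
    (\<lambda>x. brane_potential (\<epsilon> * Im (E (zeta x))))"
proof
  note U = open_zeta_vimage[OF D]
  have dE: "deriv E holomorphic_on D" and dF: "deriv F holomorphic_on D" and ddE: "deriv (deriv E) holomorphic_on D"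
    using E F D by (simp_all add: holomorphic_deriv)
  have G: "\<G> holomorphic_on D" using dF F F_nz by (intro holomorphic_on_divide) auto
  then have dG: "deriv \<G> holomorphic_on D" using D by (simp add: holomorphic_deriv)
  note lin = has_grad_linear[OF bounded_linear_Re] has_grad_linear[OF bounded_linear_Im]
  note gE = has_grad_holomorphic[OF D E] and gF = has_grad_holomorphic[OF D F]
  have gE': "has_grad U (\<lambda>x. dzeta r * deriv E (zeta x)) (\<lambda>s x. dzeta r * (dzeta s * deriv (deriv E) (zeta x)))"
    and gG': "has_grad U (\<lambda>x. dzeta r * \<G> (zeta x)) (\<lambda>s x. dzeta r * (dzeta s * deriv \<G> (zeta x)))" for r
    by (rule has_grad_linear[OF bounded_linear_mult_right], rule has_grad_holomorphic[OF D], fact)+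
  have cm: "(cmod z)\<^sup>2 = Re z * Re z + Im z * Im z" for z
    unfolding cmod_power2 by (simp add: power2_eq_square)
  show "open U" by (rule U)
  show "has_grad U (\<lambda>x. ln ((cmod (F (zeta x)))\<^sup>2)) (\<lambda>r x. 2 * Re (dzeta r * \<G> (zeta x)))"
  proof -
    have "has_grad U (\<lambda>x. Re (F (zeta x)) * Re (F (zeta x)) + Im (F (zeta x)) * Im (F (zeta x)))
       (\<lambda>r x. (Re (dzeta r * deriv F (zeta x)) * Re (F (zeta x)) + Re (F (zeta x)) * Re (dzeta r * deriv F (zeta x)))
         + (Im (dzeta r * deriv F (zeta x)) * Im (F (zeta x)) + Im (F (zeta x)) * Im (dzeta r * deriv F (zeta x))))"
      by (intro has_grad_add has_grad_mult lin gF)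
    then have "has_grad U (\<lambda>x. (cmod (F (zeta x)))\<^sup>2) (\<lambda>r x. 2 * Re (cnj (F (zeta x)) * (dzeta r * deriv F (zeta x))))"
      by (rule has_grad_cong[OF U]) (simp_all add: cm algebra_simps)
    then have "has_grad U (\<lambda>x. ln ((cmod (F (zeta x)))\<^sup>2))
       (\<lambda>r x. 1 / (cmod (F (zeta x)))\<^sup>2 * (2 * Re (cnj (F (zeta x)) * (dzeta r * deriv F (zeta x)))))"
      by (rule has_grad_chain) (use F_nz in \<open>auto intro!: derivative_eq_intros simp: field_simps\<close>)
    then show ?thesis
    proof (rule has_grad_cong[OF U])
      fix r x assume "x \<in> U"
      then have nz: "F (zeta x) \<noteq> 0" using F_nz by simp
      have "1 / (cmod (F (zeta x)))\<^sup>2 * Re (cnj (F (zeta x)) * (dzeta r * deriv F (zeta x)))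
        = Re (cnj (F (zeta x)) * (dzeta r * deriv F (zeta x)) / of_real ((cmod (F (zeta x)))\<^sup>2))"
        by (simp only: Re_divide_of_real) simp
      also have "cnj (F (zeta x)) * (dzeta r * deriv F (zeta x)) / of_real ((cmod (F (zeta x)))\<^sup>2) = dzeta r * \<G> (zeta x)"
        using nz by (simp only: complex_norm_square) (simp add: field_simps)
      finally show "1 / (cmod (F (zeta x)))\<^sup>2 * (2 * Re (cnj (F (zeta x)) * (dzeta r * deriv F (zeta x)))) = 2 * Re (dzeta r * \<G> (zeta x))"
        by (simp only: mult.left_commute[of _ 2])
    qed simp
  qed
  show "has_grad U (\<lambda>x. 2 * Re (dzeta r * \<G> (zeta x))) (\<lambda>s x. 2 * Re (dzeta r * (dzeta s * deriv \<G> (zeta x))))" for r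
    by (intro has_grad_cmult lin gG')
  have cont: "continuous_on U (\<lambda>x. deriv \<G> (zeta x))" "continuous_on U (\<lambda>x. deriv (deriv E) (zeta x))"
     "continuous_on U (\<lambda>x. deriv E (zeta x))" "continuous_on U (\<lambda>x. E (zeta x))"
    by (rule continuous_on_holomorphic_zeta, fact)+
  show "continuous_on U (\<lambda>x. 2 * Re (dzeta r * (dzeta s * deriv \<G> (zeta x))))" for r s
    by (intro continuous_intros cont)
  show "has_grad U (\<lambda>x. ln (Re (E (zeta x)))) (\<lambda>r x. Re (dzeta r * deriv E (zeta x)) / Re (E (zeta x)))"
  proof -
    have "has_grad U (\<lambda>x. ln (Re (E (zeta x)))) (\<lambda>r x. 1 / Re (E (zeta x)) * Re (dzeta r * deriv E (zeta x)))"
      by (rule has_grad_chain[OF lin(1)[OF gE]]) (use E_pos in \<open>auto intro!: derivative_eq_intros\<close>)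
    then show ?thesis by (rule has_grad_cong[OF U]) simp_all
  qed
  show "has_grad U (\<lambda>x. Re (dzeta r * deriv E (zeta x)) / Re (E (zeta x)))
      (\<lambda>s x. Re (dzeta r * (dzeta s * deriv (deriv E) (zeta x))) / Re (E (zeta x))
      - Re (dzeta r * deriv E (zeta x)) * Re (dzeta s * deriv E (zeta x)) / (Re (E (zeta x)))\<^sup>2)" for r
  proof -
    have "has_grad U (\<lambda>x. inverse (Re (E (zeta x)))) (\<lambda>s x. - (1 / (Re (E (zeta x)))\<^sup>2) * Re (dzeta s * deriv E (zeta x)))"
      by (rule has_grad_chain[OF lin(1)[OF gE]])
        (use E_nz in \<open>auto intro!: derivative_eq_intros simp: power2_eq_square field_simps\<close>)
    from has_grad_mult[OF lin(1)[OF gE'] this] show ?thesis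
      by (rule has_grad_cong[OF U]) (simp_all add: divide_inverse mult_ac)
  qed
  show "continuous_on U (\<lambda>x. Re (dzeta r * (dzeta s * deriv (deriv E) (zeta x))) / Re (E (zeta x))
      - Re (dzeta r * deriv E (zeta x)) * Re (dzeta s * deriv E (zeta x)) / (Re (E (zeta x)))\<^sup>2)" for r s
    by (intro continuous_intros cont) (use E_nz in auto)
  show "has_grad U (\<lambda>x. \<epsilon> * Im (E (zeta x))) (\<lambda>r x. \<epsilon> * Im (dzeta r * deriv E (zeta x)))"
    by (intro has_grad_cmult lin gE)
  show "has_grad U (\<lambda>x. \<epsilon> * Im (dzeta r * deriv E (zeta x))) (\<lambda>s x. \<epsilon> * Im (dzeta r * (dzeta s * deriv (deriv E) (zeta x))))" for r
    by (intro has_grad_cmult lin gE')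
  show "continuous_on U (\<lambda>x. \<epsilon> * Im (dzeta r * (dzeta s * deriv (deriv E) (zeta x))))" for r s
    by (intro continuous_intros cont)
  show "brane_metric (Re (F (zeta y) * cnj (F (zeta y)))) (Re (E (zeta y))) \<sigma> \<tau> =
      diagonal (\<lambda>k. brane_sign \<sigma> \<tau> k * exp (2 * (weight_w k * ln ((cmod (F (zeta y)))\<^sup>2) + weight_h k * ln (Re (E (zeta y))))))"
    if "y \<in> U" for y
  proof -
    have "Re (F (zeta y) * cnj (F (zeta y))) = exp (ln ((cmod (F (zeta y)))\<^sup>2))" "Re (E (zeta y)) = exp (ln (Re (E (zeta y))))"
      using that F_nz[of "zeta y"] E_pos[of "zeta y"]
      by (simp_all only: complex_norm_square[symmetric] Re_complex_of_real) simp_all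
    then show ?thesis using brane_metric_exp by metis
  qed
  show "\<exists>\<epsilon>'::real. \<epsilon>'\<^sup>2 = 1 \<and> \<epsilon> * Im (dzeta 1 * deriv E (zeta y)) = - \<epsilon>' * exp (ln (Re (E (zeta y)))) * (Re (dzeta 2 * deriv E (zeta y)) / Re (E (zeta y)))
      \<and> \<epsilon> * Im (dzeta 2 * deriv E (zeta y)) = \<epsilon>' * exp (ln (Re (E (zeta y)))) * (Re (dzeta 1 * deriv E (zeta y)) / Re (E (zeta y)))"
    if "y \<in> U" for y
    \<comment> \<open>The witness is the sign of the potential itself. Multiplication by
      \<open>Re (E z)\<close> removes the denominator of the gradient of \<open>ln h\<close>, and
      the rest is Im w = - Re (i w) and Im (i w) = Re w.\<close>
    using that E_pos[of "zeta y"] signs by (intro exI[of _ \<epsilon>]) (simp add: dzeta_def)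
  show "(brane_sign \<sigma> \<tau> k)\<^sup>2 = 1" for k using signs by (simp add: brane_sign_def)
  show "planar (\<lambda>x. brane_metric (Re (F (zeta x) * cnj (F (zeta x)))) (Re (E (zeta x))) \<sigma> \<tau>)"
    "planar (\<lambda>x. brane_potential (\<epsilon> * Im (E (zeta x))))"
    unfolding planar_def zeta_def by simp_all
\<comment> \<open>All three Laplace identities come from 1 + i^2 = 0; for \<open>ln h\<close> the
  squared gradient remains from differentiating the denominator.\<close>
qed (auto simp: dzeta_def brane_sign_def power2_eq_square add_divide_distrib mult_ac)


lemma brane_solves_field_equations:
  defines "g \<equiv> \<lambda>x. brane_metric (Re (F (zeta x) * cnj (F (zeta x)))) (Re (E (zeta x))) \<sigma> \<tau>"
    and "A \<equiv> \<lambda>x. brane_potential (\<epsilon> * Im (E (zeta x)))"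
  shows "C2_on U g" "C2_on U A"
    and "x \<in> U \<Longrightarrow> transpose h = h \<Longrightarrow> antisymmetric a \<Longrightarrow>
      euler_lagrange (sugra_lagrangian c) (\<lambda>y. (g y, A y)) (h, a) x = 0"
proof -
  note B = brane_configuration_holomorphic
  show "C2_on U g" unfolding g_def by (rule brane_configuration.C2_g[OF B])
  show "C2_on U A" unfolding A_def by (rule brane_configuration.C2_A[OF B])
  assume "x \<in> U" "transpose h = h" "antisymmetric a"
  from brane_configuration.euler_lagrange_zero[OF B this]
  show "euler_lagrange (sugra_lagrangian c) (\<lambda>y. (g y, A y)) (h, a) x = 0"
    unfolding brane_configuration.u_def[OF B] g_def A_def .
qed

end

section \<open>Signature and time directions\<close>

lemma brane_metric_signature:
  assumes w: "w > 0" and h: "h > 0"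
  shows "has_signature (brane_metric w h (-1) 1) 1 10" "time_directions (brane_metric w h (-1) 1) = {3}"
    "has_signature (brane_metric w h 1 (-1)) 5 6" "time_directions (brane_metric w h 1 (-1)) = {4, 5, 6, 7, 8}"
proof -
  have p: "h powr z > 0" for z using h by simp
  have t: "transpose (brane_metric w h \<sigma> \<tau>) = brane_metric w h \<sigma> \<tau>" for \<sigma> \<tau>
    by (simp add: transpose_def brane_metric_def vec_eq_iff)
  have sig: "has_signature (brane_metric w h \<sigma> \<tau>) m n"
    if "card {i. brane_metric w h \<sigma> \<tau> $ i $ i < 0} = m" "card {i. brane_metric w h \<sigma> \<tau> $ i $ i > 0} = n" for \<sigma> \<tau> m n
    unfolding has_signature_def
  proof (intro conjI t)
    have "invertible (mat 1 :: metric)" unfolding invertible_def by (intro exI[of _ "mat 1"]) simp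
    moreover have "brane_metric w h \<sigma> \<tau> $ i $ j = 0" if "i \<noteq> j" for i j
      using that by (simp add: brane_metric_def)
    ultimately show "\<exists>P D :: metric. invertible P \<and> transpose P ** brane_metric w h \<sigma> \<tau> ** P = D
        \<and> (\<forall>i j. i \<noteq> j \<longrightarrow> D $ i $ j = 0) \<and> card {i. D $ i $ i < 0} = m \<and> card {i. 0 < D $ i $ i} = n"
      using that by (intro exI[of _ "mat 1"] exI[of _ "brane_metric w h \<sigma> \<tau>"]) (simp add: transpose_mat)
  qed
  have nz: "brane_metric w h \<sigma> \<tau> $ i $ i > 0" if "i \<in> {1,2,9,10,11}" for \<sigma> \<tau> i
    using that w h by (auto simp: brane_metric_def)
  have eq: "brane_metric w h \<sigma> \<tau> $ i $ i = (if i = 3 then \<sigma> else \<tau>) * h powr (-1/3)" if "i \<notin> {1,2,9,10,11}" for \<sigma> \<tau> i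
    using that by (auto simp: brane_metric_def)
  have U: "i \<in> {1,2,9,10,11} \<or> i = 3 \<or> i \<in> {4,5,6,7,8}" for i :: 11
    using UNIV_I[of i] unfolding UNIV_11 by blast
  have A: "{i. brane_metric w h (-1) 1 $ i $ i < 0} = {3}" "{i. brane_metric w h (-1) 1 $ i $ i > 0} = {1,2,9,10,11,4,5,6,7,8}"
  proof -
    have "brane_metric w h (-1) 1 $ i $ i < 0 \<longleftrightarrow> i = 3" "brane_metric w h (-1) 1 $ i $ i > 0 \<longleftrightarrow> i \<noteq> 3" for i
      using nz[of i "-1" 1] eq[of i "-1" 1] p[of "-1/3"] by (cases "i \<in> {1,2,9,10,11}"; auto)+
    then show "{i. brane_metric w h (-1) 1 $ i $ i < 0} = {3}" "{i. brane_metric w h (-1) 1 $ i $ i > 0} = {1,2,9,10,11,4,5,6,7,8}"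
      using U by auto
  qed
  have B: "{i. brane_metric w h 1 (-1) $ i $ i < 0} = {4,5,6,7,8}" "{i. brane_metric w h 1 (-1) $ i $ i > 0} = {1,2,9,10,11,3}"
  proof -
    have "brane_metric w h 1 (-1) $ i $ i < 0 \<longleftrightarrow> i \<in> {4,5,6,7,8}" "brane_metric w h 1 (-1) $ i $ i > 0 \<longleftrightarrow> i \<notin> {4,5,6,7,8}" for i
      using nz[of i 1 "-1"] eq[of i 1 "-1"] p[of "-1/3"] U[of i] by (cases "i \<in> {1,2,9,10,11}"; auto)+
    then show "{i. brane_metric w h 1 (-1) $ i $ i < 0} = {4,5,6,7,8}" "{i. brane_metric w h 1 (-1) $ i $ i > 0} = {1,2,9,10,11,3}"
      using U by auto
  qed
  show "has_signature (brane_metric w h (-1) 1) 1 10" by (rule sig) (simp_all add: A)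
  show "has_signature (brane_metric w h 1 (-1)) 5 6" by (rule sig) (simp_all add: B)
  show "time_directions (brane_metric w h (-1) 1) = {3}" "time_directions (brane_metric w h 1 (-1)) = {4, 5, 6, 7, 8}"
    unfolding time_directions_def by (rule A B)+
qed

lemma sugra_solution_holomorphic:
  assumes "open D" "E holomorphic_on D" "F holomorphic_on D"
    and pos: "\<And>z. z \<in> D \<Longrightarrow> Re (E z) > 0" and nz: "\<And>z. z \<in> D \<Longrightarrow> F z \<noteq> 0" and "\<epsilon>\<^sup>2 = 1"
  shows "sugra_solution 1 10 c {x. zeta x \<in> D} (\<lambda>x. brane_metric (Re (F (zeta x) * cnj (F (zeta x)))) (Re (E (zeta x))) (-1) 1)
      (\<lambda>x. brane_potential (\<epsilon> * Im (E (zeta x))))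
    \<and> (\<forall>x\<in>{x. zeta x \<in> D}. time_directions (brane_metric (Re (F (zeta x) * cnj (F (zeta x)))) (Re (E (zeta x))) (-1) 1) = {3})"
    and "sugra_solution 5 6 c {x. zeta x \<in> D} (\<lambda>x. brane_metric (Re (F (zeta x) * cnj (F (zeta x)))) (Re (E (zeta x))) 1 (-1))
      (\<lambda>x. brane_potential (\<epsilon> * Im (E (zeta x))))
    \<and> (\<forall>x\<in>{x. zeta x \<in> D}. time_directions (brane_metric (Re (F (zeta x) * cnj (F (zeta x)))) (Re (E (zeta x))) 1 (-1)) = {4, 5, 6, 7, 8})"
proof -
  have w: "Re (F z * cnj (F z)) > 0" if "z \<in> D" for z
    using nz[OF that] by (simp add: complex_neq_0 power2_eq_square)
  note S = brane_metric_signature[OF w pos]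
  have s: "(-1::real)\<^sup>2 = 1" "(1::real)\<^sup>2 = 1" by simp_all
  show "sugra_solution 1 10 c {x. zeta x \<in> D} (\<lambda>x. brane_metric (Re (F (zeta x) * cnj (F (zeta x)))) (Re (E (zeta x))) (-1) 1)
      (\<lambda>x. brane_potential (\<epsilon> * Im (E (zeta x))))
    \<and> (\<forall>x\<in>{x. zeta x \<in> D}. time_directions (brane_metric (Re (F (zeta x) * cnj (F (zeta x)))) (Re (E (zeta x))) (-1) 1) = {3})"
    unfolding sugra_solution_def
    using S(1,2) brane_solves_field_equations[OF assms s] antisymmetric_brane_potential by blast
  show "sugra_solution 5 6 c {x. zeta x \<in> D} (\<lambda>x. brane_metric (Re (F (zeta x) * cnj (F (zeta x)))) (Re (E (zeta x))) 1 (-1))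
      (\<lambda>x. brane_potential (\<epsilon> * Im (E (zeta x))))
    \<and> (\<forall>x\<in>{x. zeta x \<in> D}. time_directions (brane_metric (Re (F (zeta x) * cnj (F (zeta x)))) (Re (E (zeta x))) 1 (-1)) = {4, 5, 6, 7, 8})"
    unfolding sugra_solution_def
    using S(3,4) brane_solves_field_equations[OF assms s(2,1)] antisymmetric_brane_potential by blast
qed

section \<open>Conjugate harmonic functions and the recursion\<close>

lemma conjugate_harmonic_holomorphic:
  assumes "conjugate_harmonic \<Omega> H B" "open \<Omega>"
  shows "(\<lambda>z. Complex (H (Re z, Im z)) (B (Re z, Im z))) holomorphic_on {z. (Re z, Im z) \<in> \<Omega>}"
proof (rule holomorphic_onI)
  fix z assume "z \<in> {z. (Re z, Im z) \<in> \<Omega>}"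
  then have z: "(Re z, Im z) \<in> \<Omega>" by simp
  then obtain H' B' where H': "(H has_derivative H') (at (Re z, Im z))" and B': "(B has_derivative B') (at (Re z, Im z))"
    using assms(1) unfolding conjugate_harmonic_def differentiable_def by blast
  interpret H': bounded_linear H' using H' by (rule has_derivative_bounded_linear)
  interpret B': bounded_linear B' using B' by (rule has_derivative_bounded_linear)
  have CR: "H' (1, 0) = B' (0, 1)" "H' (0, 1) = - B' (1, 0)"
    using assms(1)[unfolded conjugate_harmonic_def, rule_format, OF z]
    by (simp_all add: dir_deriv_has_derivative[OF H'] dir_deriv_has_derivative[OF B'])
  have lin: "f (a, b) = a * f (1, 0) + b * f (0, 1)" if "bounded_linear f" for f :: "real \<times> real \<Rightarrow> real" and a b
  proof -
    interpret bounded_linear f by fact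
    have "(a, b) = a *\<^sub>R (1, 0) + b *\<^sub>R (0, 1)" by simp
    then show ?thesis by (metis add scaleR real_scaleR_def)
  qed
  have "((\<lambda>z. (Re z, Im z)) has_derivative (\<lambda>w. (Re w, Im w))) (at z)"
    by (auto intro!: derivative_eq_intros)
  from has_derivative_compose[OF this H'] has_derivative_compose[OF this B']
  have "((\<lambda>z. of_real (H (Re z, Im z)) + \<i> * of_real (B (Re z, Im z))) has_derivative
      (\<lambda>w. of_real (H' (Re w, Im w)) + \<i> * of_real (B' (Re w, Im w)))) (at z)"
    by (auto intro!: derivative_eq_intros)
  \<comment> \<open>The Cauchy-Riemann equations say exactly that the real derivative is
    multiplication by one complex number, read off from its first column.\<close>
  moreover have "of_real (H' (Re w, Im w)) + \<i> * of_real (B' (Re w, Im w)) = Complex (H' (1, 0)) (B' (1, 0)) * w" for w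
    unfolding lin[OF H'.bounded_linear_axioms, of "Re w"] lin[OF B'.bounded_linear_axioms, of "Re w"]
    by (simp add: complex_eq_iff CR algebra_simps)
  ultimately have "((\<lambda>z. Complex (H (Re z, Im z)) (B (Re z, Im z))) has_field_derivative Complex (H' (1, 0)) (B' (1, 0))) (at z)"
    unfolding has_field_derivative_def Complex_eq by simp
  then show "(\<lambda>z. Complex (H (Re z, Im z)) (B (Re z, Im z))) field_differentiable at z within {z. (Re z, Im z) \<in> \<Omega>}"
    unfolding field_differentiable_def using has_field_derivative_at_within by blast
qed

text \<open>Computing the term with index \<open>p\<close> inverts earlier terms only, so
  nonvanishing is asked for indices below \<open>p\<close>. The index 0 is the constant
  default.\<close>

lemma holomorphic_\<E>:
  assumes "W holomorphic_on D" "\<And>z q. z \<in> D \<Longrightarrow> 1 \<le> q \<Longrightarrow> q < p \<Longrightarrow> \<E> (W z) q \<noteq> 0"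
  shows "(\<lambda>z. \<E> (W z) p) holomorphic_on D"
  using assms(2)
proof (induction p rule: less_induct)
  case (less p)
  consider "p = 0" | "p = 1" | k where "p = Suc (Suc k)"
    by (metis One_nat_def not0_implies_Suc)
  then show ?case
  proof cases
    case 3
    have "(\<lambda>z. \<E> (W z) (Suc k)) holomorphic_on D"
      using less.prems 3 by (intro less.IH) auto
    moreover have "\<E> (W z) (Suc k) \<noteq> 0" if "z \<in> D" for z
      using less.prems[OF that, of "Suc k"] 3 by simp
    ultimately show ?thesis
      unfolding 3 by (cases "even k") (auto intro!: holomorphic_intros)
  qed (use assms(1) in simp_all)
qed

lemma \<F>_nonzero:
  assumes "\<And>q. 1 \<le> q \<Longrightarrow> q < 2 * n \<Longrightarrow> \<E> w q \<noteq> 0"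
  shows "\<F> w n \<noteq> 0"
  using assms by (auto simp: \<F>_def)

lemma holomorphic_\<F>:
  assumes "W holomorphic_on D" "\<And>z q. z \<in> D \<Longrightarrow> 1 \<le> q \<Longrightarrow> q < 2 * n \<Longrightarrow> \<E> (W z) q \<noteq> 0"
  shows "(\<lambda>z. \<F> (W z) n) holomorphic_on D"
  unfolding \<F>_def using assms(2)
  by (intro holomorphic_on_prod holomorphic_\<E>[OF assms(1)]) auto

theorem mainTheorem4:
  fixes \<Omega> :: "(real \<times> real) set"
    and H B :: "real \<times> real \<Rightarrow> real"
    and c :: real
    and U :: "point set"
    and e :: "point \<Rightarrow> complex"
  assumes "open \<Omega>"
    and "conjugate_harmonic \<Omega> H B"
    and U: "U = {x. (x$1, x$2) \<in> \<Omega>}"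
    and e: "e = (\<lambda>x. Complex (H (x$1, x$2)) (B (x$1, x$2)))"
  shows "(\<forall>n g A.
      (\<forall>x\<in>U. \<forall>p\<in>{1..2*n+1}. \<E> (e x) p \<noteq> 0) \<and>
      (\<forall>x\<in>U. Re (\<E> (e x) (2*n+1)) > 0) \<and>
      g = (\<lambda>x. brane_metric (Re (\<F> (e x) n * cnj (\<F> (e x) n))) (Re (\<E> (e x) (2*n+1)))
                 ((-1)^(n+1)) ((-1)^n)) \<and>
      A = (\<lambda>x. brane_potential ((-1)^n * Im (\<E> (e x) (2*n+1)))) \<longrightarrow>
      (if even n
       then sugra_solution 1 10 c U g A \<and> (\<forall>x\<in>U. time_directions (g x) = {3})
       else sugra_solution 5 6 c U g A \<and> (\<forall>x\<in>U. time_directions (g x) = {4, 5, 6, 7, 8})))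
    \<and> (\<forall>n g A. n > 0 \<and>
      (\<forall>x\<in>U. \<forall>p\<in>{1..2*n}. \<E> (e x) p \<noteq> 0) \<and>
      (\<forall>x\<in>U. Re (\<E> (e x) (2*n)) > 0) \<and>
      g = (\<lambda>x. brane_metric (Re (\<F> (e x) n * cnj (\<F> (e x) n))) (Re (\<E> (e x) (2*n)))
                 ((-1)^n) ((-1)^(n+1))) \<and>
      A = (\<lambda>x. brane_potential ((-1)^(n+1) * Im (\<E> (e x) (2*n)))) \<longrightarrow>
      (if odd n
       then sugra_solution 1 10 c U g A \<and> (\<forall>x\<in>U. time_directions (g x) = {3})
       else sugra_solution 5 6 c U g A \<and> (\<forall>x\<in>U. time_directions (g x) = {4, 5, 6, 7, 8})))"
proof -
  define D where "D = {z. (Re z, Im z) \<in> \<Omega>}"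
  define W where "W z = Complex (H (Re z, Im z)) (B (Re z, Im z))" for z
  have W: "W holomorphic_on D"
    unfolding W_def D_def using assms(2,1) by (rule conjugate_harmonic_holomorphic)
  have D: "open D"
    unfolding D_def using continuous_open_vimage[OF assms(1), of "\<lambda>z. (Re z, Im z)"]
    by (auto simp: vimage_def intro!: continuous_intros)
  have U_eq: "U = {x. zeta x \<in> D}" unfolding U D_def zeta_def by simp
  have e_eq: "e = (\<lambda>x. W (zeta x))" unfolding e W_def zeta_def by simp
  \<comment> \<open>Every \<open>z\<close> in \<open>D\<close> is \<open>zeta\<close> of some point
    of \<open>U\<close>; this carries hypotheses over \<open>U\<close> to \<open>D\<close>, where
    holomorphy is argued.\<close>
  have pull: "P (W z)" if P: "\<forall>x\<in>U. P (e x)" and z: "z \<in> D" for P z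
  proof -
    define x :: point where "x = (\<chi> i. if i = 1 then Re z else if i = 2 then Im z else 0)"
    have x: "zeta x = z" by (simp add: x_def zeta_def)
    with z have "x \<in> U" by (simp add: U_eq)
    with P have "P (e x)" by blast
    then show ?thesis by (simp add: e_eq x)
  qed
  have sq: "((-1::real)^k)\<^sup>2 = 1" for k by (simp flip: power_mult)
  \<comment> \<open>Both parts are instances: \<open>p = 2 * n + 1\<close>,
    \<open>m = n + 1\<close>, \<open>k = n\<close> for the first and \<open>p = 2 * n\<close>,
    \<open>m = n\<close>, \<open>k = n + 1\<close> for the second. The condition
    \<open>2 * n \<le> p\<close> covers all factors of \<open>\<F>\<close>.\<close>
  have main: "if odd m
       then sugra_solution 1 10 c U g A \<and> (\<forall>x\<in>U. time_directions (g x) = {3})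
       else sugra_solution 5 6 c U g A \<and> (\<forall>x\<in>U. time_directions (g x) = {4, 5, 6, 7, 8})"
    if nz: "\<forall>x\<in>U. \<forall>q\<in>{1..p}. \<E> (e x) q \<noteq> 0" and pos: "\<forall>x\<in>U. Re (\<E> (e x) p) > 0" and p: "2 * n \<le> p"
      and g: "g = (\<lambda>x. brane_metric (Re (\<F> (e x) n * cnj (\<F> (e x) n))) (Re (\<E> (e x) p)) ((-1)^m) ((-1)^(m+1)))"
      and A: "A = (\<lambda>x. brane_potential ((-1)^k * Im (\<E> (e x) p)))"
    for n m k p g A
  proof -
    have nz': "\<E> (W z) q \<noteq> 0" if "z \<in> D" "1 \<le> q" "q \<le> p" for z q
      using pull[OF nz that(1)] that(2,3) by simp
    have 1: "(\<lambda>z. \<E> (W z) p) holomorphic_on D"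
      by (rule holomorphic_\<E>[OF W]) (simp add: nz')
    have 2: "(\<lambda>z. \<F> (W z) n) holomorphic_on D"
      by (rule holomorphic_\<F>[OF W]) (use p nz' in simp)
    have 3: "Re (\<E> (W z) p) > 0" if "z \<in> D" for z
      using pull[OF pos that] .
    have 4: "\<F> (W z) n \<noteq> 0" if "z \<in> D" for z
      by (rule \<F>_nonzero) (use that p nz' in simp)
    note S = sugra_solution_holomorphic[OF D 1 2 3 4 sq, of c k]
    show ?thesis
      using S unfolding g A U_eq e_eq by (cases "odd m") simp_all
  qed
  show ?thesis
  proof (intro conjI allI impI; elim conjE)
    fix n g A
    assume "\<forall>x\<in>U. \<forall>p\<in>{1..2*n+1}. \<E> (e x) p \<noteq> 0" "\<forall>x\<in>U. Re (\<E> (e x) (2*n+1)) > 0"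
      and g: "g = (\<lambda>x. brane_metric (Re (\<F> (e x) n * cnj (\<F> (e x) n))) (Re (\<E> (e x) (2*n+1))) ((-1)^(n+1)) ((-1)^n))"
      and "A = (\<lambda>x. brane_potential ((-1)^n * Im (\<E> (e x) (2*n+1))))"
    \<comment> \<open>\<open>main\<close> expects the exponent of the second sign to be one above
      the first; adding 2 to it changes nothing.\<close>
    moreover have "g = (\<lambda>x. brane_metric (Re (\<F> (e x) n * cnj (\<F> (e x) n))) (Re (\<E> (e x) (2*n+1))) ((-1)^(n+1)) ((-1)^(n+1+1)))"
      unfolding g by simp
    ultimately show "if even n
       then sugra_solution 1 10 c U g A \<and> (\<forall>x\<in>U. time_directions (g x) = {3})
       else sugra_solution 5 6 c U g A \<and> (\<forall>x\<in>U. time_directions (g x) = {4, 5, 6, 7, 8})"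
      using main[of "2*n+1" n g "n+1" A n] by simp
  next
    fix n g A
    assume "\<forall>x\<in>U. \<forall>p\<in>{1..2*n}. \<E> (e x) p \<noteq> 0" "\<forall>x\<in>U. Re (\<E> (e x) (2*n)) > 0"
      "g = (\<lambda>x. brane_metric (Re (\<F> (e x) n * cnj (\<F> (e x) n))) (Re (\<E> (e x) (2*n))) ((-1)^n) ((-1)^(n+1)))"
      "A = (\<lambda>x. brane_potential ((-1)^(n+1) * Im (\<E> (e x) (2*n))))"
    then show "if odd n
       then sugra_solution 1 10 c U g A \<and> (\<forall>x\<in>U. time_directions (g x) = {3})
       else sugra_solution 5 6 c U g A \<and> (\<forall>x\<in>U. time_directions (g x) = {4, 5, 6, 7, 8})"
      using main[of "2*n" n g n A "n+1"] by simp
  qed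
qed

end
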